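(* Let $k\ge 1$, $i\in\{0,1\}$ and $0\le j\le k$. Then there is an isomorphism of $\widehat{\mathfrak{sl}}_2$-modules $$L_{i,1}\otimes L_{j,k}\simeq\lim_{n\to\infty}L_{(1^{2n+i-1}(j+1)),\,k+1}.$$
   Context: Let $e,h,f$ be the standard basis of $\mathfrak{sl}_2$, $x_i=x\otimes t^i$; $\widehat{\mathfrak{sl}}_2=\mathfrak{sl}_2\otimes\mathbb C[t,t^{-1}]\oplus\mathbb CK\oplus\mathbb Cd$, $K$ central, $[d,x_i]=-ix_i$. $L_{l,k}$ ($0\le l\le k$) is the irreducible integrable level $k$ highest weight module whose highest weight vector has $h_0$-eigenvalue $l$. For $\kappa\ge1$ and $\mathbf m\in\mathbb Z_{\ge0}^\kappa$, $L_{\mathbf m,\kappa}=L_{(1^{m_1}\cdots\kappa^{m_\kappa}),\kappa}$ is the integrable level $\kappa$ module obtained as the inductive limit of $\mathfrak{sl}_2\otimes\mathbb C[t]$-module embeddings $V_{(m_1,\ldots,m_\kappa)}\hookrightarrow V_{(m_1,\ldots,m_\kappa+2)}\hookrightarrow V_{(m_1,\ldots,m_\kappa+4)}\hookrightarrow\cdots$, where $V_{\mathbf m}$ is the fusion product of $m_a$ copies of the $(a+1)$-dimensional irreducible $\mathfrak{sl}_2$-module $\pi_a$, $a=1,\ldots,\kappa$ (the associated graded $\mathfrak{sl}_2\otimes\mathbb C[t]$-module of the tensor product of evaluation modules at pairwise distinct points, filtered by $t$-degree from the tensor product of lowest weight vectors). Explicitly: let $v(p)\in L_{0,1}\oplus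 L_{1,1}$ ($p\in\mathbb Z$) be the extremal vectors, $h_0v(p)=-pv(p)$, and $M_a=m_a+\cdots+m_\kappa$; then $V_{\mathbf m}\simeq U(\mathfrak{sl}_2\otimes\mathbb C[t])\cdot(v(M_1)\otimes\cdots\otimes v(M_\kappa))$ and $L_{\mathbf m,\kappa}\simeq U(\widehat{\mathfrak{sl}}_2)\cdot(v(M_1)\otimes\cdots\otimes v(M_\kappa))$ inside a tensor product of $\kappa$ level one modules. $(1^N(j+1))$ denotes the tuple $\mathbf m\in\mathbb Z_{\ge0}^{k+1}$ corresponding to $N$ copies of $\pi_1$ and one copy of $\pi_{j+1}$. Thus $L_{(1^{2n+i-1}(j+1)),k+1}\simeq U(\widehat{\mathfrak{sl}}_2)\cdot(v(2n+i)\otimes v(1)^{\otimes j}\otimes v(0)^{\otimes(k-j)})$, and the limit is the inductive limit along the inclusions of these submodules of $L_{i,1}\otimes L_{1,1}^{\otimes j}\otimes L_{0,1}^{\otimes(k-j)}$ for increasing $n$. *)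

theory Defs
  imports Complex_Main "HOL-Library.Poly_Mapping" "HOL-Library.Product_Plus"
begin

section \<open>Complex vector spaces\<close>

class complex_vector = ab_group_add +
  fixes scaleC :: "complex \<Rightarrow> 'a \<Rightarrow> 'a" (infixr "*\<^sub>C" 75)
  assumes scaleC_add_right: "c *\<^sub>C (x + y) = c *\<^sub>C x + c *\<^sub>C y"
    and scaleC_add_left: "(c + d) *\<^sub>C x = c *\<^sub>C x + d *\<^sub>C x"
    and scaleC_scaleC: "c *\<^sub>C d *\<^sub>C x = (c * d) *\<^sub>C x"
    and scaleC_one: "1 *\<^sub>C x = x"

global_interpretation cvs: vector_space "scaleC :: complex \<Rightarrow> 'a \<Rightarrow> 'a::complex_vector"
  by unfold_locales (simp_all add: scaleC_add_right scaleC_add_left scaleC_scaleC scaleC_one)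

global_interpretation cvs_pair: vector_space_pair
  "scaleC :: complex \<Rightarrow> 'a \<Rightarrow> 'a::complex_vector"
  "scaleC :: complex \<Rightarrow> 'b \<Rightarrow> 'b::complex_vector"
  by unfold_locales

abbreviation clinear :: "('a::complex_vector \<Rightarrow> 'b::complex_vector) \<Rightarrow> bool"
  where "clinear \<equiv> Vector_Spaces.linear scaleC scaleC"

lemma clinearI:
  assumes "\<And>x y. f (x + y) = f x + f y" and "\<And>c x. f (c *\<^sub>C x) = c *\<^sub>C f x"
  shows "clinear f"
  using assms by unfold_locales auto

instantiation complex :: complex_vector
begin
definition scaleC_complex_def: "scaleC = ((*) :: complex \<Rightarrow> _)"
instance by standard (simp_all add: scaleC_complex_def algebra_simps)
end

instantiation prod :: (complex_vector, complex_vector) complex_vector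
begin
definition scaleC_prod_def: "c *\<^sub>C x = (c *\<^sub>C fst x, c *\<^sub>C snd x)"
instance
  by standard (auto simp: scaleC_prod_def prod_eq_iff cvs.scale_right_distrib
      cvs.scale_left_distrib)
end

instantiation poly_mapping :: (type, complex_vector) complex_vector
begin
definition scaleC_poly_mapping_def: "c *\<^sub>C x = Poly_Mapping.map (scaleC c) x"
lemma lookup_scaleC:
  "Poly_Mapping.lookup (c *\<^sub>C x) b = c *\<^sub>C Poly_Mapping.lookup x b" for x :: "'a \<Rightarrow>\<^sub>0 'b"
  by (auto simp: scaleC_poly_mapping_def map.rep_eq when_def)
instance
  by standard (simp_all add: poly_mapping_eq_iff fun_eq_iff lookup_scaleC lookup_add
      scaleC_add_right scaleC_add_left scaleC_scaleC scaleC_one)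
end

text \<open>The linear extension of a map on the basis of a free vector space.\<close>

definition lin_ext :: "('b \<Rightarrow> 'x::complex_vector) \<Rightarrow> ('b \<Rightarrow>\<^sub>0 complex) \<Rightarrow> 'x"
  where "lin_ext f x = (\<Sum>b\<in>Poly_Mapping.keys x. Poly_Mapping.lookup x b *\<^sub>C f b)"

lemma lin_ext_superset:
  assumes "finite S" "Poly_Mapping.keys x \<subseteq> S"
  shows "lin_ext f x = (\<Sum>b\<in>S. Poly_Mapping.lookup x b *\<^sub>C f b)"
  unfolding lin_ext_def using assms
  by (intro sum.mono_neutral_left) (auto simp: in_keys_iff)

lemma lin_ext_linear: "clinear (lin_ext f)"
proof (rule clinearI)
  fix x y :: "'a \<Rightarrow>\<^sub>0 complex" and c :: complex
  let ?S = "Poly_Mapping.keys x \<union> Poly_Mapping.keys y"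
  have "Poly_Mapping.keys (x + y) \<subseteq> ?S" by (rule Poly_Mapping.keys_add)
  then show "lin_ext f (x + y) = lin_ext f x + lin_ext f y"
    by (simp add: lin_ext_superset[of ?S] lookup_add cvs.scale_left_distrib sum.distrib)
  have "Poly_Mapping.keys (c *\<^sub>C x) \<subseteq> Poly_Mapping.keys x" by (auto simp: in_keys_iff lookup_scaleC)
  then show "lin_ext f (c *\<^sub>C x) = c *\<^sub>C lin_ext f x"
    by (simp add: lin_ext_superset[of "Poly_Mapping.keys x"] lookup_scaleC cvs.scale_sum_right
        scaleC_complex_def)
qed

lemma lin_ext_single [simp]: "lin_ext f (Poly_Mapping.single b c) = c *\<^sub>C f b"
  by (cases "c = 0") (simp_all add: lin_ext_def)

lemma lin_ext_vanish_on_span: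
  assumes "\<And>r. r \<in> R \<Longrightarrow> lin_ext f r = 0" and "x \<in> cvs.span R"
  shows "lin_ext f x = 0"
  using cvs_pair.linear_eq_0_on_span[OF lin_ext_linear[of f], of R x] assms by blast

section \<open>Tensor products\<close>

abbreviation basis_vec :: "'b \<Rightarrow> ('b \<Rightarrow>\<^sub>0 complex)"
  where "basis_vec b \<equiv> Poly_Mapping.single b 1"

subsection \<open>The tensor product of two vector spaces\<close>

definition bilin_relations :: "(('v::complex_vector \<times> 'w::complex_vector) \<Rightarrow>\<^sub>0 complex) set"
  where "bilin_relations =
    {basis_vec (x + x', y) - basis_vec (x, y) - basis_vec (x', y) | x x' y. True} \<union>
    {basis_vec (x, y + y') - basis_vec (x, y) - basis_vec (x, y') | x y y'. True} \<union>
    {basis_vec (c *\<^sub>C x, y) - c *\<^sub>C basis_vec (x, y) | c x y. True} \<union>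
    {basis_vec (x, c *\<^sub>C y) - c *\<^sub>C basis_vec (x, y) | c x y. True}"

definition tensor_eq ::
    "(('v::complex_vector \<times> 'w::complex_vector) \<Rightarrow>\<^sub>0 complex) \<Rightarrow> (('v \<times> 'w) \<Rightarrow>\<^sub>0 complex) \<Rightarrow> bool"
  where "tensor_eq s t \<longleftrightarrow> s - t \<in> cvs.span bilin_relations"

lemma equivp_diff_in_span: "equivp (\<lambda>s t. s - t \<in> cvs.span R)"
proof (rule equivpI)
  show "reflp (\<lambda>s t. s - t \<in> cvs.span R)" by (auto simp: reflp_def cvs.span_zero)
  show "symp (\<lambda>s t. s - t \<in> cvs.span R)"
    by (auto simp: symp_def) (metis cvs.span_neg minus_diff_eq)
  show "transp (\<lambda>s t. s - t \<in> cvs.span R)"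
    by (auto simp: transp_def) (metis cvs.span_add diff_add_cancel add_diff_eq)
qed

lemma diff_in_span_add:
  "s - t \<in> cvs.span R \<Longrightarrow> s' - t' \<in> cvs.span R \<Longrightarrow> (s + s') - (t + t') \<in> cvs.span R"
  by (metis add_diff_add cvs.span_add)

lemma diff_in_span_diff:
  "s - t \<in> cvs.span R \<Longrightarrow> s' - t' \<in> cvs.span R \<Longrightarrow> (s - s') - (t - t') \<in> cvs.span R"
  using cvs.span_diff[of "s - t" R "s' - t'"] by (simp add: algebra_simps)

lemma diff_in_span_uminus:
  "s - t \<in> cvs.span R \<Longrightarrow> (- s) - (- t) \<in> cvs.span R"
  using cvs.span_neg[of "s - t" R] by simp

lemma diff_in_span_scale:
  "s - t \<in> cvs.span R \<Longrightarrow> c *\<^sub>C s - c *\<^sub>C t \<in> cvs.span R"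
  by (metis cvs.scale_right_diff_distrib cvs.span_scale)

quotient_type (overloaded) ('v, 'w) tensor = "('v::complex_vector \<times> 'w::complex_vector) \<Rightarrow>\<^sub>0 complex" / tensor_eq
  unfolding tensor_eq_def[abs_def] by (rule equivp_diff_in_span)

instantiation tensor :: (complex_vector, complex_vector) complex_vector
begin
lift_definition zero_tensor :: "('a, 'b) tensor" is 0 .
lift_definition plus_tensor :: "('a, 'b) tensor \<Rightarrow> ('a, 'b) tensor \<Rightarrow> ('a, 'b) tensor" is "(+)"
  unfolding tensor_eq_def by (rule diff_in_span_add)
lift_definition minus_tensor :: "('a, 'b) tensor \<Rightarrow> ('a, 'b) tensor \<Rightarrow> ('a, 'b) tensor" is "(-)"
  unfolding tensor_eq_def by (rule diff_in_span_diff)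
lift_definition uminus_tensor :: "('a, 'b) tensor \<Rightarrow> ('a, 'b) tensor" is uminus
  unfolding tensor_eq_def by (rule diff_in_span_uminus)
lift_definition scaleC_tensor :: "complex \<Rightarrow> ('a, 'b) tensor \<Rightarrow> ('a, 'b) tensor" is scaleC
  unfolding tensor_eq_def by (rule diff_in_span_scale)
instance
  by standard (transfer; simp add: tensor_eq_def algebra_simps cvs.span_zero cvs.scale_right_distrib
      cvs.scale_left_distrib)+
end

lift_definition tensor_pure :: "'v::complex_vector \<Rightarrow> 'w::complex_vector \<Rightarrow> ('v, 'w) tensor"
  is "\<lambda>x y. basis_vec (x, y)" .

text \<open>The linear map out of the tensor product that is induced by a bilinear map \<open>\<beta>\<close>; the choice of
  a representative is immaterial exactly when \<open>\<beta>\<close> is bilinear.\<close>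

definition tensor_lift ::
    "('v::complex_vector \<Rightarrow> 'w::complex_vector \<Rightarrow> 'x::complex_vector) \<Rightarrow> ('v, 'w) tensor \<Rightarrow> 'x"
  where "tensor_lift \<beta> t = lin_ext (\<lambda>(x, y). \<beta> x y) (rep_tensor t)"

lemma tensor_lift_abs:
  assumes "\<And>y. clinear (\<lambda>x. \<beta> x y)" and "\<And>x. clinear (\<beta> x)"
  shows "tensor_lift \<beta> (abs_tensor s) = lin_ext (\<lambda>(x, y). \<beta> x y) s"
proof -
  let ?L = "lin_ext (\<lambda>(x, y). \<beta> x y)"
  note L = cvs_pair.linear_diff[OF lin_ext_linear] cvs_pair.linear_scale[OF lin_ext_linear]
  have "?L r = 0" if "r \<in> bilin_relations" for r
    using that unfolding bilin_relations_def
    by (auto simp: L cvs_pair.linear_add[OF assms(1)] cvs_pair.linear_add[OF assms(2)]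
        cvs_pair.linear_scale[OF assms(1)] cvs_pair.linear_scale[OF assms(2)])
  moreover have "rep_tensor (abs_tensor s) - s \<in> cvs.span bilin_relations"
    using Quotient3_rep_abs[OF Quotient3_tensor, of s]
    by (simp add: tensor_eq_def cvs.span_zero)
  ultimately have "?L (rep_tensor (abs_tensor s) - s) = 0"
    by (rule lin_ext_vanish_on_span)
  then show ?thesis by (simp add: tensor_lift_def L)
qed

lemma tensor_lift_pure:
  assumes "\<And>y. clinear (\<lambda>x. \<beta> x y)" and "\<And>x. clinear (\<beta> x)"
  shows "tensor_lift \<beta> (tensor_pure x y) = \<beta> x y"
  using tensor_lift_abs[OF assms] by (simp add: tensor_pure.abs_eq)

lemma tensor_lift_linear:
  assumes "\<And>y. clinear (\<lambda>x. \<beta> x y)" and "\<And>x. clinear (\<beta> x)"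
  shows "clinear (tensor_lift \<beta>)"
proof (rule clinearI)
  fix s t :: "('b, 'a) tensor" and c :: complex
  note L = tensor_lift_abs[OF assms] cvs_pair.linear_add[OF lin_ext_linear]
    cvs_pair.linear_scale[OF lin_ext_linear]
  show "tensor_lift \<beta> (s + t) = tensor_lift \<beta> s + tensor_lift \<beta> t"
    by (induct s; induct t) (simp add: plus_tensor.abs_eq L)
  show "tensor_lift \<beta> (c *\<^sub>C s) = c *\<^sub>C tensor_lift \<beta> s"
    by (induct s) (simp add: scaleC_tensor.abs_eq L)
qed

lemma tensor_pure_bilinear:
  "clinear (\<lambda>x. tensor_pure x y)" "clinear (tensor_pure x)"
  by (rule clinearI; transfer; unfold tensor_eq_def;
      rule cvs.span_base; unfold bilin_relations_def diff_diff_eq[symmetric]; blast)+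

subsection \<open>The tensor algebra\<close>

text \<open>The quotient of the free vector space on lists by the multilinearity relations is
  \<open>\<Oplus>\<^sub>n V\<^sup>\<otimes>\<^sup>n\<close>; the list \<open>[x\<^sub>1, \<dots>, x\<^sub>n]\<close> represents \<open>x\<^sub>1 \<otimes> \<dots> \<otimes> x\<^sub>n\<close>. Tensor powers are only used
  through submodules generated by one pure tensor, so the degree need not be recorded in a type.\<close>

definition multilin_relations :: "('v::complex_vector list \<Rightarrow>\<^sub>0 complex) set"
  where "multilin_relations =
    {basis_vec (us @ [x + x'] @ ws) - basis_vec (us @ [x] @ ws) - basis_vec (us @ [x'] @ ws)
       | us x x' ws. True} \<union>
    {basis_vec (us @ [c *\<^sub>C x] @ ws) - c *\<^sub>C basis_vec (us @ [x] @ ws) | us c x ws. True}"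

definition tensor_alg_eq ::
    "('v::complex_vector list \<Rightarrow>\<^sub>0 complex) \<Rightarrow> ('v list \<Rightarrow>\<^sub>0 complex) \<Rightarrow> bool"
  where "tensor_alg_eq s t \<longleftrightarrow> s - t \<in> cvs.span multilin_relations"

quotient_type (overloaded) 'v tensor_alg = "'v::complex_vector list \<Rightarrow>\<^sub>0 complex" / tensor_alg_eq
  unfolding tensor_alg_eq_def[abs_def] by (rule equivp_diff_in_span)

instantiation tensor_alg :: (complex_vector) complex_vector
begin
lift_definition zero_tensor_alg :: "'a tensor_alg" is 0 .
lift_definition plus_tensor_alg :: "'a tensor_alg \<Rightarrow> 'a tensor_alg \<Rightarrow> 'a tensor_alg" is "(+)"
  unfolding tensor_alg_eq_def by (rule diff_in_span_add)
lift_definition minus_tensor_alg :: "'a tensor_alg \<Rightarrow> 'a tensor_alg \<Rightarrow> 'a tensor_alg" is "(-)"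
  unfolding tensor_alg_eq_def by (rule diff_in_span_diff)
lift_definition uminus_tensor_alg :: "'a tensor_alg \<Rightarrow> 'a tensor_alg" is uminus
  unfolding tensor_alg_eq_def by (rule diff_in_span_uminus)
lift_definition scaleC_tensor_alg :: "complex \<Rightarrow> 'a tensor_alg \<Rightarrow> 'a tensor_alg" is scaleC
  unfolding tensor_alg_eq_def by (rule diff_in_span_scale)
instance
  by standard (transfer; simp add: tensor_alg_eq_def algebra_simps cvs.span_zero
      cvs.scale_right_distrib cvs.scale_left_distrib)+
end

lift_definition pure_tensors :: "'v::complex_vector list \<Rightarrow> 'v tensor_alg"
  is "\<lambda>xs. basis_vec xs" .

definition multilinear :: "('v::complex_vector list \<Rightarrow> 'x::complex_vector) \<Rightarrow> bool"
  where "multilinear f \<longleftrightarrow> (\<forall>us ws. clinear (\<lambda>x. f (us @ [x] @ ws)))"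

definition tensor_alg_lift ::
    "('v::complex_vector list \<Rightarrow> 'x::complex_vector) \<Rightarrow> 'v tensor_alg \<Rightarrow> 'x"
  where "tensor_alg_lift f t = lin_ext f (rep_tensor_alg t)"

lemma tensor_alg_lift_abs:
  assumes "multilinear f"
  shows "tensor_alg_lift f (abs_tensor_alg s) = lin_ext f s"
proof -
  note L = cvs_pair.linear_diff[OF lin_ext_linear] cvs_pair.linear_scale[OF lin_ext_linear]
  have f: "clinear (\<lambda>x. f (us @ [x] @ ws))" for us ws
    using assms by (simp add: multilinear_def)
  have "lin_ext f r = 0" if "r \<in> multilin_relations" for r
    using that unfolding multilin_relations_def
    by (auto simp: L cvs_pair.linear_add[OF f, simplified] cvs_pair.linear_scale[OF f, simplified])
  moreover have "rep_tensor_alg (abs_tensor_alg s) - s \<in> cvs.span multilin_relations"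
    using Quotient3_rep_abs[OF Quotient3_tensor_alg, of s]
    by (simp add: tensor_alg_eq_def cvs.span_zero)
  ultimately have "lin_ext f (rep_tensor_alg (abs_tensor_alg s) - s) = 0"
    by (rule lin_ext_vanish_on_span)
  then show ?thesis by (simp add: tensor_alg_lift_def L)
qed

lemma tensor_alg_lift_pure:
  "multilinear f \<Longrightarrow> tensor_alg_lift f (pure_tensors xs) = f xs"
  by (simp add: pure_tensors.abs_eq tensor_alg_lift_abs)

lemma tensor_alg_lift_linear:
  assumes "multilinear f"
  shows "clinear (tensor_alg_lift f)"
proof (rule clinearI)
  fix s t :: "'a tensor_alg" and c :: complex
  note L = tensor_alg_lift_abs[OF assms] cvs_pair.linear_add[OF lin_ext_linear]
    cvs_pair.linear_scale[OF lin_ext_linear]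
  show "tensor_alg_lift f (s + t) = tensor_alg_lift f s + tensor_alg_lift f t"
    by (induct s; induct t) (simp add: plus_tensor_alg.abs_eq L)
  show "tensor_alg_lift f (c *\<^sub>C s) = c *\<^sub>C tensor_alg_lift f s"
    by (induct s) (simp add: scaleC_tensor_alg.abs_eq L)
qed

lemma multilinear_pure_tensors: "multilinear pure_tensors"
  unfolding multilinear_def
  by (intro allI clinearI; transfer; unfold tensor_alg_eq_def;
      rule cvs.span_base; unfold multilin_relations_def diff_diff_eq[symmetric]; blast)

section \<open>Modules over the affine Lie algebra\<close>

text \<open>A basis of the affine Lie algebra: \<open>E n\<close>, \<open>H n\<close>, \<open>F n\<close> stand for \<open>e \<otimes> t\<^sup>n\<close>,
  \<open>h \<otimes> t\<^sup>n\<close>, \<open>f \<otimes> t\<^sup>n\<close>. A module is given by the operators by which this basis acts.\<close>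

datatype affine_sl2 = E int | H int | F int | K | D

text \<open>The bracket is \<open>[x\<^sub>m, y\<^sub>n] = [x, y]\<^sub>m\<^sub>+\<^sub>n + m \<delta>\<^sub>m\<^sub>+\<^sub>n\<^sub>,\<^sub>0 tr(x y) K\<close>, and \<open>[D, x\<^sub>n] = - n x\<^sub>n\<close>.\<close>

locale affine_sl2_module =
  fixes act :: "affine_sl2 \<Rightarrow> 'v::complex_vector \<Rightarrow> 'v"
  assumes linear: "clinear (act g)"
    and EE: "act (E m) (act (E n) x) - act (E n) (act (E m) x) = 0"
    and FF: "act (F m) (act (F n) x) - act (F n) (act (F m) x) = 0"
    and EF: "act (E m) (act (F n) x) - act (F n) (act (E m) x) =
               act (H (m + n)) x + (if m + n = 0 then of_int m *\<^sub>C act K x else 0)"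
    and HE: "act (H m) (act (E n) x) - act (E n) (act (H m) x) = 2 *\<^sub>C act (E (m + n)) x"
    and HF: "act (H m) (act (F n) x) - act (F n) (act (H m) x) = (-2) *\<^sub>C act (F (m + n)) x"
    and HH: "act (H m) (act (H n) x) - act (H n) (act (H m) x) =
               (if m + n = 0 then (2 * of_int m) *\<^sub>C act K x else 0)"
    and K_central: "act K (act g x) - act g (act K x) = 0"
    and DE: "act D (act (E n) x) - act (E n) (act D x) = (- of_int n) *\<^sub>C act (E n) x"
    and DH: "act D (act (H n) x) - act (H n) (act D x) = (- of_int n) *\<^sub>C act (H n) x"
    and DF: "act D (act (F n) x) - act (F n) (act D x) = (- of_int n) *\<^sub>C act (F n) x"

definition submodule :: "(affine_sl2 \<Rightarrow> 'v::complex_vector \<Rightarrow> 'v) \<Rightarrow> 'v set \<Rightarrow> bool"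
  where "submodule act S \<longleftrightarrow> cvs.subspace S \<and> (\<forall>g. \<forall>x\<in>S. act g x \<in> S)"

text \<open>\<open>U \<cdot> x\<close> for the universal enveloping algebra \<open>U\<close>, which is spanned by the monomials in the
  basis.\<close>

definition cyclic_submodule ::
    "(affine_sl2 \<Rightarrow> 'v::complex_vector \<Rightarrow> 'v) \<Rightarrow> 'v \<Rightarrow> 'v set"
  where "cyclic_submodule act x = cvs.span (range (\<lambda>gs. foldr act gs x))"

definition irreducible_module :: "(affine_sl2 \<Rightarrow> 'v::complex_vector \<Rightarrow> 'v) \<Rightarrow> bool"
  where "irreducible_module act \<longleftrightarrow>
    (UNIV :: 'v set) \<noteq> {0} \<and> (\<forall>S. submodule act S \<longrightarrow> S = {0} \<or> S = UNIV)"

text \<open>The Chevalley generators are \<open>E 0\<close>, \<open>F 0\<close> for \<open>\<alpha>\<^sub>1\<close> and \<open>F 1\<close>, \<open>E (-1)\<close> for \<open>\<alpha>\<^sub>0\<close>, with coroots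
  \<open>H 0\<close> and \<open>K - H 0\<close>.\<close>

definition integrable_module :: "(affine_sl2 \<Rightarrow> 'v::complex_vector \<Rightarrow> 'v) \<Rightarrow> bool"
  where "integrable_module act \<longleftrightarrow>
    cvs.span {x. \<exists>a b c. act (H 0) x = a *\<^sub>C x \<and> act K x = b *\<^sub>C x \<and> act D x = c *\<^sub>C x} = UNIV \<and>
    (\<forall>g\<in>{E 0, F 0, F 1, E (-1)}. \<forall>x. \<exists>n. (act g ^^ n) x = 0)"

text \<open>The level and the \<open>H 0\<close>-eigenvalue do not determine the action of \<open>D\<close>; as usual, it is
  normalized to be zero on highest weight vectors.\<close>

definition highest_weight_vector ::
    "(affine_sl2 \<Rightarrow> 'v::complex_vector \<Rightarrow> 'v) \<Rightarrow> complex \<Rightarrow> complex \<Rightarrow> 'v \<Rightarrow> bool"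
  where "highest_weight_vector act l k x \<longleftrightarrow> x \<noteq> 0 \<and> act (E 0) x = 0 \<and>
    (\<forall>n>0. act (E n) x = 0 \<and> act (H n) x = 0 \<and> act (F n) x = 0) \<and>
    act (H 0) x = l *\<^sub>C x \<and> act K x = k *\<^sub>C x \<and> act D x = 0"

text \<open>\<open>is_L l k act\<close>: the module realizes \<open>L\<^sub>l\<^sub>,\<^sub>k\<close>.\<close>

definition is_L :: "nat \<Rightarrow> nat \<Rightarrow> (affine_sl2 \<Rightarrow> 'v::complex_vector \<Rightarrow> 'v) \<Rightarrow> bool"
  where "is_L l k act \<longleftrightarrow>
    affine_sl2_module act \<and> irreducible_module act \<and> integrable_module act \<and>
    (\<exists>x. highest_weight_vector act (of_nat l) (of_nat k) x \<and> cyclic_submodule act x = UNIV)"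

text \<open>Extremal vectors are obtained from highest weight vectors by the Weyl group, where a simple
  reflection acts on a weight vector by the extremal power of a Chevalley generator. They are thus
  determined by their weight only up to a nonzero scalar.\<close>

inductive extremal_vector :: "(affine_sl2 \<Rightarrow> 'v::complex_vector \<Rightarrow> 'v) \<Rightarrow> 'v \<Rightarrow> bool"
  for act where
  highest: "highest_weight_vector act l k x \<Longrightarrow> extremal_vector act x"
| refl1_pos: "extremal_vector act x \<Longrightarrow> act (H 0) x = of_nat n *\<^sub>C x \<Longrightarrow>
    extremal_vector act ((act (F 0) ^^ n) x)"
| refl1_neg: "extremal_vector act x \<Longrightarrow> act (H 0) x = (- of_nat n) *\<^sub>C x \<Longrightarrow>
    extremal_vector act ((act (E 0) ^^ n) x)"
| refl0_pos: "extremal_vector act x \<Longrightarrow> act K x - act (H 0) x = of_nat n *\<^sub>C x \<Longrightarrow>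
    extremal_vector act ((act (E (-1)) ^^ n) x)"
| refl0_neg: "extremal_vector act x \<Longrightarrow> act K x - act (H 0) x = (- of_nat n) *\<^sub>C x \<Longrightarrow>
    extremal_vector act ((act (F 1) ^^ n) x)"

definition direct_sum_act ::
    "(affine_sl2 \<Rightarrow> 'v \<Rightarrow> 'v) \<Rightarrow> (affine_sl2 \<Rightarrow> 'w \<Rightarrow> 'w) \<Rightarrow> affine_sl2 \<Rightarrow> 'v \<times> 'w \<Rightarrow> 'v \<times> 'w"
  where "direct_sum_act A B g = map_prod (A g) (B g)"

definition tensor_act ::
    "(affine_sl2 \<Rightarrow> 'v::complex_vector \<Rightarrow> 'v) \<Rightarrow> (affine_sl2 \<Rightarrow> 'w::complex_vector \<Rightarrow> 'w) \<Rightarrow>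
      affine_sl2 \<Rightarrow> ('v, 'w) tensor \<Rightarrow> ('v, 'w) tensor"
  where "tensor_act A B g =
    tensor_lift (\<lambda>x y. tensor_pure (A g x) y + tensor_pure x (B g y))"

definition tensor_alg_act ::
    "(affine_sl2 \<Rightarrow> 'v::complex_vector \<Rightarrow> 'v) \<Rightarrow> affine_sl2 \<Rightarrow> 'v tensor_alg \<Rightarrow> 'v tensor_alg"
  where "tensor_alg_act A g =
    tensor_alg_lift (\<lambda>xs. \<Sum>a<length xs. pure_tensors (xs[a := A g (xs ! a)]))"

text \<open>\<open>f\<close> is an isomorphism from the module \<open>A\<close> onto the submodule \<open>S\<close> of the module \<open>B\<close>.\<close>

definition module_iso_onto ::
    "(affine_sl2 \<Rightarrow> 'v::complex_vector \<Rightarrow> 'v) \<Rightarrow> (affine_sl2 \<Rightarrow> 'w::complex_vector \<Rightarrow> 'w) \<Rightarrow>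
      'w set \<Rightarrow> ('v \<Rightarrow> 'w) \<Rightarrow> bool"
  where "module_iso_onto A B S f \<longleftrightarrow>
    submodule B S \<and> clinear f \<and> bij_betw f UNIV S \<and> (\<forall>g x. f (A g x) = B g (f x))"

section \<open>The modules \<open>L\<^sub>\<bold>m\<^sub>,\<^sub>\<kappa>\<close>\<close>

text \<open>The family \<open>v\<close> consists of extremal vectors \<open>v(p)\<close> with \<open>h\<^sub>0 v(p) = - p v(p)\<close>.\<close>

definition extremal_family ::
    "(affine_sl2 \<Rightarrow> 'v::complex_vector \<Rightarrow> 'v) \<Rightarrow> (int \<Rightarrow> 'v) \<Rightarrow> bool"
  where "extremal_family act v \<longleftrightarrow>
    (\<forall>p. extremal_vector act (v p) \<and> act (H 0) (v p) = (- of_int p) *\<^sub>C v p)"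

text \<open>For \<open>m = [m\<^sub>1, \<dots>, m\<^sub>\<kappa>]\<close> the list of the \<open>M\<^sub>a = m\<^sub>a + \<dots> + m\<^sub>\<kappa>\<close>; list positions start at 0.\<close>

definition tail_sums :: "nat list \<Rightarrow> nat list"
  where "tail_sums m = map (\<lambda>a. sum_list (drop a m)) [0..<length m]"

text \<open>\<open>L\<^sub>m\<^sub>,\<^sub>\<kappa>\<close> inside the \<open>\<kappa>\<close>-th tensor power of \<open>L\<^sub>0\<^sub>,\<^sub>1 \<oplus> L\<^sub>1\<^sub>,\<^sub>1\<close>, where \<open>\<kappa> = length m\<close>
  and \<open>act\<close> is the action on \<open>L\<^sub>0\<^sub>,\<^sub>1 \<oplus> L\<^sub>1\<^sub>,\<^sub>1\<close>. Rescaling the vectors of \<open>v\<close> does not change it.\<close>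

definition fusion_L ::
    "(affine_sl2 \<Rightarrow> 'v::complex_vector \<Rightarrow> 'v) \<Rightarrow> (int \<Rightarrow> 'v) \<Rightarrow> nat list \<Rightarrow> 'v tensor_alg set"
  where "fusion_L act v m =
    cyclic_submodule (tensor_alg_act act) (pure_tensors (map (\<lambda>M. v (int M)) (tail_sums m)))"

text \<open>The tuple \<open>(1\<^sup>N r)\<close> in \<open>\<int>\<^sub>\<ge>\<^sub>0\<^sup>\<kappa>\<close>, that is, \<open>N\<close> copies of \<open>\<pi>\<^sub>1\<close> and one copy of \<open>\<pi>\<^sub>r\<close>.\<close>

definition ones_and :: "nat \<Rightarrow> nat \<Rightarrow> nat \<Rightarrow> nat list"
  where "ones_and \<kappa> N r =
    map (\<lambda>a. (if a = 1 then N else 0) + (if a = r then 1 else 0)) [1..<Suc \<kappa>]"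

lemma tail_sums_ones_and:
  assumes "j \<le> k"
  shows "tail_sums (ones_and (Suc k) N (Suc j)) = Suc N # replicate j 1 @ replicate (k - j) 0"
proof (rule nth_equalityI)
  let ?m = "\<lambda>a::nat. (if a = 1 then N else 0) + (if a = Suc j then 1 else 0)"
  show "length (tail_sums (ones_and (Suc k) N (Suc j))) =
      length (Suc N # replicate j 1 @ replicate (k - j) 0)"
    using assms by (simp add: tail_sums_def ones_and_def)
  fix b assume "b < length (tail_sums (ones_and (Suc k) N (Suc j)))"
  then have b: "b < Suc k" by (simp add: tail_sums_def ones_and_def del: upt_Suc)
  have len: "length (ones_and (Suc k) N (Suc j)) = Suc k" by (simp add: ones_and_def)
  have "tail_sums (ones_and (Suc k) N (Suc j)) ! b = sum_list (map ?m [Suc b..<Suc (Suc k)])"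
    using b unfolding tail_sums_def len by (simp add: ones_and_def drop_map del: upt_Suc)
  also have "\<dots> = (\<Sum>a\<in>{Suc b..<Suc (Suc k)}. ?m a)"
    by (simp only: sum_set_upt_conv_sum_list_nat atLeastLessThan_upt)
  also have "\<dots> = (if b = 0 then N else 0) + (if b \<le> j then 1 else 0)"
    using b assms by (simp add: sum.distrib sum.delta)
  also have "\<dots> = (Suc N # replicate j 1 @ replicate (k - j) 0) ! b"
    using b assms by (cases b) (auto simp: nth_append)
  finally show "tail_sums (ones_and (Suc k) N (Suc j)) ! b =
      (Suc N # replicate j 1 @ replicate (k - j) 0) ! b" .
qed

lemma direct_sum_act_module:
  assumes "affine_sl2_module A" "affine_sl2_module B"
  shows "affine_sl2_module (direct_sum_act A B)"
proof -
  interpret A: affine_sl2_module A by fact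
  interpret B: affine_sl2_module B by fact
  show ?thesis
    by unfold_locales
      (auto simp: direct_sum_act_def prod_eq_iff scaleC_prod_def
        cvs_pair.linear_add[OF A.linear] cvs_pair.linear_add[OF B.linear]
        cvs_pair.linear_scale[OF A.linear] cvs_pair.linear_scale[OF B.linear]
        A.EE A.FF A.EF A.HE A.HF A.HH A.K_central A.DE A.DH A.DF
        B.EE B.FF B.EF B.HE B.HF B.HH B.K_central B.DE B.DH B.DF)
qed

lemma tensor_act_bilinear:
  assumes "clinear (A g)" "clinear (B g)"
  shows "clinear (\<lambda>x. tensor_pure (A g x) y + tensor_pure x (B g y))"
    and "clinear (\<lambda>y. tensor_pure (A g x) y + tensor_pure x (B g y))"
  using Vector_Spaces.linear_compose[OF assms(1) tensor_pure_bilinear(1)]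
    Vector_Spaces.linear_compose[OF assms(2) tensor_pure_bilinear(2)]
  by (auto simp: o_def intro!: cvs_pair.linear_compose_add tensor_pure_bilinear)

lemma tensor_act_pure:
  assumes "clinear (A g)" "clinear (B g)"
  shows "tensor_act A B g (tensor_pure x y) = tensor_pure (A g x) y + tensor_pure x (B g y)"
  unfolding tensor_act_def by (intro tensor_lift_pure tensor_act_bilinear assms)

lemma multilinear_tensor_alg_act:
  assumes "clinear (A g)"
  shows "multilinear (\<lambda>xs. \<Sum>a<length xs. pure_tensors (xs[a := A g (xs ! a)]))"
  unfolding multilinear_def
proof (intro allI)
  fix us ws :: "'a list"
  let ?xs = "\<lambda>x. us @ [x] @ ws"
  have pure: "clinear (\<lambda>x. pure_tensors (us' @ [x] @ ws'))" for us' ws' :: "'a list"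
    using multilinear_pure_tensors unfolding multilinear_def by blast
  have "clinear (\<lambda>x. pure_tensors ((?xs x)[a := A g (?xs x ! a)]))" for a
  proof -
    consider "a < length us" | "a = length us" | b where "a = length us + Suc b"
      by (metis less_imp_Suc_add linorder_neqE_nat add_Suc_right)
    then show ?thesis
    proof cases
      case 1
      then show ?thesis
        using pure[of "us[a := A g (us ! a)]" ws] by (simp add: list_update_append nth_append)
    next
      case 2
      then show ?thesis
        using Vector_Spaces.linear_compose[OF assms pure[of us ws]] by (simp add: o_def)
    next
      case 3
      then show ?thesis
        using pure[of us "ws[b := A g (ws ! b)]"] by (simp add: list_update_append nth_append)
    qed
  qed
  then show "clinear (\<lambda>x. \<Sum>a<length (?xs x). pure_tensors ((?xs x)[a := A g (?xs x ! a)]))"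
    unfolding length_append list.size by (intro cvs_pair.linear_compose_sum ballI)
qed

lemma tensor_alg_act_pure:
  assumes "clinear (A g)"
  shows "tensor_alg_act A g (pure_tensors xs) =
    (\<Sum>a<length xs. pure_tensors (xs[a := A g (xs ! a)]))"
  unfolding tensor_alg_act_def by (intro tensor_alg_lift_pure multilinear_tensor_alg_act assms)

end

theory Submission
  imports Defs
begin

text \<open>Put \<open>w = v(1)\<^sup>\<otimes>\<^sup>j \<otimes> v(0)\<^sup>\<otimes>\<^sup>(\<^sup>k\<^sup>-\<^sup>j\<^sup>)\<close>. The \<open>n\<close>-th module of the limit is generated by \<open>v(2n + i) \<otimes> w\<close>. The
inclusions hold because \<open>e \<otimes> t\<^sup>p\<^sup>+\<^sup>1\<close> maps \<open>v(p + 2)\<close> to a multiple of \<open>v(p)\<close> and kills \<open>w\<close>; write \<open>S\<close> for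
the union. Clearly \<open>S\<close> lies in the product of the component generated by the \<open>v(2n + i)\<close> with
\<open>W = U \<cdot> w\<close>, so two things have to be shown: that these factors are \<open>L\<^sub>i\<^sub>,\<^sub>1\<close> and \<open>L\<^sub>j\<^sub>,\<^sub>k\<close>, and that \<open>S\<close> is
the whole product.

The first is the fact that an integrable highest weight module is determined by its highest weight
(\<open>highest_weight_module_iso\<close>). For two such modules the submodule of the direct sum generated by the
pair of highest weight vectors is the graph of an isomorphism, because a nonzero submodule of an
integrable highest weight module contains the highest weight vector: the Casimir operator has the
same value on the highest weight vector and on any singular vector, and for dominant weights this
forces the weights to agree. That the Casimir operator commutes with all generators is reduced to
the finite dimensional subalgebra: it obviously commutes with \<open>e\<^sub>0\<close> and \<open>f\<^sub>0\<close>, and it is invariant under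
the automorphism that exchanges the two nodes of the Dynkin diagram.

For the second, an asymptotic argument in \<open>p\<close> is used. Call \<open>x\<close> in \<open>W\<close> asymptotic if \<open>v(p) \<otimes> x\<close> lies in
\<open>S\<close> for all large \<open>p\<close> of the parity of \<open>i\<close>. As \<open>v(p)\<close> is killed by \<open>f\<^sub>m\<close> for \<open>m \<ge> - p\<close> and is an
eigenvector of \<open>h\<^sub>m\<close> for \<open>m \<ge> 0\<close>, the asymptotic vectors are closed under all \<open>f\<^sub>m\<close> and under \<open>h\<^sub>m\<close> with
\<open>m \<ge> 0\<close>. For \<open>h\<^sub>-\<^sub>n\<close> one needs a level one fact, the recursion
\<open>n e\<^sub>p\<^sub>-\<^sub>1\<^sub>-\<^sub>n v(p) = \<Sum>\<^sub>a h\<^sub>-\<^sub>a e\<^sub>p\<^sub>-\<^sub>1\<^sub>-\<^sub>n\<^sub>+\<^sub>a v(p)\<close>, which is the coefficient form of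
\<open>\<partial>e(z) = :h(z)e(z):\<close>. Since \<open>e\<^sub>p\<^sub>-\<^sub>1\<^sub>-\<^sub>n x = 0\<close> for large \<open>p\<close>, the vectors
\<open>(e\<^sub>p\<^sub>-\<^sub>1\<^sub>-\<^sub>n v(p)) \<otimes> x\<close> lie in \<open>S\<close>, and solving the recursion for \<open>h\<^sub>-\<^sub>n v(p - 2)\<close> gives the closure under
\<open>h\<^sub>-\<^sub>n\<close> (\<open>asymptotic_H_negative\<close>).

Reflections in real roots, carried out by top powers of root vectors on tensor products of extremal
vectors, show that the translates \<open>v(2q + 1)\<^sup>\<otimes>\<^sup>j \<otimes> v(2q)\<^sup>\<otimes>\<^sup>(\<^sup>k\<^sup>-\<^sup>j\<^sup>)\<close> with \<open>q \<le> 0\<close> are asymptotic as well. These are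
killed by more and more of the \<open>e\<^sub>m\<close> as \<open>q\<close> decreases, and each arises from the next one by applying
\<open>f\<close>s; hence what the \<open>f\<^sub>m\<close> and \<open>h\<^sub>m\<close> generate from them is stable under the \<open>e\<^sub>m\<close> too and equals \<open>W\<close>
(\<open>FH_orbit_submodule\<close>). So every vector of \<open>W\<close> is asymptotic. The bound on \<open>p\<close> still depends on \<open>x\<close>;
applying \<open>e\<^sub>p\<^sub>-\<^sub>1\<close> and using induction on the \<open>D\<close>-degree of \<open>x\<close> brings \<open>p\<close> down to \<open>i\<close>. Hence
\<open>v(i) \<otimes> W \<subseteq> S\<close>, and because \<open>v(i)\<close> generates \<open>L\<^sub>i\<^sub>,\<^sub>1\<close> the whole product lies in \<open>S\<close>
(\<open>tcons_in_S\<close>).\<close>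

section \<open>Eigenvectors and primitive vectors\<close>

lemma clinear_ann:
  assumes "clinear f"
  shows "clinear (foldr (\<lambda>c y. f y - c *\<^sub>C y) cs)"
proof (induction cs)
  case Nil
  show ?case by (rule clinearI) simp_all
next
  case (Cons c cs)
  show ?case
    by (rule clinearI)
      (simp_all add: cvs_pair.linear_add[OF Cons] cvs_pair.linear_scale[OF Cons]
        cvs_pair.linear_add[OF assms] cvs_pair.linear_scale[OF assms] cvs.scale_right_distrib
        cvs.scale_right_diff_distrib algebra_simps)
qed

lemma ann_commute_single:
  assumes "clinear f"
  shows "foldr (\<lambda>c y. f y - c *\<^sub>C y) cs (f x - c *\<^sub>C x)
       = f (foldr (\<lambda>c y. f y - c *\<^sub>C y) cs x) - c *\<^sub>C foldr (\<lambda>c y. f y - c *\<^sub>C y) cs x"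
proof (induction cs)
  case Nil
  show ?case by simp
next
  case (Cons d cs)
  show ?case
    unfolding foldr.simps o_apply Cons
    by (simp add: cvs_pair.linear_diff[OF assms] cvs_pair.linear_scale[OF assms]
      cvs.scale_right_diff_distrib algebra_simps)
qed

lemma ann_eigenvector:
  assumes "clinear f" "f x = c *\<^sub>C x"
  shows "foldr (\<lambda>c y. f y - c *\<^sub>C y) cs x = (\<Prod>d\<leftarrow>cs. c - d) *\<^sub>C x"
  by (induction cs)
    (simp_all add: cvs_pair.linear_scale[OF assms(1)] assms(2) scaleC_one
      algebra_simps flip: cvs.scale_left_diff_distrib)

lemma ann_commute:
  assumes "clinear f"
  shows "foldr (\<lambda>c y. f y - c *\<^sub>C y) cs (foldr (\<lambda>c y. f y - c *\<^sub>C y) ds x)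
       = foldr (\<lambda>c y. f y - c *\<^sub>C y) ds (foldr (\<lambda>c y. f y - c *\<^sub>C y) cs x)"
  by (induction ds arbitrary: x) (simp_all add: ann_commute_single[OF assms])

text \<open>A combination of eigenvectors is killed by the product of the factors \<open>f - c\<close> over the eigenvalues
  that occur. Both following lemmas read off what they need from this product, which avoids splitting
  a vector into its components.\<close>

lemma span_eigenvectors_ann:
  assumes f: "clinear f" and x: "x \<in> cvs.span {y. \<exists>c\<in>C. f y = c *\<^sub>C y}"
  shows "\<exists>cs. set cs \<subseteq> C \<and> foldr (\<lambda>c y. f y - c *\<^sub>C y) cs x = 0"
  using x
proof (induction rule: cvs.span_induct_alt)
  case base
  then show ?case by (intro exI[of _ "[]"]) simp
next
  case (step a y z)
  then obtain c cs where c: "c \<in> C" "f y = c *\<^sub>C y"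
    and cs: "set cs \<subseteq> C" "foldr (\<lambda>c y. f y - c *\<^sub>C y) cs z = 0" by auto
  let ?A = "foldr (\<lambda>c y. f y - c *\<^sub>C y)"
  note A = cvs_pair.linear_add[OF clinear_ann[OF f]] cvs_pair.linear_scale[OF clinear_ann[OF f]]
    cvs_pair.linear_0[OF clinear_ann[OF f]] cvs_pair.linear_0[OF f]
  have "?A (cs @ [c]) (a *\<^sub>C y + z) = ?A cs (?A [c] (a *\<^sub>C y)) + ?A cs (?A [c] z)"
    unfolding A(1) by (simp only: foldr_append o_apply A(1))
  also have "?A [c] (a *\<^sub>C y) = 0"
    unfolding A(2) by (simp add: c)
  also have "?A cs (?A [c] z) = ?A [c] (?A cs z)"
    by (rule ann_commute[OF f])
  finally have "?A (cs @ [c]) (a *\<^sub>C y + z) = 0"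
    using cs(2) by (simp add: A)
  then show ?case
    using c(1) cs(1) by (intro exI[of _ "cs @ [c]"]) auto
qed

lemma eigenvalue_in_span_eigenvectors:
  assumes f: "clinear f" and x: "x \<in> cvs.span {y. \<exists>c\<in>C. f y = c *\<^sub>C y}"
    and "f x = c *\<^sub>C x" "x \<noteq> 0"
  shows "c \<in> C"
proof -
  obtain cs where cs: "set cs \<subseteq> C" "foldr (\<lambda>c y. f y - c *\<^sub>C y) cs x = 0"
    using span_eigenvectors_ann[OF f x] by blast
  then have "(\<Prod>d\<leftarrow>cs. c - d) = 0"
    using ann_eigenvector[OF f assms(3), of cs] assms(4) by (simp add: cvs.scale_eq_0_iff)
  then have "c \<in> set cs" by (auto simp: prod_list_zero_iff)
  then show ?thesis using cs(1) by blast
qed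

text \<open>Apply the factors \<open>f - c\<close> one after another; the last nonzero vector that arises is an
  eigenvector, and it stays in \<open>R\<close>.\<close>

lemma eigenvector_in_invariant_subspace:
  assumes f: "clinear f" and x: "x \<in> cvs.span {y. \<exists>c\<in>C. f y = c *\<^sub>C y}"
    and R: "cvs.subspace R" "\<And>y. y \<in> R \<Longrightarrow> f y \<in> R" and "x \<in> R" "x \<noteq> 0"
  shows "\<exists>c\<in>C. \<exists>y\<in>R. y \<noteq> 0 \<and> f y = c *\<^sub>C y"
proof -
  obtain cs where cs: "set cs \<subseteq> C" "foldr (\<lambda>c y. f y - c *\<^sub>C y) cs x = 0"
    using span_eigenvectors_ann[OF f x] by blast
  have in_R: "foldr (\<lambda>c y. f y - c *\<^sub>C y) ds x \<in> R" for ds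
    by (induction ds) (simp_all add: \<open>x \<in> R\<close> cvs.subspace_diff[OF R(1)] cvs.subspace_scale[OF R(1)] R(2))
  show ?thesis
    using cs
  proof (induction cs)
    case Nil
    then show ?case using \<open>x \<noteq> 0\<close> by simp
  next
    case (Cons c cs)
    then show ?case
      using in_R[of cs] by (cases "foldr (\<lambda>c y. f y - c *\<^sub>C y) cs x = 0") auto
  qed
qed

lemma funpow_zero_mono:
  fixes f :: "'a::zero \<Rightarrow> 'a"
  assumes "f 0 = 0" "(f ^^ m) x = 0" "m \<le> n"
  shows "(f ^^ n) x = 0"
proof -
  have "(f ^^ d) 0 = 0" for d by (induction d) (simp_all add: assms(1))
  then show ?thesis
    using assms(2,3) by (metis le_add_diff_inverse2 funpow_add o_apply)
qed

text \<open>From \<open>e f\<^sup>s\<^sup>+\<^sup>1 x = (s + 1)(\<mu> - s) f\<^sup>s x\<close>, the first vanishing power of \<open>f\<close> determines \<open>\<mu>\<close>.\<close>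

lemma sl2_primitive_vector:
  fixes e f h :: "'a::complex_vector \<Rightarrow> 'a"
  assumes e: "clinear e" and f: "clinear f"
    and ef: "\<And>y. e (f y) = f (e y) + h y" and hf: "\<And>y. h (f y) = f (h y) - 2 *\<^sub>C f y"
    and x: "e x = 0" "h x = \<mu> *\<^sub>C x" "x \<noteq> 0" and nil: "(f ^^ N) x = 0"
  shows "\<exists>s. \<mu> = of_nat s \<and> (f ^^ s) x \<noteq> 0 \<and> (f ^^ Suc s) x = 0"
proof -
  have h_pow: "h ((f ^^ n) x) = (\<mu> - 2 * of_nat n) *\<^sub>C (f ^^ n) x" for n
  proof (induction n)
    case 0
    show ?case by (simp add: x)
  next
    case (Suc n)
    have "h ((f ^^ Suc n) x) = ((\<mu> - 2 * of_nat n) - 2) *\<^sub>C (f ^^ Suc n) x"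
      by (simp add: hf Suc cvs_pair.linear_scale[OF f] cvs_pair.linear_diff[OF f] cvs.scale_left_diff_distrib)
    moreover have "(\<mu> - 2 * of_nat n) - 2 = \<mu> - 2 * of_nat (Suc n)" by simp
    ultimately show ?case by (simp only:)
  qed
  have e_pow: "e ((f ^^ Suc n) x) = (of_nat (Suc n) * (\<mu> - of_nat n)) *\<^sub>C (f ^^ n) x" for n
  proof (induction n)
    case 0
    show ?case by (simp add: ef x cvs_pair.linear_0[OF f])
  next
    case (Suc n)
    have "e ((f ^^ Suc (Suc n)) x) = f (e ((f ^^ Suc n) x)) + h ((f ^^ Suc n) x)"
      by (simp only: funpow.simps o_apply ef)
    also have "\<dots> = (of_nat (Suc n) * (\<mu> - of_nat n) + (\<mu> - 2 * of_nat (Suc n))) *\<^sub>C (f ^^ Suc n) x"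
      unfolding Suc.IH h_pow cvs_pair.linear_scale[OF f] cvs.scale_left_distrib by simp
    also have "of_nat (Suc n) * (\<mu> - of_nat n) + (\<mu> - 2 * of_nat (Suc n))
        = of_nat (Suc (Suc n)) * (\<mu> - of_nat (Suc n))"
      by (simp add: algebra_simps)
    finally show ?case .
  qed
  define s where "s = (LEAST n. (f ^^ Suc n) x = 0)"
  have ex: "\<exists>n. (f ^^ Suc n) x = 0"
    using nil x(3) by (cases N) auto
  then have s: "(f ^^ Suc s) x = 0" unfolding s_def by (rule LeastI_ex)
  have ns: "(f ^^ s) x \<noteq> 0"
  proof (cases s)
    case 0
    then show ?thesis using x by simp
  next
    case (Suc r)
    then have "r < (LEAST n. (f ^^ Suc n) x = 0)" by (simp only: s_def[symmetric])
    from not_less_Least[OF this] show ?thesis by (simp only: Suc not_False_eq_True)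
  qed
  have "(of_nat (Suc s) * (\<mu> - of_nat s)) *\<^sub>C (f ^^ s) x = 0"
    using e_pow[of s] s cvs_pair.linear_0[OF e] by simp
  then have "\<mu> = of_nat s"
    using ns by (simp add: cvs.scale_eq_0_iff del: of_nat_Suc)
  then show ?thesis using s ns by blast
qed

section \<open>Submodules and words\<close>

lemma linear_maps_span_into:
  assumes "clinear f" "cvs.subspace S" "\<And>b. b \<in> B \<Longrightarrow> f b \<in> S" "x \<in> cvs.span B"
  shows "f x \<in> S"
  using assms(4)
  by (induction rule: cvs.span_induct_alt)
    (simp_all add: cvs_pair.linear_add[OF assms(1)] cvs_pair.linear_scale[OF assms(1)]
      cvs_pair.linear_0[OF assms(1)] assms(3) cvs.subspace_0[OF assms(2)]
      cvs.subspace_add[OF assms(2)] cvs.subspace_scale[OF assms(2)])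

text \<open>All vectors \<open>g\<^sub>1 \<dots> g\<^sub>n x\<close> with \<open>x\<close> in \<open>X\<close> and all \<open>g\<^sub>a\<close> in \<open>Y\<close>.\<close>

inductive_set orbit :: "(affine_sl2 \<Rightarrow> 'v \<Rightarrow> 'v) \<Rightarrow> affine_sl2 set \<Rightarrow> 'v set \<Rightarrow> 'v set"
  for act Y X where
  base: "x \<in> X \<Longrightarrow> x \<in> orbit act Y X"
| step: "x \<in> orbit act Y X \<Longrightarrow> g \<in> Y \<Longrightarrow> act g x \<in> orbit act Y X"

context affine_sl2_module
begin

lemmas act_add = cvs_pair.linear_add[OF linear]
  and act_diff = cvs_pair.linear_diff[OF linear]
  and act_scale = cvs_pair.linear_scale[OF linear]
  and act_neg = cvs_pair.linear_neg[OF linear]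
  and act_sum = cvs_pair.linear_sum[OF linear]

lemma act_zero: "act g 0 = 0"
  by (rule cvs_pair.linear_0[OF linear])

lemma linear_pow: "clinear (act g ^^ n)"
proof (induction n)
  case 0
  show ?case by (rule clinearI) simp_all
next
  case (Suc n)
  show ?case
    by (rule clinearI)
      (simp_all add: cvs_pair.linear_add[OF Suc] cvs_pair.linear_scale[OF Suc] act_add act_scale)
qed

lemma pow_zero: "(act g ^^ n) 0 = 0"
  by (rule cvs_pair.linear_0[OF linear_pow])

lemma swap_EF: "act (E m) (act (F n) x) = act (F n) (act (E m) x) + act (H (m + n)) x
    + (if m + n = 0 then of_int m *\<^sub>C act K x else 0)"
  using EF[of m n x] by (simp add: algebra_simps)

lemma swap_HE: "act (H m) (act (E n) x) = act (E n) (act (H m) x) + 2 *\<^sub>C act (E (m + n)) x"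
  using HE[of m n x] by (simp add: algebra_simps)

lemma swap_HF: "act (H m) (act (F n) x) = act (F n) (act (H m) x) - 2 *\<^sub>C act (F (m + n)) x"
  using HF[of m n x] by (simp add: algebra_simps)

lemma swap_HH: "act (H m) (act (H n) x) = act (H n) (act (H m) x)
    + (if m + n = 0 then (2 * of_int m) *\<^sub>C act K x else 0)"
  using HH[of m n x] by (simp add: algebra_simps)

lemma swap_EE: "act (E m) (act (E n) x) = act (E n) (act (E m) x)"
  using EE[of m n x] by simp

lemma swap_FF: "act (F m) (act (F n) x) = act (F n) (act (F m) x)"
  using FF[of m n x] by simp

lemma swap_K: "act K (act g x) = act g (act K x)"
  using K_central[of g x] by simp

lemma swap_DE: "act D (act (E n) x) = act (E n) (act D x) - of_int n *\<^sub>C act (E n) x"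
  using DE[of n x] by (simp add: algebra_simps)

lemma swap_DH: "act D (act (H n) x) = act (H n) (act D x) - of_int n *\<^sub>C act (H n) x"
  using DH[of n x] by (simp add: algebra_simps)

lemma swap_DF: "act D (act (F n) x) = act (F n) (act D x) - of_int n *\<^sub>C act (F n) x"
  using DF[of n x] by (simp add: algebra_simps)

lemma bracket_in_basis:
  "\<exists>c g' d. act g (act h x) - act h (act g x) = c *\<^sub>C act g' x + d *\<^sub>C act K x" (is "?P g h")
proof -
  have swap: "?P g h" if hg: "?P h g" for g h
  proof -
    obtain c g' d where "act h (act g x) - act g (act h x) = c *\<^sub>C act g' x + d *\<^sub>C act K x"
      using hg by blast
    then have "act g (act h x) - act h (act g x) = (- c) *\<^sub>C act g' x + (- d) *\<^sub>C act K x"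
      by (simp add: algebra_simps)
    then show ?thesis by blast
  qed
  have nil: "?P g h" if "act g (act h x) - act h (act g x) = 0" for g h
    using that by (intro exI[of _ 0] exI[of _ K]) simp
  have one: "?P g h" if "act g (act h x) - act h (act g x) = c *\<^sub>C act g' x" for g h c g'
    using that by (intro exI[of _ c] exI[of _ g'] exI[of _ 0]) simp
  have K: "?P K h" "?P h K" for h
    using nil[of K h] nil[of h K] K_central[of h x] swap_K[of h x] by simp_all
  have EF: "?P (E m) (F n)" for m n
    using EF[of m n x]
    by (intro exI[of _ 1] exI[of _ "H (m + n)"] exI[of _ "if m + n = 0 then of_int m else 0"])
      (simp add: scaleC_one)
  have HH: "?P (H m) (H n)" for m n
    using HH[of m n x]
    by (intro exI[of _ 0] exI[of _ K] exI[of _ "if m + n = 0 then 2 * of_int m else 0"]) simp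
  note r = nil[OF EE] nil[OF FF] EF one[OF HE] one[OF HF] HH K one[OF DE] one[OF DH] one[OF DF]
  show ?thesis
    using r[THEN swap] r nil[of D D] by (cases g; cases h) simp_all
qed

text \<open>A triangular decomposition without the Poincare-Birkhoff-Witt theorem: any \<open>g\<close> can be commuted past
  the letters from \<open>Y\<close>, at the price of brackets that act on a shorter word, until it reaches a
  generator.\<close>

lemma submodule_span_orbit:
  assumes "\<And>x g. x \<in> X \<Longrightarrow> act g x \<in> cvs.span (orbit act Y X)"
  shows "submodule act (cvs.span (orbit act Y X))"
proof -
  let ?S = "cvs.span (orbit act Y X)"
  have Y: "act g x \<in> ?S" if "g \<in> Y" "x \<in> ?S" for g x
    by (rule linear_maps_span_into[OF linear cvs.subspace_span _ that(2)])
      (rule cvs.span_base, rule orbit.step[OF _ that(1)])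
  have "\<forall>g. act g x \<in> ?S" if "x \<in> orbit act Y X" for x
    using that
  proof induction
    case (base x)
    then show ?case using assms by blast
  next
    case (step x h)
    show ?case
    proof
      fix g
      obtain c g' d where "act g (act h x) - act h (act g x) = c *\<^sub>C act g' x + d *\<^sub>C act K x"
        using bracket_in_basis by blast
      then have "act g (act h x) = act h (act g x) + (c *\<^sub>C act g' x + d *\<^sub>C act K x)"
        by (simp add: algebra_simps)
      then show "act g (act h x) \<in> ?S"
        using Y[OF step.hyps(2)] step.IH by (simp add: cvs.span_add cvs.span_scale)
    qed
  qed
  then show ?thesis
    unfolding submodule_def
    using linear_maps_span_into[OF linear cvs.subspace_span, of "orbit act Y X"] by blast
qed

lemma submodule_cyclic: "submodule act (cyclic_submodule act x)"
proof -
  have "act g y \<in> cyclic_submodule act x" if "y \<in> cyclic_submodule act x" for g y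
    using that unfolding cyclic_submodule_def
  proof (rule linear_maps_span_into[OF linear cvs.subspace_span, rotated])
    fix b assume "b \<in> range (\<lambda>gs. foldr act gs x)"
    then obtain gs where "b = foldr act gs x" by blast
    then have "act g b = foldr act (g # gs) x" by simp
    then show "act g b \<in> cvs.span (range (\<lambda>gs. foldr act gs x))"
      by (metis cvs.span_base rangeI)
  qed
  then show ?thesis by (simp add: submodule_def cyclic_submodule_def)
qed

lemma generator_in_cyclic: "x \<in> cyclic_submodule act x"
  unfolding cyclic_submodule_def by (rule cvs.span_base) (metis foldr_Nil id_apply rangeI)

lemma cyclic_subset_submodule:
  assumes S: "submodule act S" and "x \<in> S"
  shows "cyclic_submodule act x \<subseteq> S"
proof -
  have "foldr act gs x \<in> S" for gs
    using S \<open>x \<in> S\<close> by (induction gs) (auto simp: submodule_def)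
  then show ?thesis
    unfolding cyclic_submodule_def using S by (intro cvs.span_minimal) (auto simp: submodule_def)
qed

lemma irreducible_cyclic:
  assumes "irreducible_module act" "x \<noteq> 0"
  shows "cyclic_submodule act x = UNIV"
  using assms submodule_cyclic[of x] generator_in_cyclic[of x] by (auto simp: irreducible_module_def)

end

lemma submoduleI:
  assumes "0 \<in> S" "\<And>x y. x \<in> S \<Longrightarrow> y \<in> S \<Longrightarrow> x + y \<in> S"
    "\<And>c x. x \<in> S \<Longrightarrow> c *\<^sub>C x \<in> S" "\<And>g x. x \<in> S \<Longrightarrow> act g x \<in> S"
  shows "submodule act S"
  using assms unfolding submodule_def cvs.subspace_def by simp

lemma submodule_add: "submodule act S \<Longrightarrow> x \<in> S \<Longrightarrow> y \<in> S \<Longrightarrow> x + y \<in> S"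
  and submodule_diff: "submodule act S \<Longrightarrow> x \<in> S \<Longrightarrow> y \<in> S \<Longrightarrow> x - y \<in> S"
  and submodule_scale: "submodule act S \<Longrightarrow> x \<in> S \<Longrightarrow> c *\<^sub>C x \<in> S"
  and submodule_sum: "submodule act S \<Longrightarrow> (\<And>a. a \<in> A \<Longrightarrow> f a \<in> S) \<Longrightarrow> sum f A \<in> S"
  and submodule_act: "submodule act S \<Longrightarrow> x \<in> S \<Longrightarrow> act g x \<in> S"
  and submodule_zero: "submodule act S \<Longrightarrow> 0 \<in> S"
  by (auto simp: submodule_def intro: cvs.subspace_add cvs.subspace_diff cvs.subspace_scale
      cvs.subspace_sum cvs.subspace_0)

lemma submodule_pow: "submodule act S \<Longrightarrow> x \<in> S \<Longrightarrow> (act g ^^ n) x \<in> S"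
  by (induction n) (simp_all add: submodule_act)

lemma submodule_scale_cancel:
  assumes "submodule act S" "c *\<^sub>C x \<in> S" "c \<noteq> 0"
  shows "x \<in> S"
  using submodule_scale[OF assms(1,2), of "inverse c"] assms(3)
  by (simp add: scaleC_scaleC scaleC_one)

section \<open>Highest weight modules\<close>

definition lowering :: "affine_sl2 set"
  where "lowering = {F n | n. n \<le> 0} \<union> {H n | n. n < 0} \<union> {E n | n. n < 0}"

locale highest_weight_module = affine_sl2_module act
  for act :: "affine_sl2 \<Rightarrow> 'v::complex_vector \<Rightarrow> 'v" +
  fixes l k :: complex and z :: 'v
  assumes hw: "highest_weight_vector act l k z"
begin

lemma z_nonzero: "z \<noteq> 0" and E_z: "0 \<le> n \<Longrightarrow> act (E n) z = 0" and H_z: "0 < n \<Longrightarrow> act (H n) z = 0"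
  and F_z: "0 < n \<Longrightarrow> act (F n) z = 0" and H0_z: "act (H 0) z = l *\<^sub>C z"
  and K_z: "act K z = k *\<^sub>C z" and D_z: "act D z = 0"
  using hw by (auto simp: highest_weight_vector_def order_le_less)

abbreviation "L \<equiv> cyclic_submodule act z"

lemma L_eq_span_orbit: "L = cvs.span (orbit act lowering {z})"
proof
  have "act g z \<in> cvs.span (orbit act lowering {z})" for g
  proof (cases "g \<in> lowering")
    case True
    then show ?thesis by (intro cvs.span_base orbit.step orbit.base) auto
  next
    case False
    have "z \<in> cvs.span (orbit act lowering {z})" by (intro cvs.span_base orbit.base) simp
    moreover have "\<exists>c. act g z = c *\<^sub>C z"
    proof (cases g)
      case (H n)
      then show ?thesis
        using False H_z[of n] H0_z by (cases "n = 0") (auto simp: lowering_def intro: exI[of _ 0])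
    qed (use False E_z F_z K_z D_z in \<open>auto simp: lowering_def intro: exI[of _ 0]\<close>)
    ultimately show ?thesis by (auto intro: cvs.span_scale)
  qed
  then have "submodule act (cvs.span (orbit act lowering {z}))"
    by (intro submodule_span_orbit) auto
  then show "L \<subseteq> cvs.span (orbit act lowering {z})"
    by (rule cyclic_subset_submodule) (intro cvs.span_base orbit.base, simp)
  have "x \<in> L" if "x \<in> orbit act lowering {z}" for x
    using that by induction (auto intro: generator_in_cyclic submodule_act[OF submodule_cyclic])
  then show "cvs.span (orbit act lowering {z}) \<subseteq> L"
    using submodule_cyclic[of z] by (intro cvs.span_minimal) (auto simp: submodule_def)
qed

text \<open>\<open>weight a b\<close> is the weight space of weight \<open>\<Lambda> - a \<alpha>\<^sub>1 - b \<alpha>\<^sub>0\<close>.\<close>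

definition weight :: "nat \<Rightarrow> nat \<Rightarrow> 'v \<Rightarrow> bool"
  where "weight a b x \<longleftrightarrow>
    act (H 0) x = (l - 2 * of_nat a + 2 * of_nat b) *\<^sub>C x \<and> act D x = of_nat b *\<^sub>C x"

lemma lowering_weight:
  assumes "weight a b x" "g \<in> lowering"
  shows "\<exists>a' b'. a' + b' > a + b \<and> weight a' b' (act g x)"
proof -
  have x: "act (H 0) x = (l - 2 * of_nat a + 2 * of_nat b) *\<^sub>C x" "act D x = of_nat b *\<^sub>C x"
    using assms(1) by (simp_all add: weight_def)
  have x': "\<exists>m. n = - int m" if "n \<le> 0" for n using that by (intro exI[of _ "nat (- n)"]) simp
  have x'': "\<exists>m. n = - int (Suc m)" if "n < 0" for n
    using that by (intro exI[of _ "nat (- n - 1)"]) simp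
  consider (F) n where "g = F (- int n)" | (H) n where "g = H (- int (Suc n))"
    | (E) n where "g = E (- int (Suc n))"
    using assms(2) x' x'' unfolding lowering_def by blast
  then show ?thesis
  proof cases
    case F
    show ?thesis
      unfolding F weight_def swap_HF swap_DF x
      by (rule exI[of _ "a + n + 1"], rule exI[of _ "b + n"])
        (simp add: act_scale act_add act_diff algebra_simps)
  next
    case H
    show ?thesis
      unfolding H weight_def swap_HH[of 0] swap_DH x
      by (rule exI[of _ "a + n + 1"], rule exI[of _ "b + n + 1"])
        (simp add: act_scale act_add act_diff algebra_simps)
  next
    case E
    show ?thesis
      unfolding E weight_def swap_HE swap_DE x
      by (rule exI[of _ "a + n"], rule exI[of _ "b + n + 1"])
        (simp add: act_scale act_add act_diff algebra_simps)
  qed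
qed

lemma orbit_weight:
  assumes "x \<in> orbit act lowering {z}"
  shows "x = z \<or> (\<exists>a b. a + b > 0 \<and> weight a b x)"
  using assms
proof induction
  case (step x g)
  have "\<exists>a b. weight a b x"
    using step.IH by (auto simp: weight_def H0_z D_z intro: exI[of _ 0])
  then show ?case using lowering_weight step.hyps(2) by (metis gr0I less_nat_zero_code)
qed simp

lemma L_eq_span_weights: "L = cvs.span {x \<in> L. \<exists>a b. weight a b x}"
proof
  have "orbit act lowering {z} \<subseteq> {x \<in> L. \<exists>a b. weight a b x}"
  proof
    fix x assume x: "x \<in> orbit act lowering {z}"
    have "weight 0 0 z" by (simp add: weight_def H0_z D_z)
    then have "\<exists>a b. weight a b x" using orbit_weight[OF x] by blast
    moreover have "x \<in> L" unfolding L_eq_span_orbit by (rule cvs.span_base[OF x])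
    ultimately show "x \<in> {x \<in> L. \<exists>a b. weight a b x}" by blast
  qed
  then show "L \<subseteq> cvs.span {x \<in> L. \<exists>a b. weight a b x}"
    unfolding L_eq_span_orbit by (rule cvs.span_mono)
  show "cvs.span {x \<in> L. \<exists>a b. weight a b x} \<subseteq> L"
    using submodule_cyclic[of z] by (intro cvs.span_minimal) (auto simp: submodule_def)
qed

lemma L_subset_span_weights: "x \<in> L \<Longrightarrow> x \<in> cvs.span {x. \<exists>a b. weight a b x}"
  using L_eq_span_weights cvs.span_mono[of "{x \<in> L. \<exists>a b. weight a b x}" "{x. \<exists>a b. weight a b x}"]
  by auto

lemma L_span_D: "x \<in> L \<Longrightarrow> x \<in> cvs.span {y. \<exists>c\<in>range of_nat. act D y = c *\<^sub>C y}"
  using L_subset_span_weights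
    cvs.span_mono[of "{x. \<exists>a b. weight a b x}" "{y. \<exists>c\<in>range of_nat. act D y = c *\<^sub>C y}"]
  by (auto simp: weight_def)

lemma D_eigenvalue_nat:
  assumes "x \<in> L" "x \<noteq> 0" "act D x = \<beta> *\<^sub>C x"
  shows "\<exists>b. \<beta> = of_nat b"
  using eigenvalue_in_span_eigenvectors[OF linear L_span_D[OF assms(1)] assms(3,2)] by auto

text \<open>This operator acts on \<open>weight a b\<close> as the scalar \<open>a\<close>. Together with \<open>D\<close> it shows that both coefficients
  of an arbitrary weight vector are natural numbers.\<close>

definition alpha1_coeff :: "'v \<Rightarrow> 'v"
  where "alpha1_coeff x = (1/2) *\<^sub>C (l *\<^sub>C x + 2 *\<^sub>C act D x - act (H 0) x)"

lemma linear_alpha1: "clinear alpha1_coeff"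
  by (rule clinearI) (simp_all add: alpha1_coeff_def act_add act_scale algebra_simps)

lemma alpha1_weight: "weight a b x \<Longrightarrow> alpha1_coeff x = of_nat a *\<^sub>C x"
  by (simp add: alpha1_coeff_def weight_def flip: cvs.scale_left_distrib cvs.scale_left_diff_distrib)

lemma L_span_alpha1: "x \<in> L \<Longrightarrow> x \<in> cvs.span {y. \<exists>c\<in>range of_nat. alpha1_coeff y = c *\<^sub>C y}"
  using L_subset_span_weights
    cvs.span_mono[of "{x. \<exists>a b. weight a b x}" "{y. \<exists>c\<in>range of_nat. alpha1_coeff y = c *\<^sub>C y}"] alpha1_weight
  by blast

lemma weight_from_alpha1_D:
  "alpha1_coeff x = of_nat a *\<^sub>C x \<Longrightarrow> act D x = of_nat b *\<^sub>C x \<Longrightarrow> weight a b x"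
proof -
  assume a: "alpha1_coeff x = of_nat a *\<^sub>C x" and b: "act D x = of_nat b *\<^sub>C x"
  have "act (H 0) x = l *\<^sub>C x + 2 *\<^sub>C act D x - 2 *\<^sub>C alpha1_coeff x"
    by (simp add: alpha1_coeff_def scaleC_one)
  also have "\<dots> = (l - 2 * of_nat a + 2 * of_nat b) *\<^sub>C x"
    unfolding a b by (simp add: algebra_simps)
  finally show "weight a b x" using b by (simp add: weight_def)
qed

lemma weights_in_L:
  assumes "x \<in> L" "x \<noteq> 0" "act (H 0) x = \<mu> *\<^sub>C x" "act D x = \<beta> *\<^sub>C x"
  obtains a b where "\<mu> = l - 2 * of_nat a + 2 * of_nat b" "\<beta> = of_nat b" "weight a b x"
proof -
  have "alpha1_coeff x = ((l + 2 * \<beta> - \<mu>) / 2) *\<^sub>C x"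
    by (simp add: alpha1_coeff_def assms flip: cvs.scale_left_distrib cvs.scale_left_diff_distrib)
  then have "(l + 2 * \<beta> - \<mu>) / 2 \<in> range of_nat"
    using eigenvalue_in_span_eigenvectors[OF linear_alpha1 L_span_alpha1] assms by blast
  then obtain a where a: "(l + 2 * \<beta> - \<mu>) / 2 = of_nat a" by blast
  obtain b where "\<beta> = of_nat b" using D_eigenvalue_nat assms by blast
  moreover have "\<mu> = l - 2 * of_nat a + 2 * \<beta>" unfolding a[symmetric] by (simp add: field_simps)
  ultimately show ?thesis using that assms by (simp add: weight_def)
qed

text \<open>The sum of both coefficients is positive on all words of positive length, so only multiples of \<open>z\<close>
  have value zero.\<close>

lemma highest_weight_space:
  assumes "x \<in> L" "weight 0 0 x"
  shows "\<exists>c. x = c *\<^sub>C z"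
proof -
  let ?G = "\<lambda>y. alpha1_coeff y + act D y"
  have G: "clinear ?G" by (intro cvs_pair.linear_compose_add linear_alpha1 linear)
  let ?P = "{y. \<exists>c\<in>of_nat ` {1..}. ?G y = c *\<^sub>C y}"
  have "y \<in> ?P" if "weight a b y" "a + b > 0" for a b y
  proof -
    have "?G y = of_nat (a + b) *\<^sub>C y"
      using that(1) alpha1_weight[OF that(1)] unfolding weight_def by (simp add: cvs.scale_left_distrib)
    moreover have "of_nat (a + b) \<in> (of_nat ` {1..} :: complex set)"
      by (rule imageI) (use that(2) in auto)
    ultimately show ?thesis by blast
  qed
  then have "orbit act lowering {z} \<subseteq> insert z ?P"
    using orbit_weight by blast
  then have "x \<in> cvs.span (insert z ?P)"
    using assms(1) cvs.span_mono unfolding L_eq_span_orbit by blast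
  then obtain c where c: "x - c *\<^sub>C z \<in> cvs.span ?P"
    by (auto simp: cvs.span_insert)
  have z: "weight 0 0 z" by (simp add: weight_def H0_z D_z)
  have "?G (x - c *\<^sub>C z) = 0 *\<^sub>C (x - c *\<^sub>C z)"
    using alpha1_weight[OF assms(2)] alpha1_weight[OF z] assms(2) z
    by (simp add: cvs_pair.linear_diff[OF G] cvs_pair.linear_scale[OF G] weight_def
        cvs_pair.linear_diff[OF linear_alpha1] cvs_pair.linear_scale[OF linear_alpha1] act_diff act_scale)
  then have "x - c *\<^sub>C z = 0"
    using eigenvalue_in_span_eigenvectors[OF G c] by fastforce
  then show ?thesis by auto
qed

lemma act_L: "x \<in> L \<Longrightarrow> act g x \<in> L"
  by (rule submodule_act[OF submodule_cyclic])

lemma K_L: "x \<in> L \<Longrightarrow> act K x = k *\<^sub>C x"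
proof -
  assume x: "x \<in> L"
  have "submodule act {x. act K x = k *\<^sub>C x}"
    unfolding submodule_def cvs.subspace_def
    by (auto simp: act_zero act_add act_scale cvs.scale_right_distrib swap_K)
  then show ?thesis
    using cyclic_subset_submodule K_z x by blast
qed

text \<open>Operators of degree \<open>n\<close> lower the \<open>D\<close>-eigenvalue by \<open>n\<close>, and the eigenvalues are bounded below.\<close>

lemma L_restricted:
  assumes "x \<in> L"
  shows "\<exists>N. \<forall>n\<ge>N. act (E n) x = 0 \<and> act (F n) x = 0 \<and> act (H n) x = 0"
proof -
  have "x \<in> cvs.span {x \<in> L. \<exists>a b. weight a b x}" using assms L_eq_span_weights by simp
  then show ?thesis
  proof (induction rule: cvs.span_induct_alt)
    case base
    then show ?case by (simp add: act_zero)
  next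
    case (step c x y)
    then obtain a b where x: "x \<in> L" "act D x = of_nat b *\<^sub>C x" by (auto simp: weight_def)
    obtain N where N: "\<forall>n\<ge>N. act (E n) y = 0 \<and> act (F n) y = 0 \<and> act (H n) y = 0"
      using step.IH by blast
    have neg: "y = 0" if y: "y \<in> L" "act D y = (of_nat b - of_int n) *\<^sub>C y" "n > int b" for y n
    proof (rule ccontr)
      assume "y \<noteq> 0"
      then obtain b' :: nat where "of_nat b - of_int n = (of_nat b' :: complex)"
        using D_eigenvalue_nat y by blast
      then have "of_int (int b - n) = (of_int (int b') :: complex)" by simp
      then have "int b - n = int b'" by (simp only: of_int_eq_iff)
      then show False using y(3) by simp
    qed
    have "act (E n) x = 0 \<and> act (F n) x = 0 \<and> act (H n) x = 0" if "n > int b" for n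
      using that x
      by (intro conjI neg[of _ n] act_L)
        (simp_all add: swap_DE swap_DF swap_DH act_scale cvs.scale_left_diff_distrib)
    then show ?case
      using N by (intro exI[of _ "max N (int b + 1)"]) (auto simp: act_add act_scale)
  qed
qed

end

section \<open>The Casimir operator\<close>

text \<open>The contraction of \<open>\<ss>\<ll>\<^sub>2 \<otimes> t\<^sup>-\<^sup>n\<close> with \<open>\<ss>\<ll>\<^sub>2 \<otimes> t\<^sup>n\<close> by the invariant form.\<close>

definition casimir_block :: "(affine_sl2 \<Rightarrow> 'v::complex_vector \<Rightarrow> 'v) \<Rightarrow> int \<Rightarrow> 'v \<Rightarrow> 'v"
  where "casimir_block act n x = 4 *\<^sub>C act (F (- n)) (act (E n) x)
    + 4 *\<^sub>C act (E (- n)) (act (F n) x) + 2 *\<^sub>C act (H (- n)) (act (H n) x)"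

text \<open>Twice the Casimir operator of the affine algebra at level \<open>k\<close>, truncated at \<open>N\<close>. On a vector that is killed by
  all operators of large degree the value does not depend on large \<open>N\<close>. The factor two avoids
  fractions.\<close>

definition casimir :: "(affine_sl2 \<Rightarrow> 'v::complex_vector \<Rightarrow> 'v) \<Rightarrow> complex \<Rightarrow> nat \<Rightarrow> 'v \<Rightarrow> 'v"
  where "casimir act k N x = act (H 0) (act (H 0) x) + 2 *\<^sub>C act (H 0) x
    + 4 *\<^sub>C act (F 0) (act (E 0) x) - (4 * (k + 2)) *\<^sub>C act D x
    + (\<Sum>n = 1..N. casimir_block act (int n) x)"

text \<open>The action precomposed with the automorphism that exchanges the simple roots \<open>\<alpha>\<^sub>1\<close> and \<open>\<alpha>\<^sub>0\<close>. The image
  of \<open>D\<close> is fixed by the brackets only up to central elements; the multiple of \<open>K\<close> is the one that leaves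
  the Casimir operator invariant.\<close>

fun node_twist :: "(affine_sl2 \<Rightarrow> 'v::complex_vector \<Rightarrow> 'v) \<Rightarrow> affine_sl2 \<Rightarrow> 'v \<Rightarrow> 'v" where
  "node_twist act (E n) x = act (F (n + 1)) x"
| "node_twist act (F n) x = act (E (n - 1)) x"
| "node_twist act (H n) x = - act (H n) x + (if n = 0 then act K x else 0)"
| "node_twist act K x = act K x"
| "node_twist act D x = act D x - (1/2) *\<^sub>C act (H 0) x + (1/4) *\<^sub>C act K x"

context affine_sl2_module
begin

lemma swap_E0F: "act (E 0) (act (F n) x) = act (F n) (act (E 0) x) + act (H n) x"
  using swap_EF[of 0 n x] by simp

lemma swap_EF0: "act (E n) (act (F 0) x) = act (F 0) (act (E n) x) + act (H n) x"
  using swap_EF[of n 0 x] by (cases "n = 0") simp_all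

lemmas swap_KX = swap_K[of "E n" for n] swap_K[of "F n" for n] swap_K[of "H n" for n] swap_K[of D]

lemma swap_H0H: "act (H 0) (act (H n) x) = act (H n) (act (H 0) x)"
  using swap_HH[of 0 n x] by simp

lemma scale_2: "2 *\<^sub>C x = x + (x::'v)" and scale_4: "4 *\<^sub>C x = x + x + (x + (x::'v))"
proof -
  have 2: "2 *\<^sub>C x = x + x" for x :: 'v
    using cvs.scale_left_distrib[of 1 1 x] by (simp add: scaleC_one)
  then show "2 *\<^sub>C x = x + (x::'v)" .
  show "4 *\<^sub>C x = x + x + (x + (x::'v))"
    using cvs.scale_left_distrib[of 2 2 x] by (simp add: 2)
qed

text \<open>Each block is invariant under \<open>\<ss>\<ll>\<^sub>2\<close> because it comes from an invariant form; no limit is involved.\<close>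

lemma casimir_block_commutes:
  "act (E 0) (casimir_block act n x) = casimir_block act n (act (E 0) x)"
  "act (F 0) (casimir_block act n x) = casimir_block act n (act (F 0) x)"
proof -
  have HE: "act (E 0) (act (H m) y) = act (H m) (act (E 0) y) - 2 *\<^sub>C act (E m) y" for m y
    using swap_HE[of m 0 y] by simp
  have FH: "act (F 0) (act (H m) y) = act (H m) (act (F 0) y) + 2 *\<^sub>C act (F m) y" for m y
    using swap_HF[of m 0 y] by simp
  have FE: "act (F 0) (act (E m) y) = act (E m) (act (F 0) y) - act (H m) y" for m y
    using swap_EF0[of m y] by simp
  show "act (E 0) (casimir_block act n x) = casimir_block act n (act (E 0) x)"
    unfolding casimir_block_def
    by (simp only: act_add act_scale swap_E0F HE act_diff swap_EE[of 0])
      (simp add: scale_2 scale_4 act_add)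
  show "act (F 0) (casimir_block act n x) = casimir_block act n (act (F 0) x)"
    unfolding casimir_block_def
    by (simp only: act_add act_scale FE FH act_diff swap_FF[of 0])
      (simp add: scale_2 scale_4 act_add)
qed

lemma casimir_commutes:
  "act (E 0) (casimir act k N x) = casimir act k N (act (E 0) x)"
  "act (F 0) (casimir act k N x) = casimir act k N (act (F 0) x)"
proof -
  have HE: "act (E 0) (act (H 0) y) = act (H 0) (act (E 0) y) - 2 *\<^sub>C act (E 0) y" for y
    using swap_HE[of 0 0 y] by simp
  have FH: "act (F 0) (act (H 0) y) = act (H 0) (act (F 0) y) + 2 *\<^sub>C act (F 0) y" for y
    using swap_HF[of 0 0 y] by simp
  have DE: "act D (act (E 0) x) = act (E 0) (act D x)" and DF: "act D (act (F 0) x) = act (F 0) (act D x)"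
    using swap_DE[of 0 x] swap_DF[of 0 x] by simp_all
  have HFE: "act (H 0) (act (F 0) y) = act (F 0) (act (H 0) y) - 2 *\<^sub>C act (F 0) y" for y
    using swap_HF[of 0 0 y] by simp
  have "act (E 0) (act (H 0) (act (H 0) x)) + 2 *\<^sub>C act (E 0) (act (H 0) x)
      + 4 *\<^sub>C act (E 0) (act (F 0) (act (E 0) x))
    = act (H 0) (act (H 0) (act (E 0) x)) + 2 *\<^sub>C act (H 0) (act (E 0) x)
      + 4 *\<^sub>C act (F 0) (act (E 0) (act (E 0) x))"
    by (simp only: HE swap_E0F act_diff act_scale)
      (simp add: cvs.scale_right_diff_distrib cvs.scale_right_distrib scale_2 scale_4 scaleC_one act_add act_diff)
  then show "act (E 0) (casimir act k N x) = casimir act k N (act (E 0) x)"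
    unfolding casimir_def by (simp add: act_add act_diff act_scale act_sum casimir_block_commutes DE)
  have "act (F 0) (act (H 0) (act (H 0) x)) + 2 *\<^sub>C act (F 0) (act (H 0) x)
      + 4 *\<^sub>C act (F 0) (act (F 0) (act (E 0) x))
    = act (H 0) (act (H 0) (act (F 0) x)) + 2 *\<^sub>C act (H 0) (act (F 0) x)
      + 4 *\<^sub>C act (F 0) (act (E 0) (act (F 0) x))"
    by (simp only: FH swap_E0F act_add act_scale)
      (simp add: cvs.scale_right_diff_distrib cvs.scale_right_distrib scale_2 scale_4 scaleC_one
        act_add act_diff HFE)
  then show "act (F 0) (casimir act k N x) = casimir act k N (act (F 0) x)"
    unfolding casimir_def by (simp add: act_add act_diff act_scale act_sum casimir_block_commutes DF)
qed

lemma node_twist_module: "affine_sl2_module (node_twist act)"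
proof (rule affine_sl2_module.intro)
  fix g m n x
  let ?t = "node_twist act"
  show "clinear (?t g)"
    by (rule clinearI; cases g)
      (simp_all add: act_add act_scale act_diff cvs.scale_right_distrib cvs.scale_right_diff_distrib)
  show "?t (E m) (?t (E n) x) - ?t (E n) (?t (E m) x) = 0"
    by (simp add: FF)
  show "?t (F m) (?t (F n) x) - ?t (F n) (?t (F m) x) = 0"
    by (simp add: EE)
  show "?t (E m) (?t (F n) x) - ?t (F n) (?t (E m) x) =
    ?t (H (m + n)) x + (if m + n = 0 then of_int m *\<^sub>C ?t K x else 0)"
    by (simp add: swap_EF) (auto simp: algebra_simps scaleC_one eq_neg_iff_add_eq_0[symmetric])
  show "?t (H m) (?t (E n) x) - ?t (E n) (?t (H m) x) =
    2 *\<^sub>C ?t (E (m + n)) x"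
    by (simp add: swap_HF act_add act_neg act_diff swap_KX act_zero add.assoc)
  show "?t (H m) (?t (F n) x) - ?t (F n) (?t (H m) x) =
    (- 2) *\<^sub>C ?t (F (m + n)) x"
    by (simp add: swap_HE act_add act_neg act_diff swap_KX act_zero add_diff_eq)
  show "?t (H m) (?t (H n) x) - ?t (H n) (?t (H m) x) =
    (if m + n = 0 then (2 * of_int m) *\<^sub>C ?t K x else 0)"
    using HH[of m n x] by (auto simp: act_add act_neg act_diff swap_KX act_zero algebra_simps)
  show "?t K (?t g x) - ?t g (?t K x) = 0"
    by (cases g) (simp_all add: act_add act_neg act_diff act_scale swap_KX act_zero)
  show "?t D (?t (E n) x) - ?t (E n) (?t D x) =
    (- of_int n) *\<^sub>C ?t (E n) x"
    by (simp add: swap_DF swap_HF swap_KX act_add act_diff act_scale algebra_simps scaleC_one)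
  show "?t D (?t (H n) x) - ?t (H n) (?t D x) =
    (- of_int n) *\<^sub>C ?t (H n) x"
    by (simp add: swap_DH swap_H0H swap_KX act_add act_diff act_scale act_neg act_zero
        algebra_simps scaleC_one)
  show "?t D (?t (F n) x) - ?t (F n) (?t D x) =
    (- of_int n) *\<^sub>C ?t (F n) x"
    by (simp add: swap_DE swap_HE swap_KX act_add act_diff act_scale algebra_simps scaleC_one)
qed

text \<open>The automorphism only shifts the summation index of the real root terms, so the truncations differ in
  the two boundary terms.\<close>

lemma casimir_node_twist:
  assumes K: "act K x = k *\<^sub>C x"
  shows "casimir (node_twist act) k N x = casimir act k N x
    + 4 *\<^sub>C act (E (- int N - 1)) (act (F (int N + 1)) x) - 4 *\<^sub>C act (F (- int N)) (act (E (int N)) x)"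
proof (induction N)
  case 0
  have KK: "act K (act (H 0) x) = k *\<^sub>C act (H 0) x"
    by (simp add: swap_K K act_scale)
  have 2: "(2 * k) *\<^sub>C y = k *\<^sub>C y + k *\<^sub>C y" for y :: 'v
    by (simp only: mult_2 cvs.scale_left_distrib)
  have "casimir (node_twist act) k 0 x
    = (act (H 0) (act (H 0) x) - (2 * k) *\<^sub>C act (H 0) x + (k * k) *\<^sub>C x)
      + 2 *\<^sub>C (k *\<^sub>C x - act (H 0) x) + 4 *\<^sub>C act (E (- 1)) (act (F 1) x)
      - (4 * (k + 2)) *\<^sub>C (act D x - (1/2) *\<^sub>C act (H 0) x + ((1/4) * k) *\<^sub>C x)"
    unfolding casimir_def
    by (simp add: act_add act_neg act_scale act_diff K KK 2 scaleC_scaleC)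
  also have "\<dots> = act (H 0) (act (H 0) x) + 2 *\<^sub>C act (H 0) x - (4 * (k + 2)) *\<^sub>C act D x
      + 4 *\<^sub>C act (E (- 1)) (act (F 1) x)"
  proof -
    have "4 * (k + 2) * (1/2) = 2 * k + 4" by (simp add: field_simps)
    then have 1: "(4 * (k + 2)) *\<^sub>C ((1/2) *\<^sub>C y) = (2 * k) *\<^sub>C y + 4 *\<^sub>C y" for y :: 'v
      by (simp only: scaleC_scaleC cvs.scale_left_distrib)
    have "4 * (k + 2) * ((1/4) * k) = k * k + 2 * k" by (simp add: field_simps)
    then have 3: "(4 * (k + 2)) *\<^sub>C (((1/4) * k) *\<^sub>C y) = (k * k) *\<^sub>C y + 2 *\<^sub>C (k *\<^sub>C y)" for y :: 'v
      by (simp only: scaleC_scaleC cvs.scale_left_distrib)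
    show ?thesis
      unfolding cvs.scale_right_distrib cvs.scale_right_diff_distrib 1 3
      by (simp add: scale_2 scale_4)
  qed
  finally show ?case by (simp add: casimir_def)
next
  case (Suc N)
  have b: "casimir_block (node_twist act) m x = casimir_block act m x
     + 4 *\<^sub>C act (E (- m - 1)) (act (F (m + 1)) x) - 4 *\<^sub>C act (F (- m)) (act (E m) x)
     - (4 *\<^sub>C act (E (- m)) (act (F m) x) - 4 *\<^sub>C act (F (- m + 1)) (act (E (m - 1)) x))" if "m \<noteq> 0" for m
    using that unfolding casimir_block_def by (simp add: act_neg)
  have i: "int (Suc N) = int N + 1" "- (int N + 1) = - int N - 1" "- int N - 1 + 1 = - int N"
    "int N + 1 - 1 = int N" "int N + 1 \<noteq> 0" by simp_all
  have s: "casimir a k (Suc N) x = casimir a k N x + casimir_block a (int (Suc N)) x" for a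
    by (simp add: casimir_def)
  show ?case unfolding s Suc.IH i(1) b[OF i(5)] unfolding i by simp
qed

text \<open>\<open>h\<^sub>1\<close> and \<open>h\<^sub>-\<^sub>1\<close> are brackets of Chevalley generators, and they shift the degree of \<open>e\<^sub>n\<close> and \<open>f\<^sub>n\<close> by one.\<close>

lemma chevalley_generate:
  assumes S: "cvs.subspace S"
    and "\<And>x. x \<in> S \<Longrightarrow> act (E 0) x \<in> S" "\<And>x. x \<in> S \<Longrightarrow> act (F 0) x \<in> S"
    and "\<And>x. x \<in> S \<Longrightarrow> act (E (-1)) x \<in> S" "\<And>x. x \<in> S \<Longrightarrow> act (F 1) x \<in> S"
    and x: "x \<in> S"
  shows "act (E n) x \<in> S" "act (F n) x \<in> S" "act (H n) x \<in> S"
proof -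
  note sub = cvs.subspace_add[OF S] cvs.subspace_diff[OF S] cvs.subspace_scale[OF S]
  have half: "y \<in> S" if "2 *\<^sub>C y \<in> S" for y
    using sub(3)[OF that, of "1/2"] by (simp add: scaleC_scaleC scaleC_one)
  have H1: "act (H 1) x \<in> S" if "x \<in> S" for x
    using sub(2)[OF assms(2)[OF assms(5)[OF that]] assms(5)[OF assms(2)[OF that]]]
    by (simp add: swap_E0F)
  have Hm1: "act (H (-1)) x \<in> S" if "x \<in> S" for x
    using sub(2)[OF assms(4)[OF assms(3)[OF that]] assms(3)[OF assms(4)[OF that]]]
    by (simp add: swap_EF0)
  have E: "\<forall>x\<in>S. act (E n) x \<in> S" for n
  proof (induction n rule: int_induct[where k = 0])
    case base
    then show ?case using assms(2) by blast
  next
    case (step1 n)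
    then show ?case
      using H1 sub(2) half by (metis HE add.commute)
  next
    case (step2 n)
    have "- 1 + n = n - 1" by simp
    then show ?case using Hm1 sub(2) half step2 by (metis HE)
  qed
  have F: "\<forall>x\<in>S. act (F n) x \<in> S" for n
  proof (induction n rule: int_induct[where k = 0])
    case base
    then show ?case using assms(3) by blast
  next
    case (step1 n)
    have "- ((-2) *\<^sub>C y) = 2 *\<^sub>C y" for y :: 'v by simp
    then show ?case
      using H1 sub(2) half step1 cvs.subspace_neg[OF S] by (metis HF add.commute)
  next
    case (step2 n)
    have "- ((-2) *\<^sub>C y) = 2 *\<^sub>C y" for y :: 'v by simp
    moreover have "- 1 + n = n - 1" by simp
    ultimately show ?case
      using Hm1 sub(2) half step2 cvs.subspace_neg[OF S] by (metis HF)
  qed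
  show "act (E n) x \<in> S" "act (F n) x \<in> S" using E F x by blast+
  have "act (E n) (act (F 0) x) - act (F 0) (act (E n) x) \<in> S"
    using E F x sub(2) by blast
  then show "act (H n) x \<in> S" by (simp add: swap_EF0)
qed

lemma singular_raising:
  assumes "act (E 0) x = 0" "act (F 1) x = 0"
  shows "0 \<le> n \<Longrightarrow> act (E n) x = 0" "0 < n \<Longrightarrow> act (F n) x = 0" "0 < n \<Longrightarrow> act (H n) x = 0"
proof -
  have H1: "act (H 1) x = 0"
    using swap_E0F[of 1 x] assms by (simp add: act_zero)
  have E: "act (E (int m)) x = 0" for m
  proof (induction m)
    case 0
    then show ?case using assms by simp
  next
    case (Suc m)
    then show ?case using swap_HE[of 1 "int m" x] H1 by (simp add: act_zero)
  qed
  have F: "act (F (int m + 1)) x = 0" for m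
  proof (induction m)
    case 0
    then show ?case using assms by simp
  next
    case (Suc m)
    then show ?case using swap_HF[of 1 "int m + 1" x] H1 by (simp add: act_zero algebra_simps)
  qed
  show "act (E n) x = 0" if "0 \<le> n" using E[of "nat n"] that by simp
  show F': "act (F n) x = 0" if "0 < n" using F[of "nat (n - 1)"] that by simp
  show "act (H n) x = 0" if "0 < n"
    using swap_E0F[of n x] F'[OF that] assms by (simp add: act_zero)
qed

end

context highest_weight_module
begin

text \<open>The vectors on which the truncations eventually take this value are stable under
  \<open>e\<^sub>0\<close> and \<open>f\<^sub>0\<close>; applied to the twisted action invariance under \<open>\<ss>\<ll>\<^sub>2\<close> also gives stability under the other two
  Chevalley generators.\<close>

lemma casimir_on_L:
  assumes "x \<in> L"
  shows "\<exists>N0. \<forall>N\<ge>N0. casimir act k N x = (l * (l + 2)) *\<^sub>C x"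
proof -
  interpret T: affine_sl2_module "node_twist act" by (rule node_twist_module)
  let ?c = "l * (l + 2)"
  let ?C = "{x \<in> L. \<exists>N0. \<forall>N\<ge>N0. casimir act k N x = ?c *\<^sub>C x}"
  have cas_add: "casimir act k N (x + y) = casimir act k N x + casimir act k N y"
    and cas_scale: "casimir act k N (c *\<^sub>C x) = c *\<^sub>C casimir act k N x" for N x y c
    unfolding casimir_def casimir_block_def
    by (simp_all add: act_add act_scale cvs.scale_right_distrib cvs.scale_right_diff_distrib
        sum.distrib cvs.scale_sum_right mult.commute)
  have twist: "\<exists>N0. \<forall>N\<ge>N0. casimir (node_twist act) k N x = casimir act k N x" if x: "x \<in> L" for x
  proof -
    obtain N0 where N0: "\<forall>n\<ge>N0. act (E n) x = 0 \<and> act (F n) x = 0 \<and> act (H n) x = 0"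
      using L_restricted[OF x] by blast
    then have "casimir (node_twist act) k N x = casimir act k N x" if "N \<ge> nat N0" for N
      using that by (simp add: casimir_node_twist[OF K_L[OF x]] act_zero)
    then show ?thesis by blast
  qed
  have eventually: "\<exists>N0. \<forall>N\<ge>N0. P N \<and> Q N"
    if "\<exists>N0::nat. \<forall>N\<ge>N0. P N" "\<exists>N0. \<forall>N\<ge>N0. Q N" for P Q
    using that by (metis le_trans max.cobounded1 max.cobounded2)
  have C: "cvs.subspace ?C"
  proof (rule cvs.subspaceI)
    show "0 \<in> ?C"
      using submodule_zero[OF submodule_cyclic] cas_scale[of _ 0 0] by simp
  next
    fix x y assume xy: "x \<in> ?C" "y \<in> ?C"
    have "\<exists>N0. \<forall>N\<ge>N0. casimir act k N x = ?c *\<^sub>C x \<and> casimir act k N y = ?c *\<^sub>C y"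
      by (rule eventually) (use xy in auto)
    then have "\<exists>N0. \<forall>N\<ge>N0. casimir act k N (x + y) = ?c *\<^sub>C (x + y)"
      by (simp only: cas_add cvs.scale_right_distrib) metis
    then show "x + y \<in> ?C"
      using xy submodule_add[OF submodule_cyclic] by blast
  next
    fix c x assume "x \<in> ?C"
    then show "c *\<^sub>C x \<in> ?C"
      by (simp only: mem_Collect_eq cas_scale) (metis cvs.scale_left_commute submodule_scale submodule_cyclic)
  qed
  have E0: "act (E 0) x \<in> ?C" and F0: "act (F 0) x \<in> ?C" if "x \<in> ?C" for x
    using that by (simp_all add: act_L flip: casimir_commutes) (metis act_scale)+
  have EF: "act (E (-1)) x \<in> ?C" "act (F 1) x \<in> ?C" if "x \<in> ?C" for x
  proof -
    have "\<exists>N0. \<forall>N\<ge>N0. casimir act k N (node_twist act g x) = ?c *\<^sub>C node_twist act g x"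
      if g: "g = E 0 \<or> g = F 0" for g
    proof -
      have "node_twist act g x \<in> L" using g \<open>x \<in> ?C\<close> by (auto simp: act_L)
      note ev = eventually[OF twist[OF this] eventually[OF twist[of x],
        of "\<lambda>N. casimir act k N x = ?c *\<^sub>C x"]]
      have "node_twist act g (casimir (node_twist act) k N x)
          = casimir (node_twist act) k N (node_twist act g x)" for N
        using g T.casimir_commutes by auto
      then show ?thesis
        using ev \<open>x \<in> ?C\<close> by (auto simp: T.act_scale) (metis T.act_scale)
    qed
    from this[of "E 0"] this[of "F 0"] show "act (E (-1)) x \<in> ?C" "act (F 1) x \<in> ?C"
      using that by (auto simp: act_L)
  qed
  have zC: "z \<in> ?C"
  proof -
    have c: "?c = l * l + 2 * l" by (simp add: distrib_left)
    have "casimir act k N z = ?c *\<^sub>C z" for N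
      unfolding casimir_def casimir_block_def c
      by (simp add: E_z F_z H_z H0_z D_z act_zero act_scale scaleC_scaleC cvs.scale_left_distrib)
    then show ?thesis using generator_in_cyclic by blast
  qed
  have "x \<in> ?C" if "x \<in> orbit act lowering {z}" for x
    using that
  proof induction
    case (base x)
    then show ?case using zC by blast
  next
    case (step x g)
    then show ?case
      using chevalley_generate[OF C E0 F0 EF] unfolding lowering_def by blast
  qed
  then have "L \<subseteq> ?C"
    unfolding L_eq_span_orbit using C L_eq_span_orbit by (intro cvs.span_minimal) auto
  then show ?thesis using assms by blast
qed

text \<open>Take a weight vector in \<open>R\<close> for which the height \<open>a + b\<close> is minimal: the raising Chevalley generators
  decrease the height by one.\<close>

lemma singular_submodule_vector:
  assumes R: "submodule act R" "R \<subseteq> L" and "x \<in> R" "x \<noteq> 0"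
  obtains y a b where "y \<in> R" "y \<noteq> 0" "weight a b y" "act (E 0) y = 0" "act (F 1) y = 0"
proof -
  have sub: "cvs.subspace R" using R by (simp add: submodule_def)
  obtain b y where y: "y \<in> R" "y \<noteq> 0" "act D y = of_nat b *\<^sub>C y"
    using eigenvector_in_invariant_subspace[OF linear L_span_D sub submodule_act[OF R(1)]]
      R(2) assms(3,4) by blast
  let ?R = "{y \<in> R. act D y = of_nat b *\<^sub>C y}"
  have "cvs.subspace ?R"
    using submodule_zero[OF R(1)] submodule_add[OF R(1)] submodule_scale[OF R(1)]
    by (auto intro!: cvs.subspaceI simp: act_zero act_add act_scale cvs.scale_right_distrib)
  moreover have "alpha1_coeff u \<in> ?R" if "u \<in> ?R" for u
  proof -
    have "act D (alpha1_coeff u) = alpha1_coeff (act D u)"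
      using swap_DH[of 0 u] by (simp add: alpha1_coeff_def act_scale act_add act_diff)
    moreover have "alpha1_coeff u \<in> R"
      using that by (auto simp: alpha1_coeff_def intro!: submodule_scale[OF R(1)]
          submodule_diff[OF R(1)] submodule_add[OF R(1)] submodule_act[OF R(1)])
    ultimately show ?thesis using that by (simp add: cvs_pair.linear_scale[OF linear_alpha1])
  qed
  ultimately have "\<exists>c\<in>range of_nat. \<exists>u\<in>?R. u \<noteq> 0 \<and> alpha1_coeff u = c *\<^sub>C u"
    using R(2) y by (intro eigenvector_in_invariant_subspace[OF linear_alpha1 L_span_alpha1, of y]) auto
  then obtain a u where "u \<in> R" "u \<noteq> 0" "weight a b u"
    using weight_from_alpha1_D by blast
  then have "\<exists>n a b u. n = a + b \<and> u \<in> R \<and> u \<noteq> 0 \<and> weight a b u" by blast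
  then obtain n where n: "\<exists>a b u. n = a + b \<and> u \<in> R \<and> u \<noteq> 0 \<and> weight a b u"
    and least: "\<And>m. m < n \<Longrightarrow> \<not> (\<exists>a b u. m = a + b \<and> u \<in> R \<and> u \<noteq> 0 \<and> weight a b u)"
    by (rule exists_least_iff[THEN iffD1, THEN exE]) blast
  obtain a b u where u: "n = a + b" "u \<in> R" "u \<noteq> 0" "weight a b u" using n by blast
  have "act (E 0) u = 0"
  proof (rule ccontr)
    assume nz: "act (E 0) u \<noteq> 0"
    have "act (H 0) (act (E 0) u) = (l - 2 * of_nat a + 2 * of_nat b + 2) *\<^sub>C act (E 0) u"
      and "act D (act (E 0) u) = of_nat b *\<^sub>C act (E 0) u"
      using u(4) by (simp_all add: weight_def swap_HE swap_DE act_scale act_add act_diff cvs.scale_left_distrib)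
    then obtain a' b' where "l - 2 * of_nat a + 2 * of_nat b + 2 = l - 2 * of_nat a' + 2 * of_nat b'"
      "of_nat b = (of_nat b' :: complex)" and w: "weight a' b' (act (E 0) u)"
      using weights_in_L[of "act (E 0) u"] nz R u(2) submodule_act[OF R(1)] by blast
    then have "b' = b" "2 * of_nat (a' + 1) = 2 * (of_nat a :: complex)" by (auto simp: algebra_simps)
    then have "b' = b" "a' + 1 = a"
      by (simp_all del: of_nat_add of_nat_Suc add: of_nat_eq_iff)
    then have "a' + b' < n" using u(1) by simp
    then show False using least w nz submodule_act[OF R(1) u(2)] by blast
  qed
  moreover have "act (F 1) u = 0"
  proof (rule ccontr)
    assume nz: "act (F 1) u \<noteq> 0"
    have "act (H 0) (act (F 1) u) = (l - 2 * of_nat a + 2 * of_nat b - 2) *\<^sub>C act (F 1) u"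
      and "act D (act (F 1) u) = (of_nat b - 1) *\<^sub>C act (F 1) u"
      using u(4) by (simp_all add: weight_def swap_HF swap_DF act_scale act_add act_diff cvs.scale_left_diff_distrib scaleC_one)
    then obtain a' b' where "l - 2 * of_nat a + 2 * of_nat b - 2 = l - 2 * of_nat a' + 2 * of_nat b'"
      "of_nat b - 1 = (of_nat b' :: complex)" and w: "weight a' b' (act (F 1) u)"
      using weights_in_L[of "act (F 1) u"] nz R u(2) submodule_act[OF R(1)] by blast
    then have "of_nat (b' + 1) = (of_nat b :: complex)" "of_nat (a' + b) = (of_nat (a + b' + 1) :: complex)"
      by (auto simp: algebra_simps)
    then have "a' + b' < n" using u(1) by (simp only: of_nat_eq_iff)
    then show False using least w nz submodule_act[OF R(1) u(2)] by blast
  qed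
  ultimately show thesis using that u by blast
qed

text \<open>Let \<open>y\<close> be singular of weight \<open>\<mu> = \<Lambda> - a \<alpha>\<^sub>1 - b \<alpha>\<^sub>0\<close>. Comparing the values of the Casimir operator on \<open>y\<close>
  and on \<open>z\<close> yields \<open>a (l + \<mu> + 2) + b (2k + 2 - l - \<mu>) = 0\<close>. Integrability makes both weights dominant, so both
  factors in parentheses are positive and \<open>a = b = 0\<close>.\<close>

lemma submodule_contains_highest_weight_vector:
  assumes nil: "\<And>x. \<exists>N. (act (F 0) ^^ N) x = 0" "\<And>x. \<exists>N. (act (E (-1)) ^^ N) x = 0"
    and lk: "l = of_nat l'" "k = of_nat k'"
    and R: "submodule act R" "R \<subseteq> L" and "x \<in> R" "x \<noteq> 0"
  shows "z \<in> R"
proof -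
  obtain y a b where y: "y \<in> R" "y \<noteq> 0" "weight a b y" "act (E 0) y = 0" "act (F 1) y = 0"
    using singular_submodule_vector[OF R \<open>x \<in> R\<close> \<open>x \<noteq> 0\<close>] by blast
  have yL: "y \<in> L" using y R by blast
  interpret T: affine_sl2_module "node_twist act" by (rule node_twist_module)
  have dominant: "\<exists>s t. \<mu> = of_nat s \<and> k - \<mu> = of_nat t"
    if u: "u \<in> L" "u \<noteq> 0" "act (E 0) u = 0" "act (F 1) u = 0" "act (H 0) u = \<mu> *\<^sub>C u" for u \<mu>
  proof -
    obtain N M where NM: "(act (F 0) ^^ N) u = 0" "(act (E (-1)) ^^ M) u = 0" using nil by blast
    have "\<exists>s. \<mu> = of_nat s \<and> (act (F 0) ^^ s) u \<noteq> 0 \<and> (act (F 0) ^^ Suc s) u = 0"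
      using swap_HF[of 0 0]
      by (intro sl2_primitive_vector[OF linear[of "E 0"] linear[of "F 0"] swap_EF0 _ u(3,5,2) NM(1)]) simp
    moreover have "node_twist act (F 0) = act (E (-1))" by (rule ext) simp
    then have "\<exists>s. k - \<mu> = of_nat s \<and> (node_twist act (F 0) ^^ s) u \<noteq> 0
        \<and> (node_twist act (F 0) ^^ Suc s) u = 0"
      using T.swap_HF[of 0 0] T.swap_EF0[of 0] NM(2) u K_L[OF u(1)]
      by (intro sl2_primitive_vector[OF T.linear[of "E 0"] T.linear[of "F 0"], where h = "node_twist act (H 0)"])
        (auto simp: cvs.scale_left_diff_distrib simp del: node_twist.simps(2))
    ultimately show ?thesis by blast
  qed
  define \<mu> where "\<mu> = l - 2 * of_nat a + 2 * of_nat b"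
  have H0y: "act (H 0) y = \<mu> *\<^sub>C y" and Dy: "act D y = of_nat b *\<^sub>C y"
    using y(3) by (simp_all add: weight_def \<mu>_def)
  obtain s t where s: "\<mu> = of_nat s" "k - \<mu> = of_nat t"
    using dominant[OF yL y(2,4,5) H0y] by blast
  obtain t' where t': "k - l = of_nat t'"
    using dominant[OF generator_in_cyclic z_nonzero _ _ H0_z] E_z[of 0] F_z[of 1] by auto
  have raise: "act (E n) y = 0" "0 < n \<Longrightarrow> act (F n) y = 0" "0 < n \<Longrightarrow> act (H n) y = 0" if "0 \<le> n" for n
    using singular_raising[OF y(4,5)] that by auto
  obtain N0 where "casimir act k N0 y = (l * (l + 2)) *\<^sub>C y"
    using casimir_on_L[OF yL] by blast
  moreover have "casimir act k N0 y = (\<mu> * \<mu> + 2 * \<mu> - 4 * (k + 2) * of_nat b) *\<^sub>C y"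
    unfolding casimir_def casimir_block_def
    by (simp add: raise H0y Dy act_zero act_scale scaleC_scaleC cvs.scale_left_distrib
        cvs.scale_left_diff_distrib)
  ultimately have "l * (l + 2) = \<mu> * \<mu> + 2 * \<mu> - 4 * (k + 2) * of_nat b"
    using y(2) cvs.scale_right_imp_eq by metis
  then have "2 * (of_nat a * (l + \<mu> + 2) + of_nat b * (2 * k + 2 - l - \<mu>)) = 0"
    unfolding \<mu>_def by (simp add: algebra_simps)
  moreover have "2 * k + 2 - l - \<mu> = of_nat (t + t' + 2)"
    using s(2) t' by (simp add: algebra_simps flip: s(2) t')
  moreover have "l + \<mu> + 2 = of_nat (l' + s + 2)" using s(1) lk by simp
  ultimately have "(of_nat (2 * (a * (l' + s + 2) + b * (t + t' + 2))) :: complex) = of_nat 0"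
    by (simp only: of_nat_add of_nat_mult of_nat_0 of_nat_numeral)
  then have "a = 0" "b = 0" unfolding of_nat_eq_iff by auto
  then obtain c where c: "y = c *\<^sub>C z"
    using highest_weight_space[OF yL] y(3) by blast
  then show ?thesis using submodule_scale_cancel[OF R(1)] y(1,2) by auto
qed

end

text \<open>The cyclic submodule generated by \<open>(x, y)\<close> in the direct sum is the graph of the isomorphism: its
  intersection with either summand is a submodule that does not contain \<open>(x, y)\<close>, hence zero.\<close>

lemma highest_weight_module_iso:
  fixes A :: "affine_sl2 \<Rightarrow> 'v::complex_vector \<Rightarrow> 'v" and B :: "affine_sl2 \<Rightarrow> 'w::complex_vector \<Rightarrow> 'w"
  assumes A: "affine_sl2_module A" and B: "affine_sl2_module B"
    and x: "highest_weight_vector A (of_nat l) (of_nat k) x"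
    and y: "highest_weight_vector B (of_nat l) (of_nat k) y"
    and gen: "cyclic_submodule A x = UNIV"
    and nilA: "\<And>u. \<exists>N. (A (F 0) ^^ N) u = 0" "\<And>u. \<exists>N. (A (E (-1)) ^^ N) u = 0"
    and nilB: "\<And>u. \<exists>N. (B (F 0) ^^ N) u = 0" "\<And>u. \<exists>N. (B (E (-1)) ^^ N) u = 0"
  obtains \<psi> where "clinear \<psi>" "inj \<psi>" "range \<psi> = cyclic_submodule B y" "\<And>g u. \<psi> (A g u) = B g (\<psi> u)"
proof -
  interpret A: affine_sl2_module A by (rule A)
  interpret B: affine_sl2_module B by (rule B)
  let ?C = "direct_sum_act A B"
  have "highest_weight_vector ?C (of_nat l) (of_nat k) (x, y)"
    using x y by (auto simp: highest_weight_vector_def direct_sum_act_def scaleC_prod_def zero_prod_def)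
  then interpret C: highest_weight_module ?C "of_nat l" "of_nat k" "(x, y)"
    using direct_sum_act_module[OF A B] by (simp add: highest_weight_module_def highest_weight_module_axioms_def)
  let ?G = "cyclic_submodule ?C (x, y)"
  have G: "submodule ?C ?G" by (rule C.submodule_cyclic)
  have pow: "(?C g ^^ n) p = ((A g ^^ n) (fst p), (B g ^^ n) (snd p))" for g n p
    by (induction n) (simp_all add: direct_sum_act_def)
  have nil: "\<exists>N. (?C g ^^ N) p = 0" if g: "g = F 0 \<or> g = E (-1)" for g p
  proof -
    obtain N M where "(A g ^^ N) (fst p) = 0" "(B g ^^ M) (snd p) = 0"
      using g nilA nilB by blast
    then have "(?C g ^^ max N M) p = 0"
      unfolding pow zero_prod_def
      by (auto intro: funpow_zero_mono[where f = "A g", OF A.act_zero] funpow_zero_mono[where f = "B g", OF B.act_zero])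
    then show ?thesis by blast
  qed
  have contains: "(x, y) \<in> R" if "submodule ?C R" "R \<subseteq> ?G" "p \<in> R" "p \<noteq> 0" for R p
    using C.submodule_contains_highest_weight_vector[OF nil nil refl refl that] by blast
  have x0: "x \<noteq> 0" and y0: "y \<noteq> 0" using x y by (simp_all add: highest_weight_vector_def)
  have sub1: "submodule ?C {p \<in> ?G. snd p = 0}" and sub2: "submodule ?C {p \<in> ?G. fst p = 0}"
    using G by (auto simp: submodule_def cvs.subspace_def direct_sum_act_def scaleC_prod_def
        A.act_zero B.act_zero) (metis cvs.scale_zero_right fst_conv snd_conv)+
  have left: "u = 0" if "(u, 0) \<in> ?G" for u
    using contains[OF sub1, of "(u, 0)"] that y0 by (auto simp: zero_prod_def)
  have right: "v = 0" if "(0, v) \<in> ?G" for v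
    using contains[OF sub2, of "(0, v)"] that x0 by (auto simp: zero_prod_def)
  have foldr: "foldr ?C gs (x, y) = (foldr A gs x, foldr B gs y)" for gs
    by (induction gs) (simp_all add: direct_sum_act_def)
  have fst: "clinear (fst :: 'v \<times> 'w \<Rightarrow> 'v)" and snd: "clinear (snd :: 'v \<times> 'w \<Rightarrow> 'w)"
    by (rule clinearI; simp add: scaleC_prod_def)+
  have "fst ` ?G = UNIV"
    unfolding gen[symmetric] cyclic_submodule_def
    by (simp add: cvs_pair.linear_span_image[OF fst, symmetric] image_image foldr)
  then have ex: "\<exists>v. (u, v) \<in> ?G" for u by (metis UNIV_I imageE prod.collapse)
  have range: "snd ` ?G = cyclic_submodule B y"
    unfolding cyclic_submodule_def
    by (simp add: cvs_pair.linear_span_image[OF snd, symmetric] image_image foldr)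
  have uniq: "v = v'" if "(u, v) \<in> ?G" "(u, v') \<in> ?G" for u v v'
    using right[of "v - v'"] submodule_diff[OF G that] by simp
  define \<psi> where "\<psi> u = (THE v. (u, v) \<in> ?G)" for u
  have \<psi>: "(u, \<psi> u) \<in> ?G" for u
    unfolding \<psi>_def using ex[of u] uniq by (metis theI)
  have \<psi>I: "\<psi> u = v" if "(u, v) \<in> ?G" for u v
    using uniq[OF \<psi> that] .
  show thesis
  proof
    show "clinear \<psi>"
    proof (rule clinearI)
      show "\<psi> (u + v) = \<psi> u + \<psi> v" for u v
        using submodule_add[OF G \<psi> \<psi>, of u v] by (intro \<psi>I) simp
      show "\<psi> (c *\<^sub>C u) = c *\<^sub>C \<psi> u" for c u
        using submodule_scale[OF G \<psi>, of c u] by (intro \<psi>I) (simp add: scaleC_prod_def)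
    qed
    show "inj \<psi>"
    proof (rule injI)
      fix u v assume "\<psi> u = \<psi> v"
      then show "u = v"
        using submodule_diff[OF G \<psi> \<psi>, of u v] left[of "u - v"] by simp
    qed
    show "range \<psi> = cyclic_submodule B y"
      unfolding range[symmetric] using \<psi> \<psi>I by (force simp: image_iff)
    show "\<psi> (A g u) = B g (\<psi> u)" for g u
      using submodule_act[OF G \<psi>, of g u] by (intro \<psi>I) (simp add: direct_sum_act_def)
  qed
qed

section \<open>Extremal vectors of level one\<close>

text \<open>The relations satisfied by a level one extremal vector of \<open>h\<^sub>0\<close>-weight \<open>- p\<close>. For \<open>p = 0\<close> they say that \<open>x\<close> is
  a vacuum vector, up to the normalization of \<open>D\<close>.\<close>

definition extremal_at :: "(affine_sl2 \<Rightarrow> 'v::complex_vector \<Rightarrow> 'v) \<Rightarrow> int \<Rightarrow> 'v \<Rightarrow> bool"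
  where "extremal_at act p x \<longleftrightarrow> x \<noteq> 0 \<and> act K x = x \<and> act (H 0) x = (- of_int p) *\<^sub>C x \<and>
    (\<exists>d. act D x = d *\<^sub>C x) \<and> (\<forall>m\<ge>p. act (E m) x = 0) \<and> (\<forall>m\<ge>-p. act (F m) x = 0) \<and>
    (\<forall>m>0. act (H m) x = 0)"

text \<open>The action precomposed with a translation in the extended affine Weyl group. It turns \<open>v(p)\<close>
  into \<open>v(p - r)\<close>, so questions about \<open>v(p)\<close> reduce to the vacuum and reflections in arbitrary real roots to
  the reflection in \<open>\<alpha>\<^sub>1\<close>. The parameter \<open>\<delta>\<close> serves to normalize \<open>D\<close> to be zero on a given vector.\<close>

fun shift_twist :: "(affine_sl2 \<Rightarrow> 'v::complex_vector \<Rightarrow> 'v) \<Rightarrow> int \<Rightarrow> complex \<Rightarrow> affine_sl2 \<Rightarrow> 'v \<Rightarrow> 'v" where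
  "shift_twist act r \<delta> (E n) x = act (E (n + r)) x"
| "shift_twist act r \<delta> (F n) x = act (F (n - r)) x"
| "shift_twist act r \<delta> (H n) x = act (H n) x + (if n = 0 then of_int r *\<^sub>C act K x else 0)"
| "shift_twist act r \<delta> K x = act K x"
| "shift_twist act r \<delta> D x = act D x + (of_int r / 2) *\<^sub>C act (H 0) x + \<delta> *\<^sub>C act K x"

text \<open>The action precomposed with the automorphism that exchanges \<open>e\<close> and \<open>f\<close>.\<close>

fun chevalley_twist :: "(affine_sl2 \<Rightarrow> 'v::complex_vector \<Rightarrow> 'v) \<Rightarrow> affine_sl2 \<Rightarrow> 'v \<Rightarrow> 'v" where
  "chevalley_twist act (E n) x = act (F n) x"
| "chevalley_twist act (F n) x = act (E n) x"
| "chevalley_twist act (H n) x = - act (H n) x"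
| "chevalley_twist act K x = act K x"
| "chevalley_twist act D x = act D x"

lemma extremal_at_shift:
  assumes "extremal_at act p x"
  shows "extremal_at (shift_twist act r \<delta>) (p - r) x"
proof -
  obtain d where d: "act D x = d *\<^sub>C x" using assms by (auto simp: extremal_at_def)
  have "\<exists>d. shift_twist act r \<delta> D x = d *\<^sub>C x"
    using assms d unfolding extremal_at_def
    by (intro exI[of _ "d + of_int r / 2 * (- of_int p) + \<delta>"])
      (simp add: cvs.scale_left_distrib cvs.scale_left_diff_distrib)
  then show ?thesis
    using assms unfolding extremal_at_def
    by (auto simp: cvs.scale_left_diff_distrib simp flip: cvs.scale_left_distrib)
qed

lemma extremal_at_unshift:
  assumes "extremal_at (shift_twist act r \<delta>) p x"
  shows "extremal_at act (p + r) x"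
proof -
  have K: "act K x = x" using assms by (simp add: extremal_at_def)
  have H: "act (H 0) x = (- of_int (p + r)) *\<^sub>C x"
    using assms by (simp add: extremal_at_def eq_diff_eq cvs.scale_left_distrib K algebra_simps)
  obtain d where d: "act D x + (of_int r / 2) *\<^sub>C act (H 0) x + \<delta> *\<^sub>C act K x = d *\<^sub>C x"
    using assms by (auto simp: extremal_at_def)
  then have "act D x = d *\<^sub>C x - (of_int r / 2) *\<^sub>C act (H 0) x - \<delta> *\<^sub>C act K x"
    by (simp add: algebra_simps)
  then have "act D x = (d - (of_int r / 2) * (- of_int (p + r)) - \<delta>) *\<^sub>C x"
    unfolding H K cvs.scale_scale by (simp only: cvs.scale_left_diff_distrib)
  moreover have "act (E m) x = 0" if "p + r \<le> m" for m
    using assms that by (auto simp: extremal_at_def dest: spec[of _ "m - r"])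
  moreover have "act (F m) x = 0" if "- (p + r) \<le> m" for m
    using assms that by (auto simp: extremal_at_def dest: spec[of _ "m + r"])
  ultimately show ?thesis
    using assms H K unfolding extremal_at_def by auto
qed

lemma extremal_at_chevalley:
  "extremal_at (chevalley_twist act) (- p) x \<longleftrightarrow> extremal_at act p x"
proof -
  have "chevalley_twist act (H 0) x = (- of_int (- p)) *\<^sub>C x \<longleftrightarrow> act (H 0) x = (- of_int p) *\<^sub>C x"
    by simp (metis minus_minus)
  then show ?thesis unfolding extremal_at_def by auto
qed

lemma submodule_shift_twist:
  assumes "submodule (shift_twist act r \<delta>) S"
  shows "submodule act S"
  unfolding submodule_def
proof (intro conjI allI ballI)
  show "cvs.subspace S" using assms by (simp add: submodule_def)
  fix g x assume x: "x \<in> S"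
  have K: "act K x \<in> S" using submodule_act[OF assms x, of K] by simp
  have H: "act (H n) x \<in> S" for n
    using submodule_diff[OF assms submodule_act[OF assms x, of "H n"]
      submodule_scale[OF assms K, of "if n = 0 then of_int r else 0"]] by (cases "n = 0") simp_all
  have D: "act D x \<in> S"
    using submodule_diff[OF assms submodule_diff[OF assms submodule_act[OF assms x, of D]
      submodule_scale[OF assms K, of \<delta>]] submodule_scale[OF assms H[of 0], of "of_int r / 2"]] by simp
  show "act g x \<in> S"
    using K H D submodule_act[OF assms x, of "E (n - r)" for n]
      submodule_act[OF assms x, of "F (n + r)" for n] by (cases g) auto
qed

lemma submodule_chevalley_twist:
  assumes "submodule (chevalley_twist act) S"
  shows "submodule act S"
  unfolding submodule_def
proof (intro conjI allI ballI)
  show sub: "cvs.subspace S" using assms by (simp add: submodule_def)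
  fix g x assume x: "x \<in> S"
  note * = submodule_act[OF assms x]
  show "act g x \<in> S"
    using *[of "E n" for n] *[of "F n" for n] *[of "H n" for n] *[of K] *[of D] cvs.subspace_neg[OF sub]
    by (cases g) (auto, metis minus_minus)
qed

lemma irreducible_shift_twist:
  "irreducible_module act \<Longrightarrow> irreducible_module (shift_twist act r \<delta>)"
  unfolding irreducible_module_def using submodule_shift_twist by blast

context affine_sl2_module
begin

lemma shift_twist_module: "affine_sl2_module (shift_twist act r \<delta>)"
proof (rule affine_sl2_module.intro)
  fix g m n x
  let ?t = "shift_twist act r \<delta>"
  show "clinear (?t g)"
    by (rule clinearI; cases g)
      (simp_all add: act_add act_scale cvs.scale_right_distrib mult.commute)
  show "?t (E m) (?t (E n) x)
      - ?t (E n) (?t (E m) x) = 0"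
    by (simp add: EE)
  show "?t (F m) (?t (F n) x)
      - ?t (F n) (?t (F m) x) = 0"
    by (simp add: FF)
  show "?t (E m) (?t (F n) x)
      - ?t (F n) (?t (E m) x) =
    ?t (H (m + n)) x + (if m + n = 0 then of_int m *\<^sub>C ?t K x else 0)"
    by (simp add: swap_EF cvs.scale_left_distrib)
  show "?t (H m) (?t (E n) x)
      - ?t (E n) (?t (H m) x) =
    2 *\<^sub>C ?t (E (m + n)) x"
    by (simp add: swap_HE act_add act_scale swap_KX act_zero add.assoc)
  show "?t (H m) (?t (F n) x)
      - ?t (F n) (?t (H m) x) =
    (- 2) *\<^sub>C ?t (F (m + n)) x"
    by (simp add: swap_HF act_add act_scale swap_KX act_zero add_diff_eq)
  show "?t (H m) (?t (H n) x)
      - ?t (H n) (?t (H m) x) =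
    (if m + n = 0 then (2 * of_int m) *\<^sub>C ?t K x else 0)"
    using HH[of m n x] by (auto simp: act_add act_scale swap_KX act_zero algebra_simps)
  show "?t K (?t g x) - ?t g (?t K x) = 0"
    by (cases g) (simp_all add: act_add act_scale swap_KX act_zero)
  have r: "(of_int r / 2) *\<^sub>C (2 *\<^sub>C y) = of_int r *\<^sub>C y" for y :: 'v
    by (simp add: scaleC_scaleC)
  show "?t D (?t (E n) x) - ?t (E n) (?t D x) =
    (- of_int n) *\<^sub>C ?t (E n) x"
    by (simp add: swap_DE swap_HE swap_KX act_add act_scale cvs.scale_right_distrib r
        cvs.scale_left_distrib del: cvs.scale_scale, (simp add: algebra_simps)?)
  show "?t D (?t (H n) x) - ?t (H n) (?t D x) =
    (- of_int n) *\<^sub>C ?t (H n) x"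
    by (simp add: swap_DH swap_H0H swap_KX act_add act_scale act_zero algebra_simps)
  show "?t D (?t (F n) x) - ?t (F n) (?t D x) =
    (- of_int n) *\<^sub>C ?t (F n) x"
    by (simp add: swap_DF swap_HF swap_KX act_add act_scale cvs.scale_right_diff_distrib r
        cvs.scale_left_diff_distrib del: cvs.scale_scale, (simp add: algebra_simps)?)
qed

lemma chevalley_twist_module: "affine_sl2_module (chevalley_twist act)"
proof (rule affine_sl2_module.intro)
  fix g m n x
  let ?t = "chevalley_twist act"
  show "clinear (?t g)"
    by (rule clinearI; cases g) (simp_all add: act_add act_scale)
  show "?t (E m) (?t (E n) x) - ?t (E n) (?t (E m) x) = 0" by (simp add: FF)
  show "?t (F m) (?t (F n) x) - ?t (F n) (?t (F m) x) = 0" by (simp add: EE)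
  show "?t (E m) (?t (F n) x) - ?t (F n) (?t (E m) x) =
    ?t (H (m + n)) x + (if m + n = 0 then of_int m *\<^sub>C ?t K x else 0)"
  proof (cases "m + n = 0")
    case True
    then have m: "m = - n" by simp
    show ?thesis using swap_EF[of n m x] unfolding m by (simp add: algebra_simps)
  next
    case False
    then show ?thesis using swap_EF[of n m x] by (simp add: add.commute)
  qed
  show "?t (H m) (?t (E n) x) - ?t (E n) (?t (H m) x) = 2 *\<^sub>C ?t (E (m + n)) x"
    by (simp add: swap_HF act_neg)
  show "?t (H m) (?t (F n) x) - ?t (F n) (?t (H m) x) = (- 2) *\<^sub>C ?t (F (m + n)) x"
    by (simp add: swap_HE act_neg)
  show "?t (H m) (?t (H n) x) - ?t (H n) (?t (H m) x) = (if m + n = 0 then (2 * of_int m) *\<^sub>C ?t K x else 0)"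
    using HH[of m n x] by (simp add: act_neg)
  show "?t K (?t g x) - ?t g (?t K x) = 0"
    by (cases g) (simp_all add: act_neg swap_KX)
  show "?t D (?t (E n) x) - ?t (E n) (?t D x) = (- of_int n) *\<^sub>C ?t (E n) x" by (simp add: swap_DF)
  show "?t D (?t (H n) x) - ?t (H n) (?t D x) = (- of_int n) *\<^sub>C ?t (H n) x"
    by (simp add: swap_DH act_neg)
  show "?t D (?t (F n) x) - ?t (F n) (?t D x) = (- of_int n) *\<^sub>C ?t (F n) x" by (simp add: swap_DE)
qed

text \<open>Since \<open>ad f\<^sub>m\<close> is nilpotent, a single vector on which \<open>f\<^sub>m\<close> is nilpotent makes it locally nilpotent on the
  submodule generated by that vector. This extends integrability from the Chevalley generators to all
  real root vectors.\<close>

lemma F_nilpotent_submodule: "submodule act {x. \<exists>N. (act (F m) ^^ N) x = 0}" (is "submodule act ?N")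
proof -
  have add: "x + y \<in> ?N" if "x \<in> ?N" "y \<in> ?N" for x y
  proof -
    obtain N M where "(act (F m) ^^ N) x = 0" "(act (F m) ^^ M) y = 0" using \<open>x \<in> ?N\<close> \<open>y \<in> ?N\<close> by blast
    then have "(act (F m) ^^ max N M) (x + y) = 0"
      using funpow_zero_mono[where f = "act (F m)", OF act_zero]
      by (simp add: cvs_pair.linear_add[OF linear_pow])
    then show ?thesis by blast
  qed
  have scale: "c *\<^sub>C x \<in> ?N" if "x \<in> ?N" for c x
    using that by (auto simp: cvs_pair.linear_scale[OF linear_pow])
  have diff: "x - y \<in> ?N" if "x \<in> ?N" "y \<in> ?N" for x y
    using add[OF that(1) scale[OF that(2), of "-1"]] by (simp add: scaleC_one)
  have up: "x \<in> ?N" if "act (F m) x \<in> ?N" for x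
  proof -
    obtain N where "(act (F m) ^^ N) (act (F m) x) = 0" using \<open>act (F m) x \<in> ?N\<close> by blast
    then have "(act (F m) ^^ Suc N) x = 0" by (simp only: funpow_Suc_right o_apply)
    then show ?thesis by blast
  qed
  have comm: "act g x \<in> ?N" if "\<And>x. act (F m) (act g x) = act g (act (F m) x)" "x \<in> ?N" for g x
  proof -
    have "(act (F m) ^^ N) (act g x) = act g ((act (F m) ^^ N) x)" for N
      by (induction N) (simp_all add: that(1))
    moreover obtain N where "(act (F m) ^^ N) x = 0" using \<open>x \<in> ?N\<close> by blast
    ultimately have "(act (F m) ^^ N) (act g x) = 0" by (simp add: act_zero)
    then show ?thesis by blast
  qed
  have F: "act (F n) x \<in> ?N" if "x \<in> ?N" for n x
    using that by (intro comm swap_FF)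
  have K: "act K x \<in> ?N" if "x \<in> ?N" for x
    using that by (intro comm swap_K[symmetric])
  have H: "act (H n) x \<in> ?N" if "(act (F m) ^^ N) x = 0" for n N x
    using that
  proof (induction N arbitrary: x)
    case 0
    then show ?case by (auto simp: act_zero intro: exI[of _ 0])
  next
    case (Suc N)
    have "act (F m) x \<in> ?N" using Suc.prems by (auto intro: exI[of _ N] simp: funpow_Suc_right simp del: funpow.simps)
    moreover have "act (H n) (act (F m) x) \<in> ?N"
      using Suc by (simp add: funpow_Suc_right del: funpow.simps)
    moreover have "x \<in> ?N" using Suc.prems by blast
    ultimately have "act (H n) (act (F m) x) + 2 *\<^sub>C act (F (n + m)) x \<in> ?N"
      by (intro add scale F)
    also have "act (H n) (act (F m) x) + 2 *\<^sub>C act (F (n + m)) x = act (F m) (act (H n) x)"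
      by (simp add: swap_HF)
    finally show ?case by (rule up)
  qed
  have D: "act D x \<in> ?N" if "(act (F m) ^^ N) x = 0" for N x
    using that
  proof (induction N arbitrary: x)
    case 0
    then show ?case by (auto simp: act_zero intro: exI[of _ 0])
  next
    case (Suc N)
    have "act D (act (F m) x) \<in> ?N"
      using Suc by (simp add: funpow_Suc_right del: funpow.simps)
    moreover have "x \<in> ?N" using Suc.prems by blast
    ultimately have "act D (act (F m) x) + of_int m *\<^sub>C act (F m) x \<in> ?N"
      by (intro add scale F)
    also have "act D (act (F m) x) + of_int m *\<^sub>C act (F m) x = act (F m) (act D x)"
      by (simp add: swap_DF)
    finally show ?case by (rule up)
  qed
  have E: "act (E n) x \<in> ?N" if "(act (F m) ^^ N) x = 0" for n N x
    using that
  proof (induction N arbitrary: x)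
    case 0
    then show ?case by (auto simp: act_zero intro: exI[of _ 0])
  next
    case (Suc N)
    have 1: "act (E n) (act (F m) x) \<in> ?N"
      using Suc by (simp add: funpow_Suc_right del: funpow.simps)
    have x: "x \<in> ?N" using Suc.prems by blast
    have "act (E n) (act (F m) x) - act (H (n + m)) x - (if n + m = 0 then of_int n else 0) *\<^sub>C act K x \<in> ?N"
      by (intro diff 1 scale K x H[OF Suc.prems])
    also have "act (E n) (act (F m) x) - act (H (n + m)) x - (if n + m = 0 then of_int n else 0) *\<^sub>C act K x
        = act (F m) (act (E n) x)"
      by (simp add: swap_EF)
    finally show ?case by (rule up)
  qed
  have "act g x \<in> ?N" if "x \<in> ?N" for g x
    using that E F H D K by (cases g) blast+
  moreover have "0 \<in> ?N" by (auto intro: exI[of _ 0])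
  ultimately show ?thesis
    using add scale unfolding submodule_def cvs.subspace_def by blast
qed

text \<open>The top power of \<open>f\<^sub>0\<close> plays the role of the simple reflection. Its image satisfies the relations at \<open>- p\<close>
  by the representation theory of \<open>\<ss>\<ll>\<^sub>2\<close>, applied to \<open>x\<close>, to \<open>f\<^sub>m x\<close> and to \<open>e\<^sub>m x\<close>.\<close>

lemma reflect_F0:
  assumes x: "extremal_at act p x" and p: "p \<le> 0" and nil: "\<And>y. \<exists>N. (act (F 0) ^^ N) y = 0"
  shows "extremal_at act (- p) ((act (F 0) ^^ nat (- p)) x)" "(act (F 0) ^^ Suc (nat (- p))) x = 0"
proof -
  define n where "n = nat (- p)"
  have p: "p = - int n" using p by (simp add: n_def)
  note x = x[unfolded extremal_at_def p]
  have x0: "x \<noteq> 0" and Kx: "act K x = x" and Hx: "act (H 0) x = of_nat n *\<^sub>C x"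
    and Ex: "- int n \<le> m \<Longrightarrow> act (E m) x = 0" and Fx: "int n \<le> m \<Longrightarrow> act (F m) x = 0"
    and HHx: "0 < m \<Longrightarrow> act (H m) x = 0" for m using x by auto
  obtain d where d: "act D x = d *\<^sub>C x" using x by blast
  have hf: "act (H 0) (act (F 0) y) = act (F 0) (act (H 0) y) - 2 *\<^sub>C act (F 0) y" for y
    using swap_HF[of 0 0 y] by simp
  have sl2: "\<exists>s. \<mu> = of_nat s \<and> (act (F 0) ^^ s) y \<noteq> 0 \<and> (act (F 0) ^^ Suc s) y = 0"
    if "act (E 0) y = 0" "act (H 0) y = \<mu> *\<^sub>C y" "y \<noteq> 0" for y \<mu>
  proof -
    obtain N where "(act (F 0) ^^ N) y = 0" using nil by blast
    then show ?thesis
      using sl2_primitive_vector[OF linear[of "E 0"] linear[of "F 0"] swap_EF0 hf that] by blast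
  qed
  have nz: "(act (F 0) ^^ n) x \<noteq> 0" and z: "(act (F 0) ^^ Suc n) x = 0"
    using sl2[OF Ex[of 0] Hx x0] by auto
  have z': "(act (F 0) ^^ k) x = 0" if "k > n" for k
    using funpow_zero_mono[where f = "act (F 0)", OF act_zero z] that by simp
  have K: "act K ((act (F 0) ^^ k) x) = (act (F 0) ^^ k) x" for k
    by (induction k) (simp_all add: Kx swap_KX)
  have D: "act D ((act (F 0) ^^ k) x) = d *\<^sub>C (act (F 0) ^^ k) x" for k
    using swap_DF[of 0] by (induction k) (simp_all add: d act_scale)
  have H0: "act (H 0) ((act (F 0) ^^ k) x) = (of_nat n - 2 * of_nat k) *\<^sub>C (act (F 0) ^^ k) x" for k
  proof (induction k)
    case 0
    then show ?case by (simp add: Hx)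
  next
    case (Suc k)
    have "of_nat n - 2 * of_nat (Suc k) = (of_nat n - 2 * of_nat k) - (2 :: complex)" by simp
    then show ?case by (simp only: funpow.simps o_apply hf Suc act_scale act_diff cvs.scale_left_diff_distrib)
  qed
  have killed: "act (E m) ((act (F 0) ^^ k) x) = 0 \<and> act (H m) ((act (F 0) ^^ k) x) = 0
      \<and> act (F m) ((act (F 0) ^^ k) x) = 0" if "int n \<le> m" "0 < m" for k m
    using that by (induction k) (simp_all add: Ex Fx HHx swap_EF0 swap_HF swap_FF[of m 0] act_zero)
  have E: "act (E m) ((act (F 0) ^^ n) x) = 0" if "int n \<le> m" for m
    using killed[OF that, of n] Ex[of m] that by (cases "m = 0") auto
  have F_pow: "act (F m) ((act (F 0) ^^ k) y) = (act (F 0) ^^ k) (act (F m) y)" for m k y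
    by (induction k) (simp_all add: swap_FF[of m 0])
  \<comment> \<open>\<open>h\<^sub>m f\<^sub>0\<^sup>n x\<close> is a multiple of \<open>f\<^sub>0\<^sup>n\<^sup>-\<^sup>1 f\<^sub>m x\<close>, where \<open>f\<^sub>m x\<close> is primitive of weight \<open>n - 2\<close>.\<close>
  have H: "act (H m) ((act (F 0) ^^ n) x) = 0" if "0 < m" for m
  proof -
    have H_pow: "act (H m) ((act (F 0) ^^ Suc k) x) = - ((2 * of_nat (Suc k)) *\<^sub>C (act (F 0) ^^ k) (act (F m) x))" for k
    proof (induction k)
      case 0
      then show ?case using swap_HF[of m 0 x] HHx[OF that] by (simp add: act_zero)
    next
      case (Suc k)
      have c: "(2 * of_nat (Suc (Suc k)) :: complex) = 2 * of_nat (Suc k) + 2" by simp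
      have "act (H m) ((act (F 0) ^^ Suc (Suc k)) x)
        = act (F 0) (act (H m) ((act (F 0) ^^ Suc k) x)) - 2 *\<^sub>C act (F m) ((act (F 0) ^^ Suc k) x)"
        using swap_HF[of m 0] by simp
      also have "\<dots> = - ((2 * of_nat (Suc k) + 2) *\<^sub>C (act (F 0) ^^ Suc k) (act (F m) x))"
        unfolding Suc F_pow[of m] act_neg act_scale cvs.scale_left_distrib
        by (simp only: funpow.simps o_apply minus_add_distrib diff_conv_add_uminus)
      finally show ?case unfolding c .
    qed
    show ?thesis
    proof (cases "int n \<le> m \<or> act (F m) x = 0")
      case True
      then have "act (F m) x = 0" using Fx by blast
      then show ?thesis
        using H_pow[of "n - 1"] HHx[OF that] by (cases n) (simp_all add: cvs_pair.linear_0[OF linear_pow])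
    next
      case False
      then have n: "n \<ge> 2" using that by simp
      have "act (E 0) (act (F m) x) = 0"
        by (simp add: swap_E0F Ex HHx[OF that] act_zero)
      moreover have "act (H 0) (act (F m) x) = (of_nat n - 2) *\<^sub>C act (F m) x"
        by (simp add: swap_HF Hx act_scale cvs.scale_left_diff_distrib)
      ultimately obtain s where "of_nat n - 2 = (of_nat s :: complex)" "(act (F 0) ^^ Suc s) (act (F m) x) = 0"
        using sl2 False by blast
      moreover from this(1) have "of_nat n = (of_nat (s + 2) :: complex)" by (simp add: algebra_simps)
      then have "n = Suc (Suc s)" by (simp only: of_nat_eq_iff)
      ultimately show ?thesis using H_pow[of "Suc s"] by simp
    qed
  qed
  \<comment> \<open>Expand \<open>f\<^sub>0\<^sup>n\<^sup>+\<^sup>2 e\<^sub>m x = 0\<close>; since \<open>f\<^sub>0\<^sup>n\<^sup>+\<^sup>1 x = 0\<close>, only a multiple of \<open>f\<^sub>m f\<^sub>0\<^sup>n x\<close> is left.\<close>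
  have F: "act (F m) ((act (F 0) ^^ n) x) = 0" if "- int n \<le> m" for m
  proof -
    have FE: "act (F 0) (act (E m) y) = act (E m) (act (F 0) y) - act (H m) y"
      and FH: "act (F 0) (act (H m) y) = act (H m) (act (F 0) y) + 2 *\<^sub>C act (F m) y" for y
      using swap_EF0[of m y] swap_HF[of m 0 y] by simp_all
    have "(act (F 0) ^^ Suc (Suc k)) (act (E m) x) = act (E m) ((act (F 0) ^^ Suc (Suc k)) x)
      - of_nat (Suc (Suc k)) *\<^sub>C act (H m) ((act (F 0) ^^ Suc k) x)
      - (of_nat (Suc (Suc k)) * of_nat (Suc k)) *\<^sub>C act (F m) ((act (F 0) ^^ k) x)" for k
    proof (induction k)
      case 0
      then show ?case by (simp add: FE FH act_diff scale_2)
    next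
      case (Suc k)
      have c: "of_nat (Suc (Suc (Suc k))) = of_nat (Suc (Suc k)) + (1::complex)"
        "of_nat (Suc (Suc (Suc k))) * of_nat (Suc (Suc k))
          = of_nat (Suc (Suc k)) * of_nat (Suc k) + of_nat (Suc (Suc k)) * (2::complex)"
        by (simp_all add: algebra_simps)
      have "(act (F 0) ^^ Suc (Suc (Suc k))) (act (E m) x)
        = act (F 0) (act (E m) ((act (F 0) ^^ Suc (Suc k)) x)
      - of_nat (Suc (Suc k)) *\<^sub>C act (H m) ((act (F 0) ^^ Suc k) x)
      - (of_nat (Suc (Suc k)) * of_nat (Suc k)) *\<^sub>C act (F m) ((act (F 0) ^^ k) x))"
        using Suc by (simp only: funpow.simps o_apply)
      also have "\<dots> = act (E m) ((act (F 0) ^^ Suc (Suc (Suc k))) x) - act (H m) ((act (F 0) ^^ Suc (Suc k)) x)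
        - (of_nat (Suc (Suc k)) *\<^sub>C act (H m) ((act (F 0) ^^ Suc (Suc k)) x)
          + of_nat (Suc (Suc k)) *\<^sub>C (2 *\<^sub>C act (F m) ((act (F 0) ^^ Suc k) x)))
        - (of_nat (Suc (Suc k)) * of_nat (Suc k)) *\<^sub>C act (F m) ((act (F 0) ^^ Suc k) x)"
        by (simp only: act_diff act_scale FE FH funpow.simps o_apply swap_FF[of 0 m] cvs.scale_right_distrib)
      finally show ?case
        unfolding c(2) unfolding c(1) cvs.scale_left_distrib scaleC_one cvs.scale_scale by (simp only: algebra_simps)
    qed
    from this[of n] have "(of_nat (Suc (Suc n)) * of_nat (Suc n)) *\<^sub>C act (F m) ((act (F 0) ^^ n) x) = 0"
      using z' Ex[OF that] by (simp add: act_zero cvs_pair.linear_0[OF linear_pow] del: funpow.simps of_nat_Suc)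
    then show ?thesis by (simp add: cvs.scale_eq_0_iff del: of_nat_Suc)
  qed
  have "extremal_at act (int n) ((act (F 0) ^^ n) x)"
    using nz K D E F H H0[of n] unfolding extremal_at_def by auto
  then show "extremal_at act (- p) ((act (F 0) ^^ nat (- p)) x)" "(act (F 0) ^^ Suc (nat (- p))) x = 0"
    using z by (simp_all add: p)
qed

lemma reflect_F:
  assumes x: "extremal_at act p x" and p: "p \<le> m" and nil: "\<And>y. \<exists>N. (act (F (- m)) ^^ N) y = 0"
  shows "extremal_at act (2 * m - p) ((act (F (- m)) ^^ nat (m - p)) x)" (is ?A)
    "(act (F (- m)) ^^ Suc (nat (m - p))) x = 0" (is ?B)
proof -
  interpret T: affine_sl2_module "shift_twist act m 0" by (rule shift_twist_module)
  have F: "shift_twist act m 0 (F 0) = act (F (- m))" by (rule ext) simp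
  note r = T.reflect_F0[OF extremal_at_shift[OF x] _ nil[folded F], unfolded F]
  show ?A using extremal_at_unshift[OF r(1)] p by simp
  show ?B using r(2) p by simp
qed

lemma reflect_E:
  assumes x: "extremal_at act p x" and p: "m \<le> p" and nil: "\<And>y. \<exists>N. (act (E m) ^^ N) y = 0"
  shows "extremal_at act (2 * m - p) ((act (E m) ^^ nat (p - m)) x)" (is ?A)
    "(act (E m) ^^ Suc (nat (p - m))) x = 0" (is ?B)
proof -
  interpret T: affine_sl2_module "chevalley_twist act" by (rule chevalley_twist_module)
  have F: "chevalley_twist act (F (- (- m))) = act (E m)" by (rule ext) simp
  note r = T.reflect_F[of "- p" x "- m", unfolded extremal_at_chevalley F, OF x _ nil]
  have "2 * - m - - p = - (2 * m - p)" by simp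
  then show ?A using r(1) p extremal_at_chevalley[of act "2 * m - p"] by simp
  show ?B using r(2) p by simp
qed

end

section \<open>Uniqueness of extremal vectors\<close>

text \<open>In a suitable twist every extremal vector becomes a vacuum vector.\<close>

lemma highest_weight_vector_shift:
  assumes "affine_sl2_module act" "extremal_at act p x"
  shows "\<exists>\<delta>. highest_weight_vector (shift_twist act p \<delta>) 0 1 x"
proof -
  obtain d where d: "act D x = d *\<^sub>C x" using assms by (auto simp: extremal_at_def)
  have "shift_twist act p (of_int p * of_int p / 2 - d) D x = 0"
    using assms(2) unfolding extremal_at_def
    by (simp add: d cvs.scale_left_diff_distrib)
  then have "highest_weight_vector (shift_twist act p (of_int p * of_int p / 2 - d)) 0 1 x"
    using assms(2) unfolding highest_weight_vector_def extremal_at_def by (auto simp: scaleC_one)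
  then show ?thesis by blast
qed

text \<open>Twist so that \<open>x\<close> becomes a highest weight vector. Then the \<open>D\<close>-eigenvalue of \<open>y\<close> exceeds that of \<open>x\<close> by a
  natural number; by symmetry both agree, and \<open>y\<close> lies in the highest weight space.\<close>

lemma extremal_at_unique:
  assumes A: "affine_sl2_module A" and irr: "irreducible_module A"
    and x: "extremal_at A p x" and y: "extremal_at A p y"
  shows "\<exists>c. y = c *\<^sub>C x"
proof -
  interpret A: affine_sl2_module A by (rule A)
  have key: "\<exists>\<delta> b. highest_weight_vector (shift_twist A p \<delta>) 0 1 x \<and> shift_twist A p \<delta> D y = of_nat b *\<^sub>C y
      \<and> cyclic_submodule (shift_twist A p \<delta>) x = UNIV \<and> of_nat b = dy - (dx :: complex)"
    if x: "extremal_at A p x" "A D x = dx *\<^sub>C x" and y: "extremal_at A p y" "A D y = dy *\<^sub>C y"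
    for x y dx dy
  proof -
    obtain \<delta> where \<delta>: "highest_weight_vector (shift_twist A p \<delta>) 0 1 x"
      using highest_weight_vector_shift[OF A x(1)] by blast
    interpret T: highest_weight_module "shift_twist A p \<delta>" 0 1 x
      using A.shift_twist_module \<delta>
      by (simp add: highest_weight_module_def highest_weight_module_axioms_def)
    have D: "shift_twist A p \<delta> D u = (du - of_int p * of_int p / 2 + \<delta>) *\<^sub>C u"
      if "extremal_at A p u" "A D u = du *\<^sub>C u" for u du
      using that unfolding extremal_at_def
      by (simp add: cvs.scale_left_distrib cvs.scale_left_diff_distrib)
    have "(dx - of_int p * of_int p / 2 + \<delta>) *\<^sub>C x = 0"
      using D[OF x] T.D_z by simp
    then have dx: "dx - of_int p * of_int p / 2 + \<delta> = 0"
      using x(1) by (simp add: cvs.scale_eq_0_iff extremal_at_def)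
    have cyc: "T.L = UNIV"
      by (rule T.irreducible_cyclic[OF irreducible_shift_twist[OF irr] T.z_nonzero])
    obtain b where b: "dy - of_int p * of_int p / 2 + \<delta> = of_nat b"
      using T.D_eigenvalue_nat[OF _ _ D[OF y]] cyc y(1) by (auto simp: extremal_at_def)
    have "of_nat b = (dy - of_int p * of_int p / 2 + \<delta>) - (dx - of_int p * of_int p / 2 + \<delta>)"
      unfolding b dx by simp
    then have "of_nat b = dy - dx" by simp
    moreover have "shift_twist A p \<delta> D y = of_nat b *\<^sub>C y" using D[OF y] unfolding b .
    ultimately show ?thesis using \<delta> cyc by blast
  qed
  obtain dx dy where dx: "A D x = dx *\<^sub>C x" and dy: "A D y = dy *\<^sub>C y"
    using x y by (auto simp: extremal_at_def)
  obtain \<delta> b where \<delta>: "highest_weight_vector (shift_twist A p \<delta>) 0 1 x"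
    "shift_twist A p \<delta> D y = of_nat b *\<^sub>C y" "cyclic_submodule (shift_twist A p \<delta>) x = UNIV"
    and b: "of_nat b = dy - dx"
    using key[OF x dx y dy] by blast
  obtain b' :: nat where b': "of_nat b' = dx - dy"
    using key[OF y dy x dx] by blast
  have "of_nat (b + b') = (0 :: complex)" using b b' by simp
  then have "b = 0" by (simp only: of_nat_eq_0_iff)
  interpret T: highest_weight_module "shift_twist A p \<delta>" 0 1 x
    using A.shift_twist_module \<delta>(1)
    by (simp add: highest_weight_module_def highest_weight_module_axioms_def)
  have "T.weight 0 0 y"
    using \<delta>(2) \<open>b = 0\<close> y unfolding T.weight_def extremal_at_def
    by (simp del: shift_twist.simps(5)) 
  then show ?thesis using T.highest_weight_space \<delta>(3) by blast
qed

lemma highest_weight_vector_unique: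
  assumes A: "affine_sl2_module A" and irr: "irreducible_module A"
    and x: "highest_weight_vector A l k x" and y: "highest_weight_vector A l' k' y"
  shows "l' = l \<and> k' = k \<and> (\<exists>c. y = c *\<^sub>C x)"
proof -
  interpret X: highest_weight_module A l k x
    using A x by (simp add: highest_weight_module_def highest_weight_module_axioms_def)
  interpret Y: highest_weight_module A l' k' y
    using A y by (simp add: highest_weight_module_def highest_weight_module_axioms_def)
  have L: "X.L = UNIV" "Y.L = UNIV"
    using X.irreducible_cyclic[OF irr] X.z_nonzero Y.z_nonzero by auto
  obtain a b where a: "l' = l - 2 * of_nat a + 2 * of_nat b" "(0 :: complex) = of_nat b"
    by (rule X.weights_in_L[of y l' 0]) (use L Y.z_nonzero Y.H0_z Y.D_z in auto)
  obtain a' b' where a': "l = l' - 2 * of_nat a' + 2 * of_nat b'" "(0 :: complex) = of_nat b'"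
    by (rule Y.weights_in_L[of x l 0]) (use L X.z_nonzero X.H0_z X.D_z in auto)
  have "2 * of_nat (a + a') = (0 :: complex)" using a a' by (simp add: algebra_simps)
  then have "of_nat (a + a') = (0 :: complex)" by (simp del: of_nat_add)
  then have "a = 0" by (simp only: of_nat_eq_0_iff)
  then have l: "l' = l" using a by simp
  have "k' *\<^sub>C y = k *\<^sub>C y" using X.K_L[of y] L Y.K_z by simp
  then have "k' = k" using Y.z_nonzero cvs.scale_right_imp_eq by blast
  moreover have "X.weight 0 0 y" using l Y.H0_z Y.D_z by (simp add: X.weight_def)
  ultimately show ?thesis using l X.highest_weight_space L by blast
qed

text \<open>Irreducibility makes \<open>z\<close> a generator, and lowering operators only raise the \<open>D\<close>-eigenvalue.\<close>

lemma singular_vector_minimizes_D: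
  assumes A: "affine_sl2_module A" and irr: "irreducible_module A"
    and z: "z \<noteq> 0" "A (E 0) z = 0" "A (F 1) z = 0" "A K z = z" "A (H 0) z = l *\<^sub>C z" "A D z = d *\<^sub>C z"
    and y: "y \<noteq> 0" "A D y = d' *\<^sub>C y"
  shows "\<exists>n. d' = d + of_nat n"
proof -
  interpret A: affine_sl2_module A by (rule A)
  let ?T = "shift_twist A 0 (- d)"
  have "highest_weight_vector ?T l 1 z"
    using z A.singular_raising[OF z(2,3)] by (simp add: highest_weight_vector_def scaleC_one)
  then interpret T: highest_weight_module ?T l 1 z
    using A.shift_twist_module by (simp add: highest_weight_module_def highest_weight_module_axioms_def)
  have L: "T.L = UNIV"
    by (rule T.irreducible_cyclic[OF irreducible_shift_twist[OF irr] z(1)])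
  have "A K y = y" using T.K_L[of y] L by (simp add: scaleC_one)
  then have "?T D y = (d' - d) *\<^sub>C y" by (simp add: y(2) cvs.scale_left_diff_distrib)
  then obtain n where "d' - d = of_nat n" using T.D_eigenvalue_nat[of y] L y(1) by blast
  then show ?thesis by (auto intro!: exI[of _ n] simp: algebra_simps)
qed

section \<open>The vertex operator recursion\<close>

lemma sum_shift_up:
  "(\<Sum>a = 1..<Suc n. f a) = (\<Sum>a = 0..<n. f (Suc a))" for f :: "nat \<Rightarrow> 'a::comm_monoid_add"
  by (metis One_nat_def sum.shift_bounds_Suc_ivl)

context
  fixes A :: "affine_sl2 \<Rightarrow> 'v::complex_vector \<Rightarrow> 'v" and x :: 'v
  assumes A: "affine_sl2_module A" and irr: "irreducible_module A" and x: "extremal_at A 0 x"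
begin

interpretation A: affine_sl2_module A by (rule A)

text \<open>A coefficient of the field \<open>e(z)\<^sup>2\<close>, applied to the vacuum. It vanishes at level one.\<close>

definition quadratic :: "nat \<Rightarrow> 'v"
  where "quadratic d = (\<Sum>a = 1..<d. A (E (- int a)) (A (E (int a - int d)) x))"

lemma vacuum: "A K x = x" "A (H 0) x = 0" "0 \<le> m \<Longrightarrow> A (E m) x = 0" "0 \<le> m \<Longrightarrow> A (F m) x = 0"
  "0 < m \<Longrightarrow> A (H m) x = 0" "x \<noteq> 0"
  using x by (auto simp: extremal_at_def)

lemma F0_quadratic:
  "A (F 0) (quadratic d) = - (\<Sum>a = 1..<d. A (E (- int a)) (A (H (int a - int d)) x)
      + A (H (- int a)) (A (E (int a - int d)) x))"
proof -
  have FE: "A (F 0) (A (E m) y) = A (E m) (A (F 0) y) - A (H m) y" for m y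
    using A.swap_EF0[of m y] by simp
  show ?thesis
    unfolding quadratic_def A.act_sum sum_negf[symmetric]
    by (intro sum.cong refl) (simp add: FE vacuum A.act_zero A.act_neg)
qed

text \<open>The central terms coming from \<open>K = 1\<close> cancel the terms produced by commuting \<open>h\<^sub>0\<close>; here the level
  has to be one.\<close>

lemma F1_quadratic:
  assumes "d > 0"
  shows "A (F 1) (quadratic (Suc d)) = A (F 0) (quadratic d)"
proof -
  let ?E = "A (E (- int d)) x"
  have FE: "A (F 1) (A (E (- int a)) y) = A (E (- int a)) (A (F 1) y) - A (H (1 - int a)) y
      + (if a = 1 then A K y else 0)" for a y
    using A.swap_EF[of "- int a" 1 y] by (cases "a = 1") (simp_all add: scaleC_one)
  have FEx: "A (F 1) (A (E (int a - int (Suc d))) x) = - A (H (int a - int d)) x + (if a = d then x else 0)" for a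
    using A.swap_EF[of "int a - int (Suc d)" 1 x] 
    by (cases "a = d") (simp_all add: scaleC_one vacuum A.act_zero eq_neg_iff_add_eq_0 add.commute)
  have K: "A K (A (E m) x) = A (E m) x" for m by (simp add: A.swap_KX vacuum)
  have "A (F 1) (quadratic (Suc d)) =
    (\<Sum>a = 1..<Suc d. - A (E (- int a)) (A (H (int a - int d)) x) + (if a = d then ?E else 0)
      - A (H (1 - int a)) (A (E (int a - int (Suc d))) x) + (if a = 1 then ?E else 0))"
    unfolding quadratic_def A.act_sum FE FEx K
    by (intro sum.cong refl) (auto simp: A.act_add A.act_neg A.act_diff A.act_zero)
  also have "\<dots> = - (\<Sum>a = 1..<Suc d. A (E (- int a)) (A (H (int a - int d)) x)) + ?E
      - (\<Sum>a = 1..<Suc d. A (H (1 - int a)) (A (E (int a - int (Suc d))) x)) + ?E"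
    using assms by (simp only: sum.distrib sum_subtractf sum_negf) (simp add: sum.delta)
  also have "(\<Sum>a = 1..<Suc d. A (E (- int a)) (A (H (int a - int d)) x))
      = (\<Sum>a = 1..<d. A (E (- int a)) (A (H (int a - int d)) x))"
    using assms by (simp add: vacuum A.act_zero)
  also have "(\<Sum>a = 1..<Suc d. A (H (1 - int a)) (A (E (int a - int (Suc d))) x))
      = (\<Sum>a = 0..<d. A (H (- int a)) (A (E (int a - int d)) x))"
    by (simp only: sum_shift_up) simp
  also have "\<dots> = A (H 0) ?E + (\<Sum>a = 1..<d. A (H (- int a)) (A (E (int a - int d)) x))"
    using assms by (simp add: sum.atLeast_Suc_lessThan)
  also have "A (H 0) ?E = ?E + ?E"
    by (simp add: A.swap_HE vacuum A.act_zero A.scale_2)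
  finally show ?thesis
    unfolding F0_quadratic by (simp add: sum.distrib)
qed

text \<open>By induction on \<open>d\<close> the vector is singular. Its \<open>D\<close>-eigenvalue is larger than that of the vacuum, which
  is impossible for a nonzero singular vector of an irreducible module.\<close>

lemma quadratic_zero: "quadratic d = 0"
proof (induction d)
  case 0
  then show ?case by (simp add: quadratic_def)
next
  case (Suc d)
  show ?case
  proof (cases "d = 0")
    case True
    then show ?thesis by (simp add: quadratic_def)
  next
    case False
    obtain dx where dx: "A D x = dx *\<^sub>C x" using x by (auto simp: extremal_at_def)
    let ?R = "quadratic (Suc d)"
    have E0: "A (E 0) (A (E m) (A (E n) x)) = 0" for m n
      by (simp add: A.swap_EE[of 0] vacuum A.act_zero)
    have H0: "A (H 0) (A (E m) (A (E n) x)) = 4 *\<^sub>C A (E m) (A (E n) x)" for m n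
      by (simp add: A.swap_HE vacuum A.act_zero A.act_scale A.scale_2 A.scale_4 A.act_add)
    have K: "A K (A (E m) (A (E n) x)) = A (E m) (A (E n) x)" for m n
      by (simp add: A.swap_KX vacuum)
    have D: "A D (A (E m) (A (E n) x)) = (dx - of_int (m + n)) *\<^sub>C A (E m) (A (E n) x)" for m n
      by (simp add: A.swap_DE dx A.act_diff A.act_scale cvs.scale_left_diff_distrib cvs.scale_left_distrib)
    show ?thesis
    proof (rule ccontr)
      assume "?R \<noteq> 0"
      moreover have "A (E 0) ?R = 0" unfolding quadratic_def A.act_sum E0 by simp
      moreover have "A (F 1) ?R = 0" using F1_quadratic[of d] False Suc by (simp add: A.act_zero)
      moreover have "A K ?R = ?R" unfolding quadratic_def A.act_sum K ..
      moreover have "A (H 0) ?R = 4 *\<^sub>C ?R"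
        unfolding quadratic_def A.act_sum H0 cvs.scale_sum_right ..
      moreover have "A D ?R = (dx + of_nat (Suc d)) *\<^sub>C ?R"
        unfolding quadratic_def A.act_sum D cvs.scale_sum_right by (intro sum.cong refl) simp
      ultimately obtain n where "dx = dx + of_nat (Suc d) + of_nat n"
        using singular_vector_minimizes_D[OF A irr _ _ _ _ _ _ vacuum(6) dx] by blast
      then have "of_nat (Suc d + n) = (0 :: complex)" by simp
      then show False by (simp only: of_nat_eq_0_iff)
    qed
  qed
qed

text \<open>Apply \<open>f\<^sub>0\<close> to the vanishing coefficient of \<open>e(z)\<^sup>2\<close> and commute the factors of each summand into the order
  \<open>h e\<close>.\<close>

lemma vacuum_recursion:
  "of_nat n *\<^sub>C A (E (- 1 - int n)) x = (\<Sum>a = 1..n. A (H (- int a)) (A (E (int a - 1 - int n)) x))"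
proof -
  let ?d = "Suc n"
  let ?S = "\<Sum>a = 1..<?d. A (H (- int a)) (A (E (int a - int ?d)) x)"
  have 1: "(\<Sum>a = 1..<?d. A (E (- int a)) (A (H (int a - int ?d)) x)) + ?S = 0"
    using F0_quadratic[of ?d, symmetric] unfolding quadratic_zero A.act_zero neg_equal_0_iff_equal sum.distrib .
  have "A (E (- int a)) (A (H (int a - int ?d)) x)
      = A (H (int a - int ?d)) (A (E (- int a)) x) - 2 *\<^sub>C A (E (- int ?d)) x" for a
    using A.swap_HE[of "int a - int ?d" "- int a" x] by simp
  then have 2: "(\<Sum>a = 1..<?d. A (E (- int a)) (A (H (int a - int ?d)) x))
    = (\<Sum>a = 1..<?d. A (H (int a - int ?d)) (A (E (- int a)) x)) - of_nat n *\<^sub>C (2 *\<^sub>C A (E (- int ?d)) x)"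
    by (simp only: sum_subtractf) (simp add: cvs.sum_constant_scale)
  have 3: "(\<Sum>a = 1..<?d. A (H (int a - int ?d)) (A (E (- int a)) x)) = ?S"
    by (rule sum.reindex_bij_witness[of _ "\<lambda>a. ?d - a" "\<lambda>a. ?d - a"]) (auto simp: of_nat_diff)
  have "u + u = w" if "u - w + u = 0" for u w :: 'v using that by (simp add: algebra_simps)
  then have "?S + ?S = of_nat n *\<^sub>C (2 *\<^sub>C A (E (- int ?d)) x)" using 1[unfolded 2 3] .
  then have "2 *\<^sub>C ?S = 2 *\<^sub>C (of_nat n *\<^sub>C A (E (- int ?d)) x)"
    by (simp only: A.scale_2 cvs.scale_left_commute)
  then have S: "?S = of_nat n *\<^sub>C A (E (- int ?d)) x"
    by (rule cvs.scale_left_imp_eq[rotated]) simp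
  have e: "{1..<?d} = {1..n}" "- int ?d = - 1 - int n" "int a - int ?d = int a - 1 - int n" for a
    by auto
  show ?thesis using S unfolding e by (rule sym)
qed

end

lemma extremal_recursion:
  assumes "affine_sl2_module A" "irreducible_module A" "extremal_at A p x"
  shows "of_nat n *\<^sub>C A (E (p - 1 - int n)) x = (\<Sum>a = 1..n. A (H (- int a)) (A (E (p + int a - 1 - int n)) x))"
proof -
  interpret A: affine_sl2_module A by fact
  have "extremal_at (shift_twist A p 0) 0 x" using extremal_at_shift[OF assms(3), of p 0] by simp
  note r = vacuum_recursion[OF A.shift_twist_module irreducible_shift_twist[OF assms(2)] this, of n]
  show ?thesis using r by (simp add: algebra_simps)
qed

section \<open>Families of extremal vectors\<close>

text \<open>What the generation argument uses about the family \<open>v\<close> on \<open>L\<^sub>0\<^sub>,\<^sub>1 \<oplus> L\<^sub>1\<^sub>,\<^sub>1\<close>: the reflection in the real root of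
  \<open>e \<otimes> t\<^sup>m\<close> exchanges \<open>v(p)\<close> and \<open>v(2m - p)\<close> up to a scalar.\<close>

locale extremal_family_module = affine_sl2_module act
  for act :: "affine_sl2 \<Rightarrow> 'v::complex_vector \<Rightarrow> 'v" +
  fixes v :: "int \<Rightarrow> 'v"
  assumes ext: "extremal_at act p (v p)"
    and nil_F: "\<exists>N. (act (F m) ^^ N) x = 0" and nil_E: "\<exists>N. (act (E m) ^^ N) x = 0"
    and F_pow: "p \<le> m \<Longrightarrow> \<exists>c. c \<noteq> 0 \<and> (act (F (- m)) ^^ nat (m - p)) (v p) = c *\<^sub>C v (2 * m - p)"
    and E_pow: "m \<le> p \<Longrightarrow> \<exists>c. c \<noteq> 0 \<and> (act (E m) ^^ nat (p - m)) (v p) = c *\<^sub>C v (2 * m - p)"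
    and recursion: "of_nat n *\<^sub>C act (E (p - 1 - int n)) (v p)
      = (\<Sum>a = 1..n. act (H (- int a)) (act (E (p + int a - 1 - int n)) (v p)))"
    and D_v: "act D (v 0) = 0" "act D (v (-1)) = 0"

text \<open>The missing relations \<open>f\<^sub>0 x = 0\<close> for \<open>l = 0\<close> and \<open>e\<^sub>-\<^sub>1 x = 0\<close> for \<open>l = 1\<close> follow from nilpotency: \<open>x\<close> has weight
  zero for the respective copy of \<open>\<ss>\<ll>\<^sub>2\<close>.\<close>

lemma (in affine_sl2_module) highest_weight_vector_extremal:
  assumes hw: "highest_weight_vector act l 1 x"
    and nil: "\<And>y. \<exists>N. (act (F 0) ^^ N) y = 0" "\<And>y. \<exists>N. (act (E (-1)) ^^ N) y = 0"
  shows "l = 0 \<Longrightarrow> extremal_at act 0 x" "l = 1 \<Longrightarrow> extremal_at act (-1) x"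
proof -
  interpret T: affine_sl2_module "node_twist act" by (rule node_twist_module)
  have x: "x \<noteq> 0" "act (E 0) x = 0" "act (H 0) x = l *\<^sub>C x" "act K x = x" "act D x = 0"
    and pos: "0 < n \<Longrightarrow> act (E n) x = 0 \<and> act (H n) x = 0 \<and> act (F n) x = 0" for n
    using hw by (simp_all add: highest_weight_vector_def scaleC_one)
  have D: "\<exists>d. act D x = d *\<^sub>C x" using x by (intro exI[of _ 0]) simp
  show "extremal_at act 0 x" if "l = 0"
  proof -
    obtain N where N: "(act (F 0) ^^ N) x = 0" using nil by blast
    have "\<exists>s. l = of_nat s \<and> (act (F 0) ^^ s) x \<noteq> 0 \<and> (act (F 0) ^^ Suc s) x = 0"
      by (rule sl2_primitive_vector[OF linear[of "E 0"] linear[of "F 0"] swap_EF0 _ x(2,3,1) N])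
        (simp add: swap_HF)
    then have "act (F 0) x = 0" using that by auto
    then show ?thesis
      using that x pos D unfolding extremal_at_def by (auto simp: order_le_less)
  qed
  show "extremal_at act (-1) x" if "l = 1"
  proof -
    have F: "node_twist act (F 0) = act (E (-1))" by (rule ext) simp
    obtain N where N: "(node_twist act (F 0) ^^ N) x = 0" using nil F by auto
    have H: "node_twist act (H 0) x = 0 *\<^sub>C x" "node_twist act (E 0) x = 0"
      using that x pos by (simp_all add: scaleC_one)
    have "\<exists>s. 0 = (of_nat s :: complex) \<and> (node_twist act (F 0) ^^ s) x \<noteq> 0 \<and> (node_twist act (F 0) ^^ Suc s) x = 0"
      by (rule sl2_primitive_vector[OF T.linear[of "E 0"] T.linear[of "F 0"] T.swap_EF0 _ H(2,1) x(1) N])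
        (simp add: T.swap_HF del: node_twist.simps)
    then have "act (E (-1)) x = 0" by auto
    moreover have "act (E n) x = 0" if "- 1 \<le> n" for n
      using calculation x(2) pos[of n] that by (cases "n = -1 \<or> n = 0") auto
    ultimately show ?thesis
      using that x pos D unfolding extremal_at_def by auto
  qed
qed

lemma extremal_at_weight:
  assumes "extremal_at act p x" "act (H 0) x = c *\<^sub>C x"
  shows "c = - of_int p"
proof (rule cvs.scale_right_imp_eq)
  show "x \<noteq> 0" "c *\<^sub>C x = (- of_int p) *\<^sub>C x"
    using assms by (auto simp only: extremal_at_def)
qed

lemma extremal_at_K: "extremal_at act p x \<Longrightarrow> act K x = x"
  by (simp add: extremal_at_def)

text \<open>\<open>v(p)\<close> lies in \<open>L\<^sub>0\<^sub>,\<^sub>1\<close> for even \<open>p\<close> and in \<open>L\<^sub>1\<^sub>,\<^sub>1\<close> for odd \<open>p\<close>.\<close>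

definition in_component :: "int \<Rightarrow> 'a::zero \<times> 'b::zero \<Rightarrow> bool"
  where "in_component p u \<longleftrightarrow> (if even p then snd u = 0 else fst u = 0)"

context
  fixes A :: "affine_sl2 \<Rightarrow> 'a::complex_vector \<Rightarrow> 'a" and B :: "affine_sl2 \<Rightarrow> 'b::complex_vector \<Rightarrow> 'b"
  assumes A: "is_L 0 1 A" and B: "is_L 1 1 B"
begin

interpretation A: affine_sl2_module A using A by (simp add: is_L_def)
interpretation B: affine_sl2_module B using B by (simp add: is_L_def)

abbreviation (input) "V \<equiv> direct_sum_act A B"

interpretation V: affine_sl2_module V
  by (rule direct_sum_act_module[OF A.affine_sl2_module_axioms B.affine_sl2_module_axioms])

lemma irreducible_components: "irreducible_module A" "irreducible_module B"
  using A B by (simp_all add: is_L_def)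

lemma V_pow: "(V g ^^ n) u = ((A g ^^ n) (fst u), (B g ^^ n) (snd u))"
  by (induction n) (simp_all add: direct_sum_act_def)

lemma V_nil:
  assumes "\<exists>N. (A g ^^ N) (fst u) = 0" "\<exists>N. (B g ^^ N) (snd u) = 0"
  shows "\<exists>N. (V g ^^ N) u = 0"
proof -
  obtain N M where "(A g ^^ N) (fst u) = 0" "(B g ^^ M) (snd u) = 0"
    using assms by blast
  then have "(V g ^^ max N M) u = 0"
    unfolding V_pow zero_prod_def
    by (auto intro: funpow_zero_mono[where f = "A g", OF A.act_zero]
        funpow_zero_mono[where f = "B g", OF B.act_zero])
  then show ?thesis by blast
qed

lemma V_simple_nil:
  "g \<in> {E 0, F 0, F 1, E (-1)} \<Longrightarrow> \<exists>N. (V g ^^ N) u = 0"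
  using A B by (intro V_nil) (auto simp: is_L_def integrable_module_def)

lemma in_component_pow: "in_component p u \<Longrightarrow> even (p - q) \<Longrightarrow> in_component q ((V g ^^ n) u)"
  unfolding in_component_def V_pow
  by (auto simp: cvs_pair.linear_0[OF A.linear_pow] cvs_pair.linear_0[OF B.linear_pow] split: if_splits)

lemma extremal_at_components:
  "extremal_at V p u \<Longrightarrow> snd u = 0 \<Longrightarrow> extremal_at A p (fst u)"
  "extremal_at V p u \<Longrightarrow> fst u = 0 \<Longrightarrow> extremal_at B p (snd u)"
  by (cases u; auto simp: extremal_at_def direct_sum_act_def scaleC_prod_def zero_prod_def)+

lemma V_highest:
  assumes "highest_weight_vector V l k u"
  shows "\<exists>p. extremal_at V p u \<and> in_component p u"
proof -
  obtain u0 u1 where u0: "highest_weight_vector A 0 1 u0" and u1: "highest_weight_vector B 1 1 u1"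
    using A B by (auto simp: is_L_def)
  have "u \<noteq> 0" using assms by (simp add: highest_weight_vector_def)
  have x: "highest_weight_vector A l k (fst u)" if "fst u \<noteq> 0"
    using assms that by (auto simp: highest_weight_vector_def direct_sum_act_def scaleC_prod_def prod_eq_iff)
  have y: "highest_weight_vector B l k (snd u)" if "snd u \<noteq> 0"
    using assms that by (auto simp: highest_weight_vector_def direct_sum_act_def scaleC_prod_def prod_eq_iff)
  have x': "l = 0 \<and> k = 1" if "fst u \<noteq> 0"
    using highest_weight_vector_unique[OF A.affine_sl2_module_axioms irreducible_components(1) u0 x[OF that]] by simp
  have y': "l = 1 \<and> k = 1" if "snd u \<noteq> 0"
    using highest_weight_vector_unique[OF B.affine_sl2_module_axioms irreducible_components(2) u1 y[OF that]] by simp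
  show ?thesis
  proof (cases "fst u = 0")
    case True
    then have "l = 1 \<and> k = 1" using y' \<open>u \<noteq> 0\<close> by (auto simp: prod_eq_iff)
    then have "extremal_at V (-1) u"
      using V.highest_weight_vector_extremal(2)[of l u] assms V_simple_nil by auto
    then show ?thesis using True by (intro exI[of _ "-1"]) (simp add: in_component_def)
  next
    case False
    then have "l = 0 \<and> k = 1" "snd u = 0" using x' y' by auto
    moreover from this have "extremal_at V 0 u"
      using V.highest_weight_vector_extremal(1)[of l u] assms V_simple_nil by auto
    ultimately show ?thesis by (intro exI[of _ "0"]) (simp add: in_component_def)
  qed
qed

text \<open>Simple reflections act on the parameter by \<open>p \<mapsto> - p\<close> and \<open>p \<mapsto> - 2 - p\<close>, which preserves the parity and
  hence the component.\<close>

lemma extremal_vector_at: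
  assumes "extremal_vector V u"
  shows "\<exists>p. extremal_at V p u \<and> in_component p u"
  using assms
proof induction
  case (highest l k x)
  then show ?case by (rule V_highest)
next
  case (refl1_pos x n)
  then obtain p where p: "extremal_at V p x" "in_component p x" by blast
  have "(of_int (- p) :: complex) = of_int (int n)"
    using extremal_at_weight[of V, OF p(1) refl1_pos.hyps(2)] by simp
  then have n: "- p = int n" by (simp only: of_int_eq_iff)
  then have "extremal_at V (- p) ((V (F 0) ^^ n) x)"
    using V.reflect_F[OF p(1), of 0] V_simple_nil n by (simp add: nat_eq_iff)
  then show ?case using in_component_pow[OF p(2), of "- p"] by auto
next
  case (refl1_neg x n)
  then obtain p where p: "extremal_at V p x" "in_component p x" by blast
  have "(of_int p :: complex) = of_int (int n)"
    using extremal_at_weight[of V, OF p(1) refl1_neg.hyps(2)] by simp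
  then have n: "p = int n" by (simp only: of_int_eq_iff)
  then have "extremal_at V (- p) ((V (E 0) ^^ n) x)"
    using V.reflect_E[OF p(1), of 0] V_simple_nil n by simp
  then show ?case using in_component_pow[OF p(2), of "- p"] by auto
next
  case (refl0_pos x n)
  then obtain p where p: "extremal_at V p x" "in_component p x" by blast
  have "V (H 0) x = x - (V K x - V (H 0) x)" using extremal_at_K[of V, OF p(1)] by simp
  also have "\<dots> = (1 - of_nat n) *\<^sub>C x"
    unfolding refl0_pos.hyps(2) by (simp add: cvs.scale_left_diff_distrib cvs.scale_left_distrib scaleC_one)
  finally have w: "1 - of_nat n = - (of_int p :: complex)" by (rule extremal_at_weight[of V, OF p(1)])
  have "(of_int (1 + p) :: complex) = of_nat n + (1 - of_nat n) + of_int p" by simp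
  also have "\<dots> = of_int (int n)" unfolding w by simp
  finally have "(of_int (1 + p) :: complex) = of_int (int n)" .
  then have n: "1 + p = int n" by (simp only: of_int_eq_iff)
  then have "extremal_at V (- 2 - p) ((V (E (-1)) ^^ n) x)"
    using V.reflect_E[OF p(1), of "-1"] V_simple_nil by (simp add: add.commute)
  then show ?case using in_component_pow[OF p(2), of "- 2 - p"] by auto
next
  case (refl0_neg x n)
  then obtain p where p: "extremal_at V p x" "in_component p x" by blast
  have "V (H 0) x = x - (V K x - V (H 0) x)" using extremal_at_K[of V, OF p(1)] by simp
  also have "\<dots> = (1 - (- of_nat n)) *\<^sub>C x"
    unfolding refl0_neg.hyps(2) by (simp add: cvs.scale_left_diff_distrib cvs.scale_left_distrib scaleC_one)
  finally have w: "1 - (- of_nat n) = - (of_int p :: complex)" by (rule extremal_at_weight[of V, OF p(1)])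
  have "(of_int (1 + p) :: complex) = (- of_nat n) + (1 - (- of_nat n)) + of_int p" by simp
  also have "\<dots> = of_int (- int n)" unfolding w by simp
  finally have "(of_int (1 + p) :: complex) = of_int (- int n)" .
  then have "1 + p = - int n" by (simp only: of_int_eq_iff)
  then have n: "- 1 - p = int n" by simp
  then have "extremal_at V (- 2 - p) ((V (F 1) ^^ n) x)"
    using V.reflect_F[OF p(1), of "-1"] V_simple_nil by simp
  then show ?case using in_component_pow[OF p(2), of "- 2 - p"] by auto
qed

lemma component_unique:
  assumes "extremal_at V p u" "in_component p u" "extremal_at V p w" "in_component p w"
  shows "\<exists>c. c \<noteq> 0 \<and> w = c *\<^sub>C u"
proof -
  have "\<exists>c. w = c *\<^sub>C u"
  proof (cases "even p")
    case True
    then have s: "snd u = 0" "snd w = 0" using assms by (auto simp: in_component_def)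
    then obtain c where "fst w = c *\<^sub>C fst u"
      using extremal_at_unique[OF A.affine_sl2_module_axioms irreducible_components(1)] extremal_at_components assms by blast
    then show ?thesis using s by (intro exI[of _ c]) (simp add: scaleC_prod_def prod_eq_iff)
  next
    case False
    then have s: "fst u = 0" "fst w = 0" using assms by (auto simp: in_component_def)
    then obtain c where "snd w = c *\<^sub>C snd u"
      using extremal_at_unique[OF B.affine_sl2_module_axioms irreducible_components(2)] extremal_at_components assms by blast
    then show ?thesis using s by (intro exI[of _ c]) (simp add: scaleC_prod_def prod_eq_iff)
  qed
  then show ?thesis using assms(3) by (auto simp: extremal_at_def)
qed

text \<open>Nilpotency of all real root vectors comes from extremal vectors \<open>v(p)\<close> with \<open>p\<close> far out, which are killed by
  the given root vector. The scalars in the reflections exist by uniqueness in each component.\<close>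

lemma extremal_family_module_direct_sum:
  assumes v: "extremal_family V v"
  shows "extremal_family_module V v"
proof -
  have vp: "extremal_at V p (v p) \<and> in_component p (v p)" for p
  proof -
    have "extremal_vector V (v p)" and H: "V (H 0) (v p) = (- of_int p) *\<^sub>C v p"
      using v by (auto simp: extremal_family_def)
    then obtain q where q: "extremal_at V q (v p)" "in_component q (v p)"
      using extremal_vector_at by blast
    have "q = p" using extremal_at_weight[of V, OF q(1) H] by simp
    then show ?thesis using q by simp
  qed
  have A_at: "extremal_at A p (fst (v p))" if "even p" for p
    using vp[of p] that extremal_at_components by (auto simp: in_component_def)
  have B_at: "extremal_at B p (snd (v p))" if "odd p" for p
    using vp[of p] that extremal_at_components by (auto simp: in_component_def)
  have all: "x \<in> S" if "submodule C S" "y \<in> S" "y \<noteq> 0" "irreducible_module C" for C S and x y :: "'z::complex_vector"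
    using that unfolding irreducible_module_def by blast
  have large: "\<exists>p. even p \<and> m \<le> p" "\<exists>p. odd p \<and> m \<le> p" for m :: int
    by (rule exI[of _ "2 * \<bar>m\<bar>"], simp) (rule exI[of _ "2 * \<bar>m\<bar> + 1"], simp)
  have nil_F: "\<exists>N. (V (F m) ^^ N) x = 0" for m x
  proof (rule V_nil)
    obtain p where p: "even p" "- m \<le> p" using large by blast
    then have "(A (F m) ^^ 1) (fst (v p)) = 0" "fst (v p) \<noteq> 0"
      using A_at[of p] by (auto simp: extremal_at_def)
    then show "\<exists>N. (A (F m) ^^ N) (fst x) = 0"
      using all[OF A.F_nilpotent_submodule[of m] _ _ irreducible_components(1)] by blast
    obtain p where p: "odd p" "- m \<le> p" using large by blast
    then have "(B (F m) ^^ 1) (snd (v p)) = 0" "snd (v p) \<noteq> 0"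
      using B_at[of p] by (auto simp: extremal_at_def)
    then show "\<exists>N. (B (F m) ^^ N) (snd x) = 0"
      using all[OF B.F_nilpotent_submodule[of m] _ _ irreducible_components(2)] by blast
  qed
  have E: "chevalley_twist C (F m) = C (E m)" for C :: "affine_sl2 \<Rightarrow> 'z \<Rightarrow> 'z::complex_vector" and m
    by (rule ext) simp
  have nil_E: "\<exists>N. (V (E m) ^^ N) x = 0" for m x
  proof (rule V_nil)
    interpret A': affine_sl2_module "chevalley_twist A" by (rule A.chevalley_twist_module)
    interpret B': affine_sl2_module "chevalley_twist B" by (rule B.chevalley_twist_module)
    obtain p where p: "even p" "- m \<le> p" using large by blast
    then have "(A (E m) ^^ 1) (fst (v (- p))) = 0" "fst (v (- p)) \<noteq> 0"
      using A_at[of "- p"] by (auto simp: extremal_at_def)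
    then show "\<exists>N. (A (E m) ^^ N) (fst x) = 0"
      using all[OF submodule_chevalley_twist[OF A'.F_nilpotent_submodule[of m]] _ _ irreducible_components(1)]
      unfolding E by blast
    obtain p where p: "odd p" "- m \<le> p" using large by blast
    then have "(B (E m) ^^ 1) (snd (v (- p))) = 0" "snd (v (- p)) \<noteq> 0"
      using B_at[of "- p"] by (auto simp: extremal_at_def)
    then show "\<exists>N. (B (E m) ^^ N) (snd x) = 0"
      using all[OF submodule_chevalley_twist[OF B'.F_nilpotent_submodule[of m]] _ _ irreducible_components(2)]
      unfolding E by blast
  qed
  have comp: "in_component (2 * m - p) ((V g ^^ n) (v p))" for m p g n
    using vp[of p] by (intro in_component_pow) auto
  have rec: "of_nat n *\<^sub>C V (E (p - 1 - int n)) (v p)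
      = (\<Sum>a = 1..n. V (H (- int a)) (V (E (p + int a - 1 - int n)) (v p)))" for n p
  proof -
    have fst_sum: "fst (sum f S) = (\<Sum>a\<in>S. fst (f a))" and snd_sum: "snd (sum f S) = (\<Sum>a\<in>S. snd (f a))"
      for f :: "nat \<Rightarrow> 'a \<times> 'b" and S
      by (induction S rule: infinite_finite_induct) auto
    show ?thesis
    proof (cases "even p")
      case True
      then have "snd (v p) = 0" using vp[of p] by (simp add: in_component_def)
      then show ?thesis
        using extremal_recursion[OF A.affine_sl2_module_axioms irreducible_components(1) A_at[OF True], of n]
        by (simp add: prod_eq_iff fst_sum snd_sum scaleC_prod_def direct_sum_act_def B.act_zero)
    next
      case False
      then have "fst (v p) = 0" using vp[of p] by (simp add: in_component_def)
      then show ?thesis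
        using extremal_recursion[OF B.affine_sl2_module_axioms irreducible_components(2) B_at[OF False], of n]
        by (simp add: prod_eq_iff fst_sum snd_sum scaleC_prod_def direct_sum_act_def A.act_zero)
    qed
  qed
  obtain u0 u1 where u0: "highest_weight_vector A 0 1 u0" and u1: "highest_weight_vector B 1 1 u1"
    using A B by (auto simp: is_L_def)
  have "highest_weight_vector V 0 1 (u0, 0)" "highest_weight_vector V 1 1 (0, u1)"
    using u0 u1 by (auto simp: highest_weight_vector_def direct_sum_act_def scaleC_prod_def
        zero_prod_def A.act_zero B.act_zero)
  then have hw: "extremal_at V 0 (u0, 0)" "extremal_at V (-1) (0, u1)" "V D (u0, 0) = 0" "V D (0, u1) = 0"
    using V.highest_weight_vector_extremal[OF _ nil_F nil_E] by (auto simp: highest_weight_vector_def)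
  have "V D (v 0) = 0"
    using component_unique[OF hw(1) _ vp[THEN conjunct1] vp[THEN conjunct2]] hw(3)
    by (auto simp: in_component_def V.act_scale)
  moreover have "V D (v (-1)) = 0"
    using component_unique[OF hw(2) _ vp[THEN conjunct1] vp[THEN conjunct2]] hw(4)
    by (auto simp: in_component_def V.act_scale)
  ultimately show ?thesis
    using vp nil_F nil_E rec
      component_unique[OF _ _ V.reflect_F(1)[OF vp[THEN conjunct1] _ nil_F] comp]
      component_unique[OF _ _ V.reflect_E(1)[OF vp[THEN conjunct1] _ nil_E] comp]
    by unfold_locales blast+
qed

end

section \<open>Tensor powers as modules\<close>

lemma free_space_sum: "(\<Sum>b\<in>Poly_Mapping.keys s. Poly_Mapping.lookup s b *\<^sub>C basis_vec b) = s"
proof (rule poly_mapping_eqI)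
  fix a
  have "Poly_Mapping.lookup (\<Sum>b\<in>Poly_Mapping.keys s. Poly_Mapping.lookup s b *\<^sub>C basis_vec b) a
    = (\<Sum>b\<in>Poly_Mapping.keys s. if b = a then Poly_Mapping.lookup s b else 0)"
    unfolding Poly_Mapping.lookup_sum
    by (intro sum.cong refl) (simp add: lookup_scaleC lookup_single when_def scaleC_complex_def)
  also have "\<dots> = Poly_Mapping.lookup s a"
    by (simp add: sum.delta in_keys_iff)
  finally show "Poly_Mapping.lookup (\<Sum>b\<in>Poly_Mapping.keys s. Poly_Mapping.lookup s b *\<^sub>C basis_vec b) a
    = Poly_Mapping.lookup s a" .
qed

lemma tensor_span: "t \<in> cvs.span (range (\<lambda>(x, y). tensor_pure x y))"
proof (induct t)
  fix s :: "'a \<times> 'b \<Rightarrow>\<^sub>0 complex"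
  have lin: "clinear abs_tensor"
    by (rule clinearI) (simp_all add: plus_tensor.abs_eq scaleC_tensor.abs_eq)
  have "abs_tensor s = (\<Sum>b\<in>Poly_Mapping.keys s. Poly_Mapping.lookup s b *\<^sub>C abs_tensor (basis_vec b))"
    by (subst free_space_sum[of s, symmetric])
      (simp only: cvs_pair.linear_sum[OF lin] cvs_pair.linear_scale[OF lin])
  moreover have "abs_tensor (basis_vec b) \<in> range (\<lambda>(x, y). tensor_pure x y)" for b
    by (intro image_eqI[of _ _ b]) (auto simp: tensor_pure.abs_eq split: prod.splits)
  ultimately show "abs_tensor s \<in> cvs.span (range (\<lambda>(x, y). tensor_pure x y))"
    by (simp only:) (intro cvs.span_sum cvs.span_scale cvs.span_base)
qed

lemma tensor_alg_span: "t \<in> cvs.span (range pure_tensors)"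
proof (induct t)
  fix s :: "'a list \<Rightarrow>\<^sub>0 complex"
  have lin: "clinear abs_tensor_alg"
    by (rule clinearI) (simp_all add: plus_tensor_alg.abs_eq scaleC_tensor_alg.abs_eq)
  have "abs_tensor_alg s = (\<Sum>b\<in>Poly_Mapping.keys s. Poly_Mapping.lookup s b *\<^sub>C pure_tensors b)"
    by (subst free_space_sum[of s, symmetric])
      (simp only: cvs_pair.linear_sum[OF lin] cvs_pair.linear_scale[OF lin] pure_tensors.abs_eq)
  then show "abs_tensor_alg s \<in> cvs.span (range pure_tensors)"
    by (simp only:) (intro cvs.span_sum cvs.span_scale cvs.span_base rangeI)
qed

lemma tensor_linear_eqI:
  assumes "clinear f" "clinear g" "\<And>x y. f (tensor_pure x y) = g (tensor_pure x y)"
  shows "f t = g t"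
  by (rule cvs_pair.linear_eq_on_span[OF assms(1,2) _ tensor_span]) (auto simp: assms(3))

lemma tensor_alg_linear_eqI:
  assumes "clinear f" "clinear g" "\<And>xs. f (pure_tensors xs) = g (pure_tensors xs)"
  shows "f t = g t"
  by (rule cvs_pair.linear_eq_on_span[OF assms(1,2) _ tensor_alg_span]) (auto simp: assms(3))

text \<open>Left multiplication \<open>y \<otimes> t\<close> in the tensor algebra; it gives proofs by induction on the tensor factors.\<close>

definition tcons :: "'v::complex_vector \<Rightarrow> 'v tensor_alg \<Rightarrow> 'v tensor_alg"
  where "tcons y = tensor_alg_lift (\<lambda>xs. pure_tensors (y # xs))"

lemma multilinear_case:
  fixes g :: "'a::complex_vector \<Rightarrow> 'a list \<Rightarrow> 'x::complex_vector"
  assumes "\<And>a. multilinear (g a)" "\<And>xs. clinear (\<lambda>a. g a xs)"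
  shows "multilinear (\<lambda>xs. case xs of [] \<Rightarrow> 0 | a # xs \<Rightarrow> g a xs)"
  unfolding multilinear_def
proof (intro allI)
  fix us ws :: "'a list"
  show "clinear (\<lambda>x. case us @ [x] @ ws of [] \<Rightarrow> 0 | a # xs \<Rightarrow> g a xs)"
    using assms by (cases us) (simp_all add: multilinear_def)
qed

lemma multilinear_Cons: "multilinear (\<lambda>xs. pure_tensors (y # xs))"
  using multilinear_pure_tensors[unfolded multilinear_def, rule_format, of "y # us" for us]
  by (simp add: multilinear_def)

lemma clinear_pure_Cons: "clinear (\<lambda>y. pure_tensors (y # xs))"
  using multilinear_pure_tensors[unfolded multilinear_def, rule_format, of "[]" xs] by simp

lemma tcons_pure: "tcons y (pure_tensors xs) = pure_tensors (y # xs)"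
  unfolding tcons_def by (rule tensor_alg_lift_pure[OF multilinear_Cons])

lemma clinear_tcons_right: "clinear (tcons y)"
  unfolding tcons_def by (rule tensor_alg_lift_linear[OF multilinear_Cons])

lemmas tcons_right = cvs_pair.linear_add[OF clinear_tcons_right] cvs_pair.linear_scale[OF clinear_tcons_right]
  cvs_pair.linear_0[OF clinear_tcons_right] cvs_pair.linear_diff[OF clinear_tcons_right]

lemma clinear_tcons_left: "clinear (\<lambda>y. tcons y t)"
proof (rule clinearI)
  note p = cvs_pair.linear_add[OF clinear_pure_Cons] cvs_pair.linear_scale[OF clinear_pure_Cons]
  show "tcons (x + y) t = tcons x t + tcons y t" for x y
    by (rule tensor_alg_linear_eqI[of "tcons (x + y)" "\<lambda>t. tcons x t + tcons y t" t])
      (intro clinear_tcons_right cvs_pair.linear_compose_add | simp add: tcons_pure p)+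
  show "tcons (c *\<^sub>C x) t = c *\<^sub>C tcons x t" for c x
    by (rule tensor_alg_linear_eqI[of "tcons (c *\<^sub>C x)" "\<lambda>t. c *\<^sub>C tcons x t" t])
      (intro clinear_tcons_right cvs_pair.linear_compose_scale_right | simp add: tcons_pure p)+
qed

lemmas tcons_left = cvs_pair.linear_add[OF clinear_tcons_left] cvs_pair.linear_scale[OF clinear_tcons_left]
  cvs_pair.linear_0[OF clinear_tcons_left] cvs_pair.linear_diff[OF clinear_tcons_left]

text \<open>Tensors with a distinguished first factor have the universal property of a tensor product of two spaces.\<close>

lemma tcons_lift:
  fixes \<beta> :: "'v::complex_vector \<Rightarrow> 'v tensor_alg \<Rightarrow> 'x::complex_vector"
  assumes "\<And>t. clinear (\<lambda>y. \<beta> y t)" "\<And>y. clinear (\<beta> y)"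
  obtains \<Lambda> where "clinear \<Lambda>" "\<And>y t. \<Lambda> (tcons y t) = \<beta> y t"
proof
  let ?f = "\<lambda>xs. case xs of [] \<Rightarrow> 0 | a # xs \<Rightarrow> \<beta> a (pure_tensors xs)"
  have "multilinear (\<lambda>xs. \<beta> a (pure_tensors xs))" for a
    unfolding multilinear_def
  proof (intro allI)
    fix us ws :: "'v list"
    have "clinear (\<lambda>x. pure_tensors (us @ [x] @ ws))"
      using multilinear_pure_tensors unfolding multilinear_def by blast
    from Vector_Spaces.linear_compose[OF this assms(2)[of a]]
    show "clinear (\<lambda>x. \<beta> a (pure_tensors (us @ [x] @ ws)))" by (simp add: o_def)
  qed
  then have f: "multilinear ?f"
    using assms(1) by (intro multilinear_case)
      (auto intro: clinearI)
  show lin: "clinear (tensor_alg_lift ?f)" by (rule tensor_alg_lift_linear[OF f])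
  show "tensor_alg_lift ?f (tcons y t) = \<beta> y t" for y t
  proof (rule tensor_alg_linear_eqI[of "\<lambda>t. tensor_alg_lift ?f (tcons y t)" "\<beta> y" t])
    show "clinear (\<lambda>t. tensor_alg_lift ?f (tcons y t))"
      using Vector_Spaces.linear_compose[OF clinear_tcons_right lin] by (simp add: o_def)
  qed (simp_all add: assms tcons_pure tensor_alg_lift_pure[OF f])
qed

lemma tcons_nonzero:
  assumes "y \<noteq> 0" "t \<noteq> 0"
  shows "tcons y t \<noteq> 0"
proof -
  have "clinear (\<lambda>c::complex. c *\<^sub>C y)"
    by (rule clinearI) (simp_all add: cvs.scale_left_distrib scaleC_complex_def)
  moreover have "inj (\<lambda>c::complex. c *\<^sub>C y)"
    using assms(1) by (auto intro!: injI simp: cvs.scale_cancel_right)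
  ultimately obtain \<xi> :: "_ \<Rightarrow> complex" where l: "clinear \<xi>" "\<xi> \<circ> (\<lambda>c. c *\<^sub>C y) = id"
    using cvs_pair.linear_injective_left_inverse by blast
  have "\<xi> (1 *\<^sub>C y) = 1" using l(2) by (metis comp_apply id_apply)
  then have y: "\<xi> y = 1" by (simp add: scaleC_one)
  obtain \<Lambda> where L: "clinear \<Lambda>" "\<And>y t. \<Lambda> (tcons y t) = \<xi> y *\<^sub>C t"
    by (rule tcons_lift[of "\<lambda>y t. \<xi> y *\<^sub>C t"])
      (auto intro!: clinearI simp: cvs_pair.linear_add[OF l(1)] cvs_pair.linear_scale[OF l(1)]
        cvs.scale_left_distrib cvs.scale_right_distrib scaleC_complex_def mult.commute)
  have "\<Lambda> (tcons y t) \<noteq> 0" using L(2) y assms(2) by (simp add: scaleC_one)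
  then show ?thesis using cvs_pair.linear_0[OF L(1)] by metis
qed

lemma pure_Nil_nonzero: "pure_tensors [] \<noteq> (0 :: 'v::complex_vector tensor_alg)"
proof
  assume 0: "pure_tensors [] = (0 :: 'v tensor_alg)"
  let ?f = "\<lambda>xs :: 'v list. if xs = [] then 1 else (0 :: complex)"
  have f: "multilinear ?f" unfolding multilinear_def by (auto intro!: clinearI)
  have "tensor_alg_lift ?f (pure_tensors []) = 1"
    by (simp add: tensor_alg_lift_pure[OF f])
  then show False
    using 0 cvs_pair.linear_0[OF tensor_alg_lift_linear[OF f]] by simp
qed

lemma pure_tensors_nonzero: "0 \<notin> set xs \<Longrightarrow> pure_tensors xs \<noteq> 0"
  by (induction xs) (auto simp: pure_Nil_nonzero tcons_nonzero simp flip: tcons_pure)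

lemma clinear_tensor_alg_act: "clinear (A g) \<Longrightarrow> clinear (tensor_alg_act A g)"
  unfolding tensor_alg_act_def by (rule tensor_alg_lift_linear[OF multilinear_tensor_alg_act])

lemma tensor_alg_act_Nil: "clinear (A g) \<Longrightarrow> tensor_alg_act A g (pure_tensors []) = 0"
  by (simp add: tensor_alg_act_pure)

lemma tensor_alg_act_tcons:
  assumes "clinear (A g)"
  shows "tensor_alg_act A g (tcons y t) = tcons (A g y) t + tcons y (tensor_alg_act A g t)"
proof (rule tensor_alg_linear_eqI[of "\<lambda>t. tensor_alg_act A g (tcons y t)"
      "\<lambda>t. tcons (A g y) t + tcons y (tensor_alg_act A g t)" t])
  note lin = clinear_tensor_alg_act[of A g, OF assms]
  show "clinear (\<lambda>t. tensor_alg_act A g (tcons y t))"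
    using Vector_Spaces.linear_compose[OF clinear_tcons_right lin] by (simp add: o_def)
  show "clinear (\<lambda>t. tcons (A g y) t + tcons y (tensor_alg_act A g t))"
    using Vector_Spaces.linear_compose[OF lin clinear_tcons_right]
    by (intro cvs_pair.linear_compose_add clinear_tcons_right) (simp add: o_def)
  show "tensor_alg_act A g (tcons y (pure_tensors xs))
      = tcons (A g y) (pure_tensors xs) + tcons y (tensor_alg_act A g (pure_tensors xs))" for xs
    by (simp add: tcons_pure tensor_alg_act_pure[of A g, OF assms] sum.lessThan_Suc_shift
        cvs_pair.linear_sum[OF clinear_tcons_right] del: sum.lessThan_Suc)
qed

lemma tensor_alg_act_module:
  assumes "affine_sl2_module A"
  shows "affine_sl2_module (tensor_alg_act A)"
proof -
  interpret A: affine_sl2_module A by fact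
  let ?T = "tensor_alg_act A"
  note lin = clinear_tensor_alg_act[of A, OF A.linear]
  note T = cvs_pair.linear_add[OF lin] cvs_pair.linear_scale[OF lin] cvs_pair.linear_diff[OF lin]
    tensor_alg_act_Nil[of A, OF A.linear] cvs_pair.linear_0[OF lin]
  have bracket: "?T g (?T h (tcons y t)) - ?T h (?T g (tcons y t))
      = tcons (A g (A h y) - A h (A g y)) t + tcons y (?T g (?T h t) - ?T h (?T g t))" for g h y t
    by (simp add: tensor_alg_act_tcons[of A, OF A.linear] T tcons_left tcons_right)
  have brL: "clinear (\<lambda>t. ?T g (?T h t) - ?T h (?T g t))" for g h
    by (rule clinearI) (simp_all add: T algebra_simps)
  have rule: "?T g (?T h t) - ?T h (?T g t) = c *\<^sub>C ?T g' t + d *\<^sub>C ?T K t"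
    if br: "\<And>y. A g (A h y) - A h (A g y) = c *\<^sub>C A g' y + d *\<^sub>C A K y" for g h c g' d t
  proof (rule tensor_alg_linear_eqI[OF brL[of g h], of "\<lambda>t. c *\<^sub>C ?T g' t + d *\<^sub>C ?T K t" t])
    show "clinear (\<lambda>t. c *\<^sub>C ?T g' t + d *\<^sub>C ?T K t)"
      by (intro cvs_pair.linear_compose_add cvs_pair.linear_compose_scale_right lin)
    show "?T g (?T h (pure_tensors xs)) - ?T h (?T g (pure_tensors xs))
        = c *\<^sub>C ?T g' (pure_tensors xs) + d *\<^sub>C ?T K (pure_tensors xs)" for xs
    proof (induction xs)
      case Nil
      then show ?case by (simp add: T)
    next
      case (Cons y xs)
      show ?case
        unfolding tcons_pure[symmetric] bracket br Cons
        by (simp add: tensor_alg_act_tcons[of A, OF A.linear] tcons_left tcons_right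
            cvs.scale_right_distrib algebra_simps)
    qed
  qed
  show ?thesis
  proof (rule affine_sl2_module.intro)
    fix g m n t
    show "clinear (?T g)" by (rule lin)
    show "?T (E m) (?T (E n) t) - ?T (E n) (?T (E m) t) = 0"
      using rule[of "E m" "E n" 0 K 0] A.EE by simp
    show "?T (F m) (?T (F n) t) - ?T (F n) (?T (F m) t) = 0"
      using rule[of "F m" "F n" 0 K 0] A.FF by simp
    show "?T (E m) (?T (F n) t) - ?T (F n) (?T (E m) t)
      = ?T (H (m + n)) t + (if m + n = 0 then of_int m *\<^sub>C ?T K t else 0)"
      using rule[of "E m" "F n" 1 "H (m + n)" "if m + n = 0 then of_int m else 0"] A.EF
      by (simp add: scaleC_one)
    show "?T (H m) (?T (E n) t) - ?T (E n) (?T (H m) t) = 2 *\<^sub>C ?T (E (m + n)) t"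
      using rule[of "H m" "E n" 2 "E (m + n)" 0] A.HE by simp
    show "?T (H m) (?T (F n) t) - ?T (F n) (?T (H m) t) = (- 2) *\<^sub>C ?T (F (m + n)) t"
      using rule[of "H m" "F n" "-2" "F (m + n)" 0] A.HF by simp
    show "?T (H m) (?T (H n) t) - ?T (H n) (?T (H m) t)
      = (if m + n = 0 then (2 * of_int m) *\<^sub>C ?T K t else 0)"
      using rule[of "H m" "H n" 0 K "if m + n = 0 then 2 * of_int m else 0"] A.HH by simp
    show "?T K (?T g t) - ?T g (?T K t) = 0"
      using rule[of K g 0 K 0] A.K_central by simp
    show "?T D (?T (E n) t) - ?T (E n) (?T D t) = (- of_int n) *\<^sub>C ?T (E n) t"
      using rule[of D "E n" "- of_int n" "E n" 0] A.DE by simp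
    show "?T D (?T (H n) t) - ?T (H n) (?T D t) = (- of_int n) *\<^sub>C ?T (H n) t"
      using rule[of D "H n" "- of_int n" "H n" 0] A.DH by simp
    show "?T D (?T (F n) t) - ?T (F n) (?T D t) = (- of_int n) *\<^sub>C ?T (F n) t"
      using rule[of D "F n" "- of_int n" "F n" 0] A.DF by simp
  qed
qed

text \<open>The highest power of \<open>g\<close> that does not annihilate \<open>x\<close> sends \<open>x\<close> to a nonzero multiple of \<open>x'\<close>.\<close>

definition top_power :: "(affine_sl2 \<Rightarrow> 'v::complex_vector \<Rightarrow> 'v) \<Rightarrow> affine_sl2 \<Rightarrow> 'v \<Rightarrow> 'v \<Rightarrow> bool"
  where "top_power act g x x' \<longleftrightarrow>
    (\<exists>s c. c \<noteq> 0 \<and> (act g ^^ s) x = c *\<^sub>C x' \<and> (act g ^^ Suc s) x = 0)"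

lemma submodule_top_power:
  assumes "submodule act S" "top_power act g x x'" "x \<in> S"
  shows "x' \<in> S"
  using assms submodule_pow submodule_scale_cancel unfolding top_power_def by metis

context affine_sl2_module
begin

interpretation T: affine_sl2_module "tensor_alg_act act"
  by (rule tensor_alg_act_module) (rule affine_sl2_module_axioms)

abbreviation "T \<equiv> tensor_alg_act act"

lemma T_tcons: "T g (tcons y t) = tcons (act g y) t + tcons y (T g t)"
  by (rule tensor_alg_act_tcons[of act g, OF linear])

lemma T_Nil: "T g (pure_tensors []) = 0"
  by (rule tensor_alg_act_Nil[of act g, OF linear])

lemma nilpotent_tcons:
  "(act g ^^ a) y = 0 \<Longrightarrow> (T g ^^ b) t = 0 \<Longrightarrow> (T g ^^ (a + b)) (tcons y t) = 0"
proof (induction "a + b" arbitrary: a b y t)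
  case 0
  then show ?case by (simp add: tcons_left)
next
  case (Suc n)
  show ?case
  proof (cases "a = 0 \<or> b = 0")
    case True
    then have "tcons y t = 0" using Suc.prems by (auto simp: tcons_left tcons_right)
    then show ?thesis by (simp add: T.pow_zero)
  next
    case False
    then obtain a' b' where ab: "a = Suc a'" "b = Suc b'" by (meson not0_implies_Suc)
    have "(T g ^^ n) (tcons (act g y) t) = 0"
      using Suc.hyps(1)[of a' b "act g y" t] Suc.hyps(2) Suc.prems ab
      by (simp add: funpow_swap1)
    moreover have "(T g ^^ n) (tcons y (T g t)) = 0"
      using Suc.hyps(1)[of a b' y "T g t"] Suc.hyps(2) Suc.prems ab
      by (simp add: funpow_swap1)
    ultimately have "(T g ^^ Suc n) (tcons y t) = 0"
      by (simp only: funpow_Suc_right o_apply T_tcons cvs_pair.linear_add[OF T.linear_pow]) simp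
    then show ?thesis using Suc.hyps(2) by simp
  qed
qed

lemma nilpotent_tensor_alg:
  assumes "\<And>y. \<exists>N. (act g ^^ N) y = 0"
  shows "\<exists>N. (T g ^^ N) t = 0"
  using tensor_alg_span[of t]
proof (induction rule: cvs.span_induct_alt)
  case base
  then show ?case by (intro exI[of _ 0]) simp
next
  case (step c p t)
  have "\<exists>N. (T g ^^ N) (pure_tensors xs) = 0" for xs
  proof (induction xs)
    case Nil
    then show ?case by (intro exI[of _ 1]) (simp add: T_Nil)
  next
    case (Cons y xs)
    then show ?case using nilpotent_tcons assms[of y] by (metis tcons_pure)
  qed
  then obtain N M where "(T g ^^ N) p = 0" "(T g ^^ M) t = 0" using step by blast
  then have "(T g ^^ max N M) (c *\<^sub>C p + t) = 0"
    using funpow_zero_mono[where f = "T g", OF T.act_zero]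
    by (simp add: cvs_pair.linear_add[OF T.linear_pow] cvs_pair.linear_scale[OF T.linear_pow])
  then show ?case by blast
qed

text \<open>Only one term of the binomial formula survives, and its coefficient is positive.\<close>

lemma power_tcons:
  "(act g ^^ Suc a) y = 0 \<Longrightarrow> (T g ^^ Suc b) t = 0 \<Longrightarrow>
    \<exists>c::nat. c > 0 \<and> (T g ^^ (a + b)) (tcons y t) = of_nat c *\<^sub>C tcons ((act g ^^ a) y) ((T g ^^ b) t)"
proof (induction "a + b" arbitrary: a b y t)
  case 0
  then show ?case by (intro exI[of _ 1]) (simp add: scaleC_one)
next
  case (Suc n)
  have split: "(T g ^^ (a + b)) (tcons y t) = (T g ^^ n) (tcons (act g y) t) + (T g ^^ n) (tcons y (T g t))"
    unfolding Suc.hyps(2)[symmetric]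
    by (simp only: funpow_Suc_right o_apply T_tcons cvs_pair.linear_add[OF T.linear_pow])
  have left: "\<exists>c::nat. (a > 0 \<longrightarrow> c > 0) \<and> (T g ^^ n) (tcons (act g y) t)
      = of_nat c *\<^sub>C tcons ((act g ^^ a) y) ((T g ^^ b) t)"
  proof (cases a)
    case 0
    then show ?thesis
      using Suc.prems by (intro exI[of _ 0]) (simp add: tcons_left T.pow_zero)
  next
    case (Suc a')
    then show ?thesis
      using Suc.hyps(1)[of a' b "act g y" t] Suc.hyps(2) Suc.prems
      by (simp add: funpow_swap1)
  qed
  have right: "\<exists>c::nat. (b > 0 \<longrightarrow> c > 0) \<and> (T g ^^ n) (tcons y (T g t))
      = of_nat c *\<^sub>C tcons ((act g ^^ a) y) ((T g ^^ b) t)"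
  proof (cases b)
    case 0
    then show ?thesis
      using Suc.prems by (intro exI[of _ 0]) (simp add: tcons_right T.pow_zero)
  next
    case (Suc b')
    then show ?thesis
      using Suc.hyps(1)[of a b' y "T g t"] Suc.hyps(2) Suc.prems
      by (simp add: funpow_swap1)
  qed
  obtain c1 c2 :: nat where c: "a > 0 \<longrightarrow> c1 > 0" "b > 0 \<longrightarrow> c2 > 0"
    "(T g ^^ n) (tcons (act g y) t) = of_nat c1 *\<^sub>C tcons ((act g ^^ a) y) ((T g ^^ b) t)"
    "(T g ^^ n) (tcons y (T g t)) = of_nat c2 *\<^sub>C tcons ((act g ^^ a) y) ((T g ^^ b) t)"
    using left right by blast
  have "c1 + c2 > 0" using c(1,2) Suc.hyps(2) by auto
  then show ?case
    unfolding split c(3,4) by (intro exI[of _ "c1 + c2"]) (simp add: cvs.scale_left_distrib)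
qed

lemma top_power_tcons:
  assumes "top_power act g y y'" "top_power T g t t'"
  shows "top_power T g (tcons y t) (tcons y' t')"
proof -
  obtain a c where a: "c \<noteq> 0" "(act g ^^ a) y = c *\<^sub>C y'" "(act g ^^ Suc a) y = 0"
    using assms(1) by (auto simp: top_power_def)
  obtain b d where b: "d \<noteq> 0" "(T g ^^ b) t = d *\<^sub>C t'" "(T g ^^ Suc b) t = 0"
    using assms(2) by (auto simp: top_power_def)
  obtain e :: nat where e: "e > 0"
    "(T g ^^ (a + b)) (tcons y t) = of_nat e *\<^sub>C tcons ((act g ^^ a) y) ((T g ^^ b) t)"
    using power_tcons[OF a(3) b(3)] by blast
  have "(T g ^^ Suc (a + b)) (tcons y t) = of_nat e *\<^sub>C T g (tcons ((act g ^^ a) y) ((T g ^^ b) t))"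
    by (simp add: e(2) T.act_scale)
  also have "\<dots> = 0"
    using a(3) b(3) by (simp add: T_tcons tcons_left tcons_right)
  finally have "(T g ^^ Suc (a + b)) (tcons y t) = 0" .
  moreover have "(T g ^^ (a + b)) (tcons y t) = (of_nat e * (c * d)) *\<^sub>C tcons y' t'"
    unfolding e(2) a(2) b(2) by (simp add: tcons_left tcons_right scaleC_scaleC mult.commute)
  moreover have "of_nat e * (c * d) \<noteq> 0" using e(1) a(1) b(1) by simp
  ultimately show ?thesis unfolding top_power_def by blast
qed

lemma top_power_pure:
  "list_all2 (top_power act g) xs ys \<Longrightarrow> top_power T g (pure_tensors xs) (pure_tensors ys)"
proof (induction rule: list_all2_induct)
  case Nil
  then show ?case
    unfolding top_power_def by (intro exI[of _ 0] exI[of _ 1]) (simp add: T_Nil scaleC_one)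
next
  case (Cons x xs y ys)
  then show ?case using top_power_tcons by (metis tcons_pure)
qed

lemma T_pure_zero: "(\<And>x. x \<in> set xs \<Longrightarrow> act g x = 0) \<Longrightarrow> T g (pure_tensors xs) = 0"
  by (induction xs) (simp_all add: T_Nil T_tcons tcons_left tcons_right flip: tcons_pure)

lemma T_pure_eigen:
  "list_all2 (\<lambda>c x. act g x = c *\<^sub>C x) cs xs \<Longrightarrow> T g (pure_tensors xs) = sum_list cs *\<^sub>C pure_tensors xs"
  by (induction rule: list_all2_induct)
    (simp_all add: T_Nil T_tcons tcons_left tcons_right cvs.scale_left_distrib flip: tcons_pure)

end

section \<open>Generating the tensor product\<close>

context extremal_family_module
begin

interpretation T: affine_sl2_module "tensor_alg_act act"
  by (rule tensor_alg_act_module) (rule affine_sl2_module_axioms)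

lemma v_simps: "v p \<noteq> 0" "act K (v p) = v p" "act (H 0) (v p) = (- of_int p) *\<^sub>C v p"
  "p \<le> m \<Longrightarrow> act (E m) (v p) = 0" "- p \<le> m \<Longrightarrow> act (F m) (v p) = 0" "0 < m \<Longrightarrow> act (H m) (v p) = 0"
  using ext[of p] by (auto simp: extremal_at_def)

lemma D_v_eigen: "\<exists>d. act D (v p) = d *\<^sub>C v p"
  using ext[of p] by (auto simp: extremal_at_def)

lemma top_F: "p \<le> m \<Longrightarrow> q = 2 * m - p \<Longrightarrow> top_power act (F (- m)) (v p) (v q)"
  unfolding top_power_def using F_pow[of p m] reflect_F(2)[OF ext _ nil_F] by blast

lemma top_E: "m \<le> p \<Longrightarrow> q = 2 * m - p \<Longrightarrow> top_power act (E m) (v p) (v q)"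
  unfolding top_power_def using E_pow[of m p] reflect_E(2)[OF ext _ nil_E] by blast

lemma top_trivial: "act g x = 0 \<Longrightarrow> top_power act g x x"
  unfolding top_power_def by (intro exI[of _ 0] exI[of _ 1]) (simp add: scaleC_one)

lemma lower_E: "\<exists>c. c \<noteq> 0 \<and> act (E (p - 1)) (v p) = c *\<^sub>C v (p - 2)"
proof -
  have "2 * (p - 1) - p = p - 2" by simp
  then show ?thesis using E_pow[of "p - 1" p] by simp
qed

text \<open>The vectors \<open>v(p)\<^sup>\<otimes>\<^sup>j \<otimes> v(q)\<^sup>\<otimes>\<^sup>r\<close>. With \<open>(p, q) = (- 1, 0)\<close> this is a highest weight vector, with \<open>(1, 0)\<close> the lowest
  vector of its \<open>\<ss>\<ll>\<^sub>2\<close>-module, and the translates of the latter have \<open>(p, q) = (2q + 1, 2q)\<close>.\<close>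

definition block_tensor :: "nat \<Rightarrow> nat \<Rightarrow> int \<Rightarrow> int \<Rightarrow> 'v tensor_alg"
  where "block_tensor j r p q = pure_tensors (replicate j (v p) @ replicate r (v q))"

lemma list_all2_blocks:
  assumes "P a a'" "P b b'"
  shows "list_all2 P (replicate j a @ replicate r b) (replicate j a' @ replicate r b')"
proof -
  have "list_all2 P (replicate n x) (replicate n y)" if "P x y" for n x y
    using that by (induction n) auto
  then show ?thesis using assms by (intro list_all2_appendI) auto
qed

lemma top_power_block:
  assumes "top_power act g (v p) (v p')" "top_power act g (v q) (v q')"
  shows "top_power T g (block_tensor j r p q) (block_tensor j r p' q')"
  unfolding block_tensor_def by (intro top_power_pure list_all2_blocks assms)

lemma block_tensor_eigen:
  assumes "act g (v p) = c *\<^sub>C v p" "act g (v q) = d *\<^sub>C v q"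
  shows "T g (block_tensor j r p q) = (of_nat j * c + of_nat r * d) *\<^sub>C block_tensor j r p q"
proof -
  have "sum_list (replicate j c @ replicate r d) = of_nat j * c + of_nat r * d"
    by (simp add: sum_list_replicate)
  moreover have "list_all2 (\<lambda>c x. act g x = c *\<^sub>C x) (replicate j c @ replicate r d)
      (replicate j (v p) @ replicate r (v q))"
    by (intro list_all2_blocks assms)
  ultimately show ?thesis
    unfolding block_tensor_def using T_pure_eigen by metis
qed

lemma block_tensor_zero:
  assumes "act g (v p) = 0" "act g (v q) = 0"
  shows "T g (block_tensor j r p q) = 0"
  unfolding block_tensor_def by (rule T_pure_zero) (use assms in auto)

lemma block_tensor_highest: "highest_weight_vector T (of_nat j) (of_nat (j + r)) (block_tensor j r (-1) 0)"
proof -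
  have "block_tensor j r (-1) 0 \<noteq> 0"
    unfolding block_tensor_def by (rule pure_tensors_nonzero) (use v_simps(1) in auto)
  then show ?thesis
    unfolding highest_weight_vector_def
    using block_tensor_eigen[of "H 0" "-1" 1 0 0 j r] block_tensor_eigen[of K "-1" 1 0 1 j r]
      block_tensor_zero[of D "-1" 0 j r] D_v
    by (auto simp: block_tensor_zero v_simps scaleC_one)
qed

lemma base_block_in_cyclic:
  "block_tensor j r 1 0 \<in> cyclic_submodule T (block_tensor j r (-1) 0)"
proof -
  have "top_power T (F (- 0)) (block_tensor j r (-1) 0) (block_tensor j r 1 0)"
    by (intro top_power_block top_F) auto
  then show ?thesis using submodule_top_power[OF T.submodule_cyclic] T.generator_in_cyclic by blast
qed

text \<open>The reflections in the roots of \<open>e\<^sub>q\<close> and \<open>e\<^sub>2\<^sub>q\<close> compose to the translation by \<open>2q\<close>. For \<open>q \<le> 0\<close> all factors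
  of the tensor have weights of the same sign at both steps, so the reflection of the tensor is the
  tensor of the reflections.\<close>

lemma translate_blocks:
  assumes S: "submodule T S" and "q \<le> 0"
  shows "block_tensor j r 1 0 \<in> S \<Longrightarrow> block_tensor j r (2 * q + 1) (2 * q) \<in> S"
    and "0 \<le> p \<Longrightarrow> tcons (v p) (block_tensor j r 1 0) \<in> S \<Longrightarrow>
      tcons (v (p + 2 * q)) (block_tensor j r (2 * q + 1) (2 * q)) \<in> S"
proof -
  have E: "top_power T (E q) (block_tensor j r 1 0) (block_tensor j r (2 * q - 1) (2 * q))"
    using assms(2) by (intro top_power_block top_E) auto
  have F: "top_power T (F (- (2 * q))) (block_tensor j r (2 * q - 1) (2 * q)) (block_tensor j r (2 * q + 1) (2 * q))"
    by (intro top_power_block top_F) auto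
  show "block_tensor j r (2 * q + 1) (2 * q) \<in> S" if "block_tensor j r 1 0 \<in> S"
    using that submodule_top_power[OF S E] submodule_top_power[OF S F] by blast
  assume p: "0 \<le> p" and *: "tcons (v p) (block_tensor j r 1 0) \<in> S"
  have "tcons (v (2 * q - p)) (block_tensor j r (2 * q - 1) (2 * q)) \<in> S"
    by (rule submodule_top_power[OF S _ *, where g = "E q"]) (intro top_power_tcons top_E E, use p assms(2) in auto)
  then show "tcons (v (p + 2 * q)) (block_tensor j r (2 * q + 1) (2 * q)) \<in> S"
    by (rule submodule_top_power[OF S, where g = "F (- (2 * q))", rotated])
      (intro top_power_tcons top_F F, use p in auto)
qed

definition FH :: "affine_sl2 set"
  where "FH = range F \<union> range H"

text \<open>To see that \<open>e\<^sub>m\<close> maps a translate into the span, descend in \<open>q\<close>: for small \<open>q\<close> the translate is killed, and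
  the translate at \<open>q\<close> is obtained from the one at \<open>q - 1\<close> by applying \<open>f\<close>s, past which \<open>e\<^sub>m\<close> can be
  commuted without changing its degree.\<close>

lemma FH_orbit_submodule:
  "submodule T (cvs.span (orbit T FH {block_tensor j r (2 * q + 1) (2 * q) | q. q \<le> 0}))"
    (is "submodule T ?N")
proof (rule T.submodule_span_orbit)
  let ?w = "\<lambda>q. block_tensor j r (2 * q + 1) (2 * q)"
  have w: "?w q \<in> ?N" if "q \<le> 0" for q
    using that by (intro cvs.span_base orbit.base) auto
  have closed: "T g x \<in> ?N" if "g \<in> FH" "x \<in> ?N" for g x
    by (rule linear_maps_span_into[OF T.linear cvs.subspace_span _ that(2)])
      (rule cvs.span_base, rule orbit.step[OF _ that(1)])
  have eig: "T g (?w q) \<in> ?N" if "g = K \<or> g = D" "q \<le> 0" for g q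
  proof -
    have ex: "\<exists>c. act g (v p) = c *\<^sub>C v p" for p
      using that(1) D_v_eigen v_simps(2)[of p] by (auto intro: exI[of _ 1] simp: scaleC_one)
    obtain c d where "act g (v (2 * q + 1)) = c *\<^sub>C v (2 * q + 1)" "act g (v (2 * q)) = d *\<^sub>C v (2 * q)"
      using ex by blast
    then have "T g (?w q) = (of_nat j * c + of_nat r * d) *\<^sub>C ?w q"
      by (rule block_tensor_eigen)
    then show ?thesis using w[OF that(2)] by (simp only: cvs.span_scale)
  qed
  have K: "T K x \<in> ?N" if x: "x \<in> ?N" for x
  proof (rule linear_maps_span_into[OF T.linear cvs.subspace_span _ x])
    fix b assume "b \<in> orbit T FH {?w q | q. q \<le> 0}"
    then show "T K b \<in> ?N"
    proof induction
      case (base b)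
      then show ?case using eig by blast
    next
      case (step b g)
      then show ?case unfolding T.swap_K[of g b] by (intro closed[of g])
    qed
  qed
  have N: "cvs.subspace ?N" by simp
  have E: "T (E m) (?w q) \<in> ?N" if "q \<le> 0" for m q
    using that
  proof (induction "nat (2 * q + 1 - m)" arbitrary: q rule: less_induct)
    case less
    show ?case
    proof (cases "2 * q + 1 \<le> m")
      case True
      then show ?thesis by (simp add: block_tensor_zero v_simps cvs.span_zero)
    next
      case False
      let ?G = "\<lambda>x. x \<in> ?N \<and> T (E m) x \<in> ?N"
      have G_F: "?G (T (F a) x)" if "?G x" for a x
      proof -
        have "T (E m) (T (F a) x) = T (F a) (T (E m) x) + T (H (m + a)) x
            + (if m + a = 0 then of_int m else 0) *\<^sub>C T K x"
          using T.swap_EF[of m a x] by simp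
        moreover have "T (F a) (T (E m) x) \<in> ?N" "T (H (m + a)) x \<in> ?N" "T (F a) x \<in> ?N"
          using that closed[of "F a"] closed[of "H (m + a)"] by (auto simp: FH_def)
        ultimately show ?thesis
          using K that by (simp add: cvs.span_add cvs.span_scale)
      qed
      have G_top: "?G x'" if top: "top_power T (F a) x x'" and Gx: "?G x" for a x x'
      proof -
        obtain s c where c: "c \<noteq> 0" "(T (F a) ^^ s) x = c *\<^sub>C x'"
          using top by (auto simp: top_power_def)
        have "?G ((T (F a) ^^ s) x)"
          using Gx G_F by (induction s) auto
        then have "?G (inverse c *\<^sub>C (c *\<^sub>C x'))"
          unfolding c(2) by (simp only: T.act_scale cvs.span_scale simp_thms)
        then show ?thesis using c(1) by (simp add: scaleC_one)
      qed
      have "?G (?w (q - 1))"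
      proof
        show "?w (q - 1) \<in> ?N" using w[of "q - 1"] less.prems by simp
        show "T (E m) (?w (q - 1)) \<in> ?N"
          by (rule less.hyps) (use False less.prems in auto)
      qed
      moreover have "top_power T (F (- (2 * q - 1))) (?w (q - 1)) (block_tensor j r (2 * q - 1) (2 * q))"
        by (intro top_power_block top_F) auto
      moreover have "top_power T (F (- (2 * q))) (block_tensor j r (2 * q - 1) (2 * q)) (?w q)"
        by (intro top_power_block top_F) auto
      ultimately show ?thesis using G_top by blast
    qed
  qed
  fix x g assume "x \<in> {?w q | q. q \<le> 0}"
  then obtain q where q: "q \<le> 0" "x = ?w q" by blast
  show "T g x \<in> ?N"
    using E[OF q(1)] eig[of g, OF _ q(1)] closed[OF _ w[OF q(1)], of g]
    by (cases g) (auto simp: FH_def q(2))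
qed

context
  fixes j r :: nat and e :: int and S :: "'v tensor_alg set"
  assumes S: "submodule T S"
    and gen: "\<And>p. 2 \<le> p \<Longrightarrow> even (p - e) \<Longrightarrow> tcons (v p) (block_tensor j r 1 0) \<in> S"
begin

interpretation W: highest_weight_module T "of_nat j" "of_nat (j + r)" "block_tensor j r (-1) 0"
  using T.affine_sl2_module_axioms block_tensor_highest
  by (simp add: highest_weight_module_def highest_weight_module_axioms_def)

abbreviation "W \<equiv> cyclic_submodule T (block_tensor j r (-1) 0)"

lemma submodule_W: "submodule T W" by (rule T.submodule_cyclic)

text \<open>Only the parameters \<open>p\<close> of the parity of \<open>e\<close> occur, since the others belong to the other component.\<close>

definition asymptotic :: "'v tensor_alg \<Rightarrow> bool"
  where "asymptotic t \<longleftrightarrow> t \<in> W \<and> (\<forall>\<^sub>F p in at_top. even (p - e) \<longrightarrow> tcons (v p) t \<in> S)"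

lemma asymptotic_subspace: "cvs.subspace {t. asymptotic t}"
proof (rule cvs.subspaceI)
  show "0 \<in> {t. asymptotic t}"
    using submodule_zero[OF submodule_W] submodule_zero[OF S] by (simp add: asymptotic_def tcons_right)
  show "x + y \<in> {t. asymptotic t}" if "x \<in> {t. asymptotic t}" "y \<in> {t. asymptotic t}" for x y
    using that unfolding asymptotic_def mem_Collect_eq
    by (auto simp: submodule_add[OF submodule_W] tcons_right elim: eventually_elim2 intro: submodule_add[OF S])
  show "c *\<^sub>C x \<in> {t. asymptotic t}" if "x \<in> {t. asymptotic t}" for c x
    using that unfolding asymptotic_def mem_Collect_eq
    by (auto simp: submodule_scale[OF submodule_W] tcons_right elim: eventually_mono intro: submodule_scale[OF S])
qed

lemma asymptotic_act:
  assumes "asymptotic t" "\<forall>\<^sub>F p in at_top. \<exists>c. act g (v p) = c *\<^sub>C v p"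
  shows "asymptotic (T g t)"
proof -
  have "\<forall>\<^sub>F p in at_top. even (p - e) \<longrightarrow> tcons (v p) (T g t) \<in> S"
    using assms(2) conjunct2[OF assms(1)[unfolded asymptotic_def]]
  proof eventually_elim
    case (elim p)
    show ?case
    proof
      assume "even (p - e)"
      then have "tcons (v p) t \<in> S" using elim by blast
      moreover obtain c where "act g (v p) = c *\<^sub>C v p" using elim by blast
      then have "tcons (v p) (T g t) = T g (tcons (v p) t) - c *\<^sub>C tcons (v p) t"
        by (simp add: T_tcons tcons_left)
      ultimately show "tcons (v p) (T g t) \<in> S"
        by (simp add: submodule_diff[OF S] submodule_act[OF S] submodule_scale[OF S])
    qed
  qed
  then show ?thesis using assms(1) submodule_act[OF submodule_W] by (simp add: asymptotic_def)
qed

text \<open>The second term of \<open>e\<^sub>m (v(p) \<otimes> t)\<close> vanishes because \<open>m = p - 1 - n\<close> grows with \<open>p\<close>.\<close>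

lemma asymptotic_E_v:
  assumes "asymptotic t"
  shows "\<forall>\<^sub>F p in at_top. even (p - e) \<longrightarrow> tcons (act (E (p - 1 - int n)) (v p)) t \<in> S"
proof -
  obtain N where N: "\<forall>m\<ge>N. T (E m) t = 0"
    using W.L_restricted[of t] assms unfolding asymptotic_def by blast
  have "\<forall>\<^sub>F p in at_top. p \<ge> N + 1 + int n" by (rule eventually_ge_at_top)
  then show ?thesis
    using conjunct2[OF assms[unfolded asymptotic_def]]
  proof eventually_elim
    case (elim p)
    have "tcons (act (E (p - 1 - int n)) (v p)) t = T (E (p - 1 - int n)) (tcons (v p) t)"
      using N elim by (simp add: T_tcons tcons_right)
    then show ?case using elim submodule_act[OF S] by simp
  qed
qed

text \<open>By induction the summands of the recursion with \<open>a < n\<close> are in \<open>S\<close> after tensoring with \<open>t\<close>, because \<open>h\<^sub>-\<^sub>a\<close>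
  can be moved to the second factor. So the remaining summand, \<open>h\<^sub>-\<^sub>n v(p - 2)\<close> up to a scalar, is in \<open>S\<close>
  too, and in it \<open>h\<^sub>-\<^sub>n\<close> can be moved to \<open>t\<close> again.\<close>

lemma asymptotic_H_negative:
  "n > 0 \<Longrightarrow> asymptotic t \<Longrightarrow> asymptotic (T (H (- int n)) t)"
proof (induction n arbitrary: t rule: less_induct)
  case (less n)
  let ?y = "\<lambda>p n. act (E (p - 1 - int n)) (v p)"
  have lower: "\<forall>\<^sub>F p in at_top. even (p - e) \<longrightarrow> tcons (act (H (- int a)) (?y p (n - a))) t \<in> S"
    if "a \<in> {1..<n}" for a
  proof -
    have "asymptotic (T (H (- int a)) t)" using less that by auto
    from asymptotic_E_v[OF this, of "n - a"] asymptotic_E_v[OF less.prems(2), of "n - a"]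
    show ?thesis
    proof eventually_elim
      case (elim p)
      have "tcons (act (H (- int a)) (?y p (n - a))) t
        = T (H (- int a)) (tcons (?y p (n - a)) t) - tcons (?y p (n - a)) (T (H (- int a)) t)"
        by (simp add: T_tcons)
      then show ?case using elim by (auto intro: submodule_diff[OF S] submodule_act[OF S])
    qed
  qed
  have "\<forall>\<^sub>F p in at_top. \<forall>a\<in>{1..<n}. even (p - e) \<longrightarrow> tcons (act (H (- int a)) (?y p (n - a))) t \<in> S"
    using lower by (intro eventually_ball_finite) auto
  then have "\<forall>\<^sub>F p in at_top. even (p - e) \<longrightarrow> tcons (v (p - 2)) (T (H (- int n)) t) \<in> S"
    using asymptotic_E_v[OF less.prems(2), of n] asymptotic_E_v[OF less.prems(2), of 0]
  proof eventually_elim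
    case (elim p)
    show ?case
    proof
      assume p: "even (p - e)"
      have "of_nat n *\<^sub>C ?y p n = (\<Sum>a = 1..n. act (H (- int a)) (?y p (n - a)))"
        unfolding recursion by (intro sum.cong refl) (auto simp: of_nat_diff algebra_simps)
      also have "{1..n} = insert n {1..<n}" using less.prems(1) by auto
      finally have "of_nat n *\<^sub>C ?y p n
        = act (H (- int n)) (?y p 0) + (\<Sum>a = 1..<n. act (H (- int a)) (?y p (n - a)))"
        by simp
      then have y: "tcons (act (H (- int n)) (?y p 0)) t = of_nat n *\<^sub>C tcons (?y p n) t
          - (\<Sum>a = 1..<n. tcons (act (H (- int a)) (?y p (n - a))) t)"
        by (simp add: eq_diff_eq tcons_left flip: cvs_pair.linear_sum[OF clinear_tcons_left] tcons_left(2))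
      then have H: "tcons (act (H (- int n)) (?y p 0)) t \<in> S"
        unfolding y using elim p
        by (intro submodule_diff[OF S] submodule_scale[OF S] submodule_sum[OF S]) blast+
      obtain c where c: "c \<noteq> 0" "?y p 0 = c *\<^sub>C v (p - 2)" using lower_E[of p] by auto
      have "tcons (?y p 0) (T (H (- int n)) t)
          = T (H (- int n)) (tcons (?y p 0) t) - tcons (act (H (- int n)) (?y p 0)) t"
        by (simp add: T_tcons)
      also have "\<dots> \<in> S"
        using H elim p by (auto intro: submodule_diff[OF S] submodule_act[OF S])
      finally show "tcons (v (p - 2)) (T (H (- int n)) t) \<in> S"
        unfolding c(2) tcons_left using submodule_scale_cancel[OF S _ c(1)] by blast
    qed
  qed
  then obtain P where P: "\<And>p. p \<ge> P \<Longrightarrow> even (p - e) \<Longrightarrow> tcons (v (p - 2)) (T (H (- int n)) t) \<in> S"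
    unfolding eventually_at_top_linorder by blast
  have "tcons (v p) (T (H (- int n)) t) \<in> S" if "p \<ge> P" "even (p - e)" for p
    using P[of "p + 2"] that by simp
  then show ?case
    using less.prems(2) submodule_act[OF submodule_W] unfolding asymptotic_def eventually_at_top_linorder by blast
qed

lemma asymptotic_W:
  assumes "t \<in> W"
  shows "asymptotic t"
proof -
  let ?X = "{block_tensor j r (2 * q + 1) (2 * q) | q. q \<le> 0}"
  have "asymptotic t" if "t \<in> orbit T FH ?X" for t
    using that
  proof induction
    case (base t)
    then obtain q where q: "q \<le> 0" "t = block_tensor j r (2 * q + 1) (2 * q)" by blast
    have "tcons (v p) t \<in> S" if "p \<ge> 2 + 2 * q" "even (p - e)" for p
      using translate_blocks(2)[OF S q(1), of "p - 2 * q" j r] gen[of "p - 2 * q"] that q by simp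
    then show ?case
      using translate_blocks(1)[OF submodule_W q(1) base_block_in_cyclic] q(2)
      unfolding asymptotic_def eventually_at_top_linorder by blast
  next
    case (step t g)
    from step.hyps(2) consider (F) m where "g = F m" | (H) m where "g = H m" "m \<ge> 0"
      | (H') n where "g = H (- int n)" "n > 0"
    proof -
      have "\<exists>n. m = - int n \<and> n > 0" if "m < 0" for m using that by (intro exI[of _ "nat (- m)"]) auto
      then show thesis using step.hyps(2) that by (auto simp: FH_def) (metis linorder_not_less)
    qed
    then show ?case
    proof cases
      case F
      have "\<forall>\<^sub>F p in at_top. p \<ge> - m" by (rule eventually_ge_at_top)
      then have "\<forall>\<^sub>F p in at_top. \<exists>c. act g (v p) = c *\<^sub>C v p"
        by eventually_elim (auto simp: F v_simps intro: exI[of _ 0])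
      then show ?thesis using asymptotic_act step.IH by blast
    next
      case H
      have "\<exists>c. act g (v p) = c *\<^sub>C v p" for p
      proof (cases "m = 0")
        case True
        then show ?thesis using H v_simps(3)[of p] by (intro exI[of _ "- of_int p"]) simp
      next
        case False
        then show ?thesis using H v_simps(6)[of m p] by (intro exI[of _ 0]) simp
      qed
      then show ?thesis using asymptotic_act step.IH by simp
    next
      case H'
      then show ?thesis using asymptotic_H_negative step.IH by simp
    qed
  qed
  then have "cvs.span (orbit T FH ?X) \<subseteq> {t. asymptotic t}"
    by (intro cvs.span_minimal asymptotic_subspace) blast
  moreover have "W \<subseteq> cvs.span (orbit T FH ?X)"
  proof (rule T.cyclic_subset_submodule[OF FH_orbit_submodule])
    have "block_tensor j r 1 0 \<in> ?X" by (intro CollectI exI[of _ 0]) simp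
    then have "block_tensor j r 1 0 \<in> cvs.span (orbit T FH ?X)"
      by (intro cvs.span_base orbit.base)
    moreover have "top_power T (E 0) (block_tensor j r 1 0) (block_tensor j r (-1) 0)"
      by (intro top_power_block top_E) auto
    ultimately show "block_tensor j r (-1) 0 \<in> cvs.span (orbit T FH ?X)"
      using submodule_top_power[OF FH_orbit_submodule] by blast
  qed
  ultimately show ?thesis using assms by blast
qed

text \<open>For large \<open>p\<close> this holds because \<open>t\<close> is asymptotic. Applying \<open>e\<^sub>p\<^sub>-\<^sub>1\<close> replaces \<open>p\<close> by \<open>p - 2\<close>, with an error term
  in which \<open>t\<close> is replaced by \<open>e\<^sub>p\<^sub>-\<^sub>1 t\<close>, a vector of smaller \<open>D\<close>-degree.\<close>

lemma tcons_eigenvector_in_S: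
  "t \<in> W \<Longrightarrow> T D t = of_nat b *\<^sub>C t \<Longrightarrow> 0 \<le> p \<Longrightarrow> even (p - e) \<Longrightarrow> tcons (v p) t \<in> S"
proof (induction b arbitrary: t p rule: less_induct)
  case (less b)
  have descend: "tcons (v (p - 2)) t \<in> S" if p: "2 \<le> p" "even (p - e)" "tcons (v p) t \<in> S" for p
  proof -
    have "tcons (v p) (T (E (p - 1)) t) \<in> S"
    proof (cases "T (E (p - 1)) t = 0")
      case True
      then show ?thesis by (simp add: tcons_right submodule_zero[OF S])
    next
      case False
      have EW: "T (E (p - 1)) t \<in> W" using less.prems(1) by (rule submodule_act[OF submodule_W])
      have eig: "T D (T (E (p - 1)) t) = (of_nat b - of_int (p - 1)) *\<^sub>C T (E (p - 1)) t"
        by (simp only: T.swap_DE less.prems(2) T.act_scale cvs.scale_left_diff_distrib)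
      obtain b' where b': "of_nat b - of_int (p - 1) = (of_nat b' :: complex)"
        using W.D_eigenvalue_nat[OF EW False eig] by blast
      then have "of_int (int b) = (of_int (int b' + (p - 1)) :: complex)" by (simp add: diff_eq_eq)
      then have "int b = int b' + (p - 1)" by (simp only: of_int_eq_iff)
      then have "b' < b" using p(1) by simp
      then show ?thesis using less.IH[OF _ EW] eig[unfolded b'] p by simp
    qed
    moreover obtain c where c: "c \<noteq> 0" "act (E (p - 1)) (v p) = c *\<^sub>C v (p - 2)" using lower_E by blast
    have "c *\<^sub>C tcons (v (p - 2)) t = T (E (p - 1)) (tcons (v p) t) - tcons (v p) (T (E (p - 1)) t)"
      by (simp add: T_tcons c(2) tcons_left)
    ultimately show ?thesis
      using submodule_scale_cancel[OF S _ c(1)] submodule_diff[OF S] submodule_act[OF S p(3)] by simp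
  qed
  have down: "tcons (v (p + 2 * int n)) t \<in> S \<Longrightarrow> 0 \<le> p \<Longrightarrow> even (p - e) \<Longrightarrow> tcons (v p) t \<in> S" for n p
  proof (induction n)
    case (Suc n)
    have "p + 2 * int (Suc n) - 2 = p + 2 * int n" by simp
    then show ?case using descend[of "p + 2 * int (Suc n)"] Suc by simp
  qed simp
  obtain P where P: "\<And>p. p \<ge> P \<Longrightarrow> even (p - e) \<Longrightarrow> tcons (v p) t \<in> S"
    using asymptotic_W[OF less.prems(1)] unfolding asymptotic_def eventually_at_top_linorder by blast
  show ?case
    using down[of p "nat (P - p)"] P[of "p + 2 * int (nat (P - p))"] less.prems(3,4) by simp
qed

text \<open>The vectors whose product with all of \<open>W\<close> lies in \<open>S\<close> form a submodule, so a single extremal vector suffices.\<close>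

lemma tcons_in_S:
  assumes "0 \<le> e" "y \<in> cyclic_submodule act (v (- e))" "t \<in> W"
  shows "tcons y t \<in> S"
proof -
  let ?R = "{y. \<forall>t\<in>W. tcons y t \<in> S}"
  have "submodule act ?R"
    unfolding submodule_def
  proof (intro conjI allI ballI)
    show "cvs.subspace ?R"
      by (rule cvs.subspaceI)
        (auto simp: tcons_left submodule_zero[OF S] submodule_add[OF S] submodule_scale[OF S])
    fix g y assume y: "y \<in> ?R"
    have "tcons (act g y) t = T g (tcons y t) - tcons y (T g t)" for t by (simp add: T_tcons)
    then show "act g y \<in> ?R"
      using y submodule_act[OF submodule_W] by (auto intro!: submodule_diff[OF S] submodule_act[OF S])
  qed
  moreover have "v e \<in> ?R"
  proof (intro CollectI ballI)
    fix t assume "t \<in> W"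
    then have "t \<in> cvs.span {x \<in> W. \<exists>a b. W.weight a b x}" using W.L_eq_span_weights by simp
    then show "tcons (v e) t \<in> S"
    proof (rule linear_maps_span_into[OF clinear_tcons_right, rotated 2])
      show "cvs.subspace S" using S by (simp add: submodule_def)
      show "tcons (v e) b \<in> S" if "b \<in> {x \<in> W. \<exists>a b. W.weight a b x}" for b
        using that tcons_eigenvector_in_S[of b _ e] assms(1) by (auto simp: W.weight_def)
    qed
  qed
  then have "v (- e) \<in> ?R"
    using submodule_top_power[OF \<open>submodule act ?R\<close> top_E[of 0 e "- e"]] assms(1) by simp
  ultimately show ?thesis
    using cyclic_subset_submodule assms(2,3) by blast
qed

end

end

section \<open>The tensor product as a limit\<close>

theorem corollary5p1:
  fixes k i j :: nat
    and L01 :: "affine_sl2 \<Rightarrow> 'a::complex_vector \<Rightarrow> 'a"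
    and L11 :: "affine_sl2 \<Rightarrow> 'b::complex_vector \<Rightarrow> 'b"
    and Li1 :: "affine_sl2 \<Rightarrow> 'c::complex_vector \<Rightarrow> 'c"
    and Ljk :: "affine_sl2 \<Rightarrow> 'd::complex_vector \<Rightarrow> 'd"
    and v :: "int \<Rightarrow> 'a \<times> 'b"
  assumes "k \<ge> 1" and "i \<in> {0, 1}" and "j \<le> k"
    and "is_L 0 1 L01" and "is_L 1 1 L11" and "is_L i 1 Li1" and "is_L j k Ljk"
    and "extremal_family (direct_sum_act L01 L11) v"
  shows "let M = (\<lambda>n. fusion_L (direct_sum_act L01 L11) v (ones_and (k + 1) (2 * n + i - 1) (j + 1)))
    in (\<forall>n\<ge>1. M n \<subseteq> M (n + 1)) \<and>
       (\<exists>\<phi>. module_iso_onto (tensor_act Li1 Ljk) (tensor_alg_act (direct_sum_act L01 L11))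
              (\<Union>n\<in>{1..}. M n) \<phi>)"
proof -
  let ?V = "direct_sum_act L01 L11"
  let ?T = "tensor_alg_act ?V"
  interpret V: extremal_family_module ?V v
    by (rule extremal_family_module_direct_sum) (use assms in auto)
  interpret T: affine_sl2_module ?T
    by (rule tensor_alg_act_module) (rule V.affine_sl2_module_axioms)
  interpret A: affine_sl2_module Li1 using assms(6) by (simp add: is_L_def)
  interpret B: affine_sl2_module Ljk using assms(7) by (simp add: is_L_def)
  define r where "r = k - j"
  have k: "j + r = k" using assms(3) by (simp add: r_def)
  let ?w = "V.block_tensor j r 1 0" and ?z = "V.block_tensor j r (-1) 0"
  define M where "M n = fusion_L ?V v (ones_and (k + 1) (2 * n + i - 1) (j + 1))" for n
  have M: "M n = cyclic_submodule ?T (tcons (v (2 * int n + int i)) ?w)" if "n \<ge> 1" for n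
  proof -
    have "Suc (2 * n + i - 1) = 2 * n + i" using that by simp
    then show ?thesis
      unfolding M_def fusion_L_def V.block_tensor_def tcons_pure
      using tail_sums_ones_and[OF assms(3), of "2 * n + i - 1"] by (simp add: r_def map_replicate_const)
  qed
  have sub_M: "submodule ?T (M n)" if "n \<ge> 1" for n
    unfolding M[OF that] by (rule T.submodule_cyclic)
  have gen_M: "tcons (v (2 * int n + int i)) ?w \<in> M n" if "n \<ge> 1" for n
    unfolding M[OF that] by (rule T.generator_in_cyclic)
  have mono: "M n \<subseteq> M (n + 1)" if "n \<ge> 1" for n
  proof -
    let ?p = "2 * int n + int i"
    \<comment> \<open>The first factor is reflected; the others are killed because \<open>?p + 1 \<ge> 1\<close>.\<close>
    have "top_power ?T (E (?p + 1)) (tcons (v (?p + 2)) ?w) (tcons (v ?p) ?w)"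
      by (intro V.top_power_tcons V.top_E V.top_power_block V.top_trivial V.v_simps(4)) auto
    moreover have "tcons (v (?p + 2)) ?w \<in> M (n + 1)"
      using gen_M[of "n + 1"] by (simp add: algebra_simps)
    ultimately have "tcons (v ?p) ?w \<in> M (n + 1)"
      using submodule_top_power[OF sub_M[of "n + 1"]] by simp
    then show ?thesis
      unfolding M[OF that] using T.cyclic_subset_submodule[OF sub_M[of "n + 1"]] by simp
  qed
  have mono': "M m \<subseteq> M n" if "1 \<le> m" "m \<le> n" for m n
    using that(2)
  proof (induction n rule: dec_induct)
    case (step n)
    then show ?case using mono[of n] that(1) by auto
  qed simp
  let ?S = "\<Union>n\<in>{1..}. M n"
  have S: "submodule ?T ?S"
  proof -
    have "x + y \<in> ?S" if xy: "x \<in> ?S" "y \<in> ?S" for x y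
    proof -
      obtain m n where mn: "m \<ge> 1" "x \<in> M m" "n \<ge> 1" "y \<in> M n" using xy by auto
      then have "x \<in> M (max m n)" "y \<in> M (max m n)"
        using mono'[of m "max m n"] mono'[of n "max m n"] by auto
      then have "x + y \<in> M (max m n)" using mn by (intro submodule_add[OF sub_M]) auto
      then show ?thesis using mn(1) by (intro UN_I[of "max m n"]) auto
    qed
    moreover have "0 \<in> ?S" using submodule_zero[OF sub_M[of 1]] by (intro UN_I[of 1]) auto
    moreover have "c *\<^sub>C x \<in> ?S" "?T g x \<in> ?S" if x: "x \<in> ?S" for c g x
    proof -
      obtain n where n: "n \<ge> 1" "x \<in> M n" using x by auto
      show "c *\<^sub>C x \<in> ?S"
        using submodule_scale[OF sub_M[OF n(1)] n(2)] n(1) by (intro UN_I[of n]) auto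
      show "?T g x \<in> ?S"
        using submodule_act[OF sub_M[OF n(1)] n(2)] n(1) by (intro UN_I[of n]) auto
    qed
    ultimately show ?thesis by (intro submoduleI)
  qed
  have nil: "\<exists>N. (?T g ^^ N) t = 0" if "g \<in> {F 0, E (-1)}" for g t
    using that V.nil_F V.nil_E by (intro V.nilpotent_tensor_alg) auto
  have nilA: "\<exists>N. (Li1 g ^^ N) t = 0" if "g \<in> {F 0, E (-1)}" for g t
    using that assms(6) by (auto simp: is_L_def integrable_module_def)
  have nilB: "\<exists>N. (Ljk g ^^ N) t = 0" if "g \<in> {F 0, E (-1)}" for g t
    using that assms(7) by (auto simp: is_L_def integrable_module_def)
  \<comment> \<open>\<open>v(0)\<close> and \<open>v(- 1)\<close> are the highest weight vectors of the two level one modules.\<close>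
  have "highest_weight_vector ?V (of_nat i) (of_nat 1) (v (- int i))"
    using assms(2) V.D_v unfolding highest_weight_vector_def by (auto simp: V.v_simps scaleC_one)
  moreover obtain x where "highest_weight_vector Li1 (of_nat i) (of_nat 1) x" "cyclic_submodule Li1 x = UNIV"
    using assms(6) by (auto simp: is_L_def)
  ultimately obtain \<iota> where iota: "clinear \<iota>" "inj \<iota>" "range \<iota> = cyclic_submodule ?V (v (- int i))"
    "\<And>g u. \<iota> (Li1 g u) = ?V g (\<iota> u)"
    using highest_weight_module_iso[OF A.affine_sl2_module_axioms V.affine_sl2_module_axioms]
      nilA V.nil_F V.nil_E by (metis insertCI)
  obtain x where "highest_weight_vector Ljk (of_nat j) (of_nat k) x" "cyclic_submodule Ljk x = UNIV"
    using assms(7) by (auto simp: is_L_def)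
  moreover have "highest_weight_vector ?T (of_nat j) (of_nat k) ?z"
    using V.block_tensor_highest[of j r] k by simp
  ultimately obtain \<psi> where psi: "clinear \<psi>" "inj \<psi>" "range \<psi> = cyclic_submodule ?T ?z"
    "\<And>g u. \<psi> (Ljk g u) = ?T g (\<psi> u)"
    using highest_weight_module_iso[OF B.affine_sl2_module_axioms T.affine_sl2_module_axioms]
      nilB nil by (metis insertCI)
  let ?\<beta> = "\<lambda>a b. tcons (\<iota> a) (\<psi> b)"
  have bil: "clinear (\<lambda>a. ?\<beta> a b)" "clinear (?\<beta> a)" for a b
    using Vector_Spaces.linear_compose[OF iota(1) clinear_tcons_left]
      Vector_Spaces.linear_compose[OF psi(1) clinear_tcons_right] by (simp_all add: o_def)
  define \<phi> where "\<phi> = tensor_lift ?\<beta>"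
  have phi: "clinear \<phi>" unfolding \<phi>_def by (rule tensor_lift_linear[OF bil])
  have phi_pure: "\<phi> (tensor_pure a b) = ?\<beta> a b" for a b
    unfolding \<phi>_def by (rule tensor_lift_pure[OF bil])
  have act: "\<phi> (tensor_act Li1 Ljk g t) = ?T g (\<phi> t)" for g t
  proof (rule tensor_linear_eqI[of "\<lambda>t. \<phi> (tensor_act Li1 Ljk g t)" "\<lambda>t. ?T g (\<phi> t)" t])
    have "clinear (tensor_act Li1 Ljk g)"
      unfolding tensor_act_def by (intro tensor_lift_linear tensor_act_bilinear A.linear B.linear)
    then show "clinear (\<lambda>t. \<phi> (tensor_act Li1 Ljk g t))"
      using Vector_Spaces.linear_compose[OF _ phi] by (fastforce simp: o_def)
    show "clinear (\<lambda>t. ?T g (\<phi> t))"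
      using Vector_Spaces.linear_compose[OF phi T.linear] by (simp add: o_def)
    show "\<phi> (tensor_act Li1 Ljk g (tensor_pure a b)) = ?T g (\<phi> (tensor_pure a b))" for a b
      by (simp add: tensor_act_pure[of Li1 g Ljk, OF A.linear B.linear] cvs_pair.linear_add[OF phi] phi_pure
          iota(4) psi(4) V.T_tcons)
  qed
  \<comment> \<open>A left inverse of \<open>\<phi>\<close> is assembled from linear left inverses of \<open>\<iota>\<close> and \<open>\<psi>\<close>.\<close>
  have "inj \<phi>"
  proof -
    obtain \<iota>' where iota': "clinear \<iota>'" "\<iota>' \<circ> \<iota> = id"
      using cvs_pair.linear_injective_left_inverse[OF iota(1,2)] by blast
    obtain \<psi>' where psi': "clinear \<psi>'" "\<psi>' \<circ> \<psi> = id"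
      using cvs_pair.linear_injective_left_inverse[OF psi(1,2)] by blast
    obtain \<Lambda> where L: "clinear \<Lambda>" "\<And>y t. \<Lambda> (tcons y t) = tensor_pure (\<iota>' y) (\<psi>' t)"
    proof (rule tcons_lift[of "\<lambda>y t. tensor_pure (\<iota>' y) (\<psi>' t)"])
      show "clinear (\<lambda>y. tensor_pure (\<iota>' y) (\<psi>' t))" for t
        using Vector_Spaces.linear_compose[OF iota'(1) tensor_pure_bilinear(1)] by (simp add: o_def)
      show "clinear (\<lambda>t. tensor_pure (\<iota>' y) (\<psi>' t))" for y
        using Vector_Spaces.linear_compose[OF psi'(1) tensor_pure_bilinear(2)] by (simp add: o_def)
    qed (rule that)
    have "\<Lambda> (\<phi> t) = t" for t
    proof (rule tensor_linear_eqI[of "\<lambda>t. \<Lambda> (\<phi> t)" "\<lambda>t. t" t])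
      show "clinear (\<lambda>t. \<Lambda> (\<phi> t))"
        using Vector_Spaces.linear_compose[OF phi L(1)] by (simp add: o_def)
      show "clinear (\<lambda>t :: ('c, 'd) tensor. t)" by (rule clinearI) simp_all
      show "\<Lambda> (\<phi> (tensor_pure a b)) = tensor_pure a b" for a b
        using iota'(2) psi'(2) by (simp add: phi_pure L(2) fun_eq_iff)
    qed
    then show ?thesis by (rule inj_on_inverseI)
  qed
  moreover have "range \<phi> = ?S"
  proof
    have gen_S: "tcons (v p) ?w \<in> ?S" if p_ge: "2 \<le> p" and p_even: "even (p - int i)" for p
    proof -
      obtain d where "p - int i = 2 * d" using p_even by (elim evenE)
      then have p: "p = 2 * int (nat d) + int i" "nat d \<ge> 1" using p_ge assms(2) by auto
      show ?thesis unfolding p(1) using gen_M[OF p(2)] p(2) by (intro UN_I[of "nat d"]) auto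
    qed
    have pure: "\<phi> (tensor_pure a b) \<in> ?S" for a b
      unfolding phi_pure
      by (rule V.tcons_in_S[OF S gen_S, of "int i"]) (use iota(3) psi(3) in auto)
    have "\<phi> t \<in> ?S" for t
      by (rule linear_maps_span_into[OF phi _ _ tensor_span]) (use S pure in \<open>auto simp: submodule_def\<close>)
    then show "range \<phi> \<subseteq> ?S" by blast
    have R: "submodule ?T (range \<phi>)"
      unfolding submodule_def using act[symmetric] cvs_pair.linear_subspace_image[OF phi cvs.subspace_UNIV] by auto
    have "M n \<subseteq> range \<phi>" if n: "n \<ge> 1" for n
      unfolding M[OF n]
    proof (rule T.cyclic_subset_submodule[OF R])
      have "top_power ?V (F (- int n)) (v (- int i)) (v (2 * int n + int i))"
        by (intro V.top_F) auto
      then have "v (2 * int n + int i) \<in> range \<iota>"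
        unfolding iota(3) using submodule_top_power[OF V.submodule_cyclic] V.generator_in_cyclic by blast
      moreover have "?w \<in> range \<psi>" unfolding psi(3) by (rule V.base_block_in_cyclic)
      ultimately obtain a b where "v (2 * int n + int i) = \<iota> a" "?w = \<psi> b" by blast
      then show "tcons (v (2 * int n + int i)) ?w \<in> range \<phi>" by (metis phi_pure rangeI)
    qed
    then show "?S \<subseteq> range \<phi>" by auto
  qed
  ultimately have "module_iso_onto (tensor_act Li1 Ljk) ?T ?S \<phi>"
    using S phi act unfolding module_iso_onto_def bij_betw_def by simp
  then show ?thesis using mono unfolding Let_def M_def[symmetric] by blast
qed

end
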